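(* Let $\mathcal{G}$ be the group of translations of $\mathbb{R}^d$, and suppose that $W$, $\mathcal{G}$, $K$, $L=\{L_t\}$, $u_0$, $f$ satisfy conditions (W1)-(W4) and (i)-(iv) listed in the context. Let $\{\nu_t(A),t\in(0,T)\}$ be a family of measures on Borel subsets of $\mathbb{R}^d$ such that $\nu_t(\{0\})=0$ for any $t\in(0,T)$; for each Borel $A$, $\nu_t(A)$ is a Borel measurable function of $t\in(0,T)$; and $$\int_{\mathbb{R}^d}(1\wedge|x|^2)\,\nu_t(dx)<\infty\ \ \forall t\in(0,T),\qquad\int_{(0,T)\times\mathbb{R}^d}(1\wedge|x|^2)\,\nu_t(dx)\,dt<\infty.$$ Set $L^0_t=L_t+J_{\nu_t}$, where $$J_\nu\phi(x)=\int_{\mathbb{R}^d}\big[\phi(x+y)-\phi(x)-y^iD_i\phi(x)\,I_{\{|y|\le1\}}(y)\big]\,\nu(dy),\quad\phi\in C_0^\infty(\mathbb{R}^d).$$ Then for any $h\in B((0,T),\mathcal{G})$ there exists $u\in W$ such that for any $\zeta\in C_0^\infty(\mathbb{R}^d)$ and $t\in[0,T]$ $$(u_t,\zeta)=(u_0,\zeta)+\int_0^t(u_s,L^0_s\zeta)\,ds+\int_0^t(h_sf_s,\zeta)\,ds.$$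
   Context: Fix $T\in(0,\infty)$, $K\in[0,\infty)$, $d\ge1$. Summation over repeated indices is understood; $D_i=\partial/\partial x^i$. $B(\mathbb{R}^d)$ is the space of bounded real Borel functions on $\mathbb{R}^d$, $B((0,T)\times\mathbb{R}^d)$ that of bounded real Borel functions on $(0,T)\times\mathbb{R}^d$; $(\phi,\psi)=\int_{\mathbb{R}^d}\phi\psi\,dx$. $W$ is a set of real-valued Borel functions $u=u_t(x)$ on $[0,T]\times\mathbb{R}^d$. For a function $\phi$ on $\mathbb{R}^d$ and $g\in\mathcal{G}$, $(g\phi)(x)=\phi(gx)$. $B((0,T),\mathcal{G})$ is the set of bounded measurable $\mathcal{G}$-valued functions on $(0,T)$ (a translation $x\mapsto x+b$ being identified with $b\in\mathbb{R}^d$). $f\in B((0,T)\times\mathbb{R}^d)$ and $u_0\in B(\mathbb{R}^d)$ are fixed. $L=\{L_t,t\in(0,T)\}$ is a family of linear operators $L_t:C_0^\infty(\mathbb{R}^d)\to B(\mathbb{R}^d)$. Conditions on $W$: (W1) $\sup_{[0,T]\times\mathbb{R}^d}|u_t(x)|\le K$ for every $u\in W$. (W2) If $(\Omega,\mathcal{F},P)$ is a probability space and $u(\omega)=u_t(\omega,x)$ is an $\mathcal{F}\times\mathcal{B}([0,T]\times\mathbb{R}^d)$-measurable function with $u(\omega)\in W$ for every $\omega$, then $E[u_t(x)]$ belongs to $W$. (W3) For $u\in W$ and any bounded measurable $\mathcal{G}$-valued function $g_t$ on $[0,T]$, the function $u_t(g_tx)$ is in $W$. (W4) For any sequence $u^k\in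 W$ and bounded function $u=u_t(x)$ on $[0,T]\times\mathbb{R}^d$ such that $\int_{\mathbb{R}^d}u^k_t\zeta\,dx\to\int_{\mathbb{R}^d}u_t\zeta\,dx$ for any $t\in[0,T]$ and $\zeta\in C_0^\infty(\mathbb{R}^d)$, there exists $w\in W$ such that $w_t=u_t$ a.e. on $\mathbb{R}^d$ for any $t\in[0,T]$. Conditions on $(L,f)$: (i) $gL_t=L_tg$ for any $t\in(0,T)$, $g\in\mathcal{G}$; (ii) for any $\zeta\in C_0^\infty(\mathbb{R}^d)$, $L_t\zeta(x)$ is measurable in $(t,x)$ and $\int_{[0,T]\times\mathbb{R}^d}|L_t\zeta(x)|\,dt\,dx<\infty$; (iii) there is a mapping $B((0,T),\mathcal{G})\to W$, $h\mapsto u[h]$, such that for $u=u[h]$, all $\zeta\in C_0^\infty(\mathbb{R}^d)$ and $t\in[0,T]$, $(u_t,\zeta)=(u_0,\zeta)+\int_0^t(u_s,L_s\zeta)\,ds+\int_0^t(h_sf_s,\zeta)\,ds$; (iv) for any $h',h''\in B((0,T),\mathcal{G})$ and $(t,x)\in[0,T]\times\mathbb{R}^d$, $|u_t[h'](x)-u_t[h''](x)|\le K\int_0^t\sup_{y\in\mathbb{R}^d}|f_r(h'_ry)-f_r(h''_ry)|\,dr$. *)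

theory Defs
  imports "HOL-Probability.Probability"
begin

text \<open>
  The space is \<^typ>\<open>real ^ 'n\<close>, with \<open>d = CARD('n)\<close>. A function with domain \<open>D\<close> is an element
  of \<^term>\<open>extensional D\<close>, so that membership of such a function in a set never depends on values
  outside \<open>D\<close>. The translation \<open>x \<mapsto> x + b\<close> is identified with the vector \<open>b\<close>. ``Measurable''
  always means Borel measurable.
\<close>

definition borel_on :: "'a::topological_space set \<Rightarrow> ('a \<Rightarrow> 'b::topological_space) set" where
  "borel_on D = {f \<in> extensional D. f \<in> borel_measurable (restrict_space borel D)}"

definition bounded_borel_on :: "'a::topological_space set \<Rightarrow> ('a \<Rightarrow> 'b::metric_space) set" where
  "bounded_borel_on D = {f \<in> borel_on D. bounded (f ` D)}"

abbreviation slab :: "real \<Rightarrow> (real \<times> (real ^ 'n)) set" where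
  "slab T \<equiv> {0..T} \<times> UNIV"

abbreviation open_slab :: "real \<Rightarrow> (real \<times> (real ^ 'n)) set" where
  "open_slab T \<equiv> {0<..<T} \<times> UNIV"

definition partial :: "'n::finite \<Rightarrow> (real ^ 'n \<Rightarrow> real) \<Rightarrow> real ^ 'n \<Rightarrow> real" where
  "partial i \<phi> x = deriv (\<lambda>s. \<phi> (x + s *\<^sub>R axis i 1)) 0"

text \<open>
  Infinitely differentiable functions with compact support. Differentiability of all iterated
  partial derivatives gives their continuity as well, hence \<open>C\<^sup>\<infinity>\<close>.
\<close>

definition test_fun :: "(real ^ 'n::finite \<Rightarrow> real) set" where
  "test_fun = {\<phi>. (\<forall>is x. foldr partial is \<phi> differentiable (at x)) \<and>
                   compact (closure {x. \<phi> x \<noteq> 0})}"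

definition pairing :: "(real ^ 'n::finite \<Rightarrow> real) \<Rightarrow> (real ^ 'n \<Rightarrow> real) \<Rightarrow> real" where
  "pairing \<phi> \<psi> = (LINT x|lborel. \<phi> x * \<psi> x)"

definition translate :: "real ^ 'n::finite \<Rightarrow> (real ^ 'n \<Rightarrow> real) \<Rightarrow> real ^ 'n \<Rightarrow> real" where
  "translate b \<phi> = (\<lambda>x. \<phi> (x + b))"

text \<open>
  \<open>(u\<^sub>t, \<zeta>) = (u\<^sub>0, \<zeta>) + \<integral>\<^sub>0\<^sup>t (u\<^sub>s, A\<^sub>s \<zeta>) ds + \<integral>\<^sub>0\<^sup>t (h\<^sub>s f\<^sub>s, \<zeta>) ds\<close>. Here \<open>u0\<close> is a given function
  of \<open>x\<close>, not the section of \<open>u\<close> at time 0.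
\<close>

definition weak_solution ::
  "real \<Rightarrow> (real \<Rightarrow> (real ^ 'n \<Rightarrow> real) \<Rightarrow> (real ^ 'n \<Rightarrow> real)) \<Rightarrow> (real ^ 'n \<Rightarrow> real) \<Rightarrow>
   (real \<times> (real ^ 'n) \<Rightarrow> real) \<Rightarrow> (real \<Rightarrow> real ^ 'n::finite) \<Rightarrow> (real \<times> (real ^ 'n) \<Rightarrow> real) \<Rightarrow> bool" where
  "weak_solution T A u0 f h u \<longleftrightarrow>
     (\<forall>\<zeta>\<in>test_fun. \<forall>t\<in>{0..T}.
        pairing (\<lambda>x. u (t, x)) \<zeta> =
          pairing u0 \<zeta> +
          (LINT s:{0<..<t}|lborel. pairing (\<lambda>x. u (s, x)) (A s \<zeta>)) +
          (LINT s:{0<..<t}|lborel. pairing (translate (h s) (\<lambda>x. f (s, x))) \<zeta>))"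

definition cond_W1 :: "real \<Rightarrow> real \<Rightarrow> (real \<times> (real ^ 'n::finite) \<Rightarrow> real) set \<Rightarrow> bool" where
  "cond_W1 T K W \<longleftrightarrow> (\<forall>u\<in>W. \<forall>p\<in>slab T. \<bar>u p\<bar> \<le> K)"

text \<open>
  A quantifier over probability spaces cannot range over all types of elementary events. Fixing
  the type \<^typ>\<open>nat \<Rightarrow> real\<close> loses nothing, because the underlying set \<^term>\<open>space M\<close> and its
  sigma-algebra remain arbitrary: on any probability space, a jointly measurable \<open>u\<close> is measurable
  with respect to a sigma-algebra generated by countably many events \<open>A\<^sub>k\<close>, so it factors through
  \<open>\<omega> \<mapsto> (indicator A\<^sub>k \<omega>)\<^sub>k\<close>, and one may pass to the image of that map with the trace of the
  product sigma-algebra and the image measure.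
\<close>

definition cond_W2 :: "real \<Rightarrow> (real \<times> (real ^ 'n::finite) \<Rightarrow> real) set \<Rightarrow> bool" where
  "cond_W2 T W \<longleftrightarrow>
     (\<forall>(M :: (nat \<Rightarrow> real) measure) u.
        prob_space M \<longrightarrow>
        (\<lambda>(\<omega>, p). u \<omega> p) \<in> borel_measurable (M \<Otimes>\<^sub>M restrict_space borel (slab T)) \<longrightarrow>
        (\<forall>\<omega>\<in>space M. u \<omega> \<in> W) \<longrightarrow>
        restrict (\<lambda>p. LINT \<omega>|M. u \<omega> p) (slab T) \<in> W)"

definition cond_W3 :: "real \<Rightarrow> (real \<times> (real ^ 'n::finite) \<Rightarrow> real) set \<Rightarrow> bool" where
  "cond_W3 T W \<longleftrightarrow>
     (\<forall>u\<in>W. \<forall>g\<in>bounded_borel_on {0..T}.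
        restrict (\<lambda>(t, x). u (t, x + g t)) (slab T) \<in> W)"

text \<open>
  The limit \<open>u\<close> is not assumed to be jointly measurable; measurability of each \<open>u\<^sub>t\<close> is only what
  its integrals against test functions require. Borel instead of Lebesgue measurability of \<open>u\<^sub>t\<close>
  makes no difference, since each \<open>u\<^sub>t\<close> may be altered on a null set.
\<close>

definition cond_W4 :: "real \<Rightarrow> (real \<times> (real ^ 'n::finite) \<Rightarrow> real) set \<Rightarrow> bool" where
  "cond_W4 T W \<longleftrightarrow>
     (\<forall>(v :: nat \<Rightarrow> real \<times> (real ^ 'n) \<Rightarrow> real) u.
        (\<forall>k. v k \<in> W) \<longrightarrow>
        bounded (u ` slab T) \<longrightarrow>
        (\<forall>t\<in>{0..T}. (\<lambda>x. u (t, x)) \<in> borel_measurable borel) \<longrightarrow>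
        (\<forall>t\<in>{0..T}. \<forall>\<zeta>\<in>test_fun.
           (\<lambda>k. pairing (\<lambda>x. v k (t, x)) \<zeta>) \<longlonglongrightarrow> pairing (\<lambda>x. u (t, x)) \<zeta>) \<longrightarrow>
        (\<exists>w\<in>W. \<forall>t\<in>{0..T}. AE x in lborel. w (t, x) = u (t, x)))"

definition linear_operator_family ::
  "real \<Rightarrow> (real \<Rightarrow> (real ^ 'n::finite \<Rightarrow> real) \<Rightarrow> (real ^ 'n \<Rightarrow> real)) \<Rightarrow> bool" where
  "linear_operator_family T L \<longleftrightarrow>
     (\<forall>t\<in>{0<..<T}.
        (\<forall>\<phi>\<in>test_fun. L t \<phi> \<in> bounded_borel_on UNIV) \<and>
        (\<forall>\<phi>\<in>test_fun. \<forall>\<psi>\<in>test_fun. L t (\<lambda>x. \<phi> x + \<psi> x) = (\<lambda>x. L t \<phi> x + L t \<psi> x)) \<and>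
        (\<forall>\<phi>\<in>test_fun. \<forall>c. L t (\<lambda>x. c * \<phi> x) = (\<lambda>x. c * L t \<phi> x)))"

definition levy_family :: "real \<Rightarrow> (real \<Rightarrow> (real ^ 'n::finite) measure) \<Rightarrow> bool" where
  "levy_family T \<nu> \<longleftrightarrow>
     (\<forall>t\<in>{0<..<T}. sets (\<nu> t) = sets borel \<and> emeasure (\<nu> t) {0} = 0) \<and>
     (\<forall>A\<in>sets borel. (\<lambda>t. emeasure (\<nu> t) A) \<in> borel_measurable (restrict_space borel {0<..<T})) \<and>
     (\<forall>t\<in>{0<..<T}. (\<integral>\<^sup>+x. ennreal (min 1 ((norm x)\<^sup>2)) \<partial>\<nu> t) < \<infinity>) \<and>
     (\<integral>\<^sup>+t\<in>{0<..<T}. (\<integral>\<^sup>+x. ennreal (min 1 ((norm x)\<^sup>2)) \<partial>\<nu> t) \<partial>lborel) < \<infinity>"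

definition jump_op :: "(real ^ 'n::finite) measure \<Rightarrow> (real ^ 'n \<Rightarrow> real) \<Rightarrow> real ^ 'n \<Rightarrow> real" where
  "jump_op \<nu> \<phi> x =
     (LINT y|\<nu>. \<phi> (x + y) - \<phi> x - (\<Sum>i\<in>UNIV. y $ i * partial i \<phi> x) * indicator {y. norm y \<le> 1} y)"

end

theory Submission
  imports Defs
begin

text \<open>
  A jump term is produced by random translations. Let \<open>\<xi>\<close> be a piecewise constant path in
  \<open>\<real>\<^sup>d\<close> and put \<open>v\<^sub>t(x) = u\<^sub>t[h - \<xi>](x + \<xi>\<^sub>t)\<close>. Between the jumps of \<open>\<xi>\<close> the function \<open>v\<close> solves
  the unperturbed equation with control \<open>h\<close>: the operators \<open>L\<^sub>t\<close> commute with translations, and the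
  shift of the forcing term is undone by the control \<open>h - \<xi>\<close>. At a jump \<open>v\<close> is translated.
  Averaging over a path with independent increments that jumps by \<open>-b\<close> with intensity \<open>a(t)\<close>
  therefore adds the term \<open>a(t) (u(x - b) - u(x))\<close> to the equation, which on the side of the test
  function reads \<open>a(t) (\<zeta>(x + b) - \<zeta>(x))\<close>.

  Time is discretised: the interval is cut into \<open>N\<close> equal cells, and a jump may occur at a grid
  point only, with the probability \<open>\<integral> a(s) ds\<close> over the preceding cell. Only finitely many paths
  have positive probability, so no question arises whether \<open>u[h - \<xi>]\<close> depends measurably on the
  path. The Lipschitz condition implies causality: \<open>u\<^sub>t[h]\<close> depends on \<open>h\<close> on \<open>(0, t)\<close>
  only, so that the state just before a jump is independent of the jump (\<open>exists_jump_scheme\<close>). The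
  error of the averaged function is governed by the oscillation of \<open>t \<mapsto> (u\<^sub>t, \<zeta>)\<close> inside one cell and
  by the integral of the jump term over one cell (\<open>jump_scheme_residual_error\<close>).

  Approximate solutions are turned into solutions by convexity instead of weak compactness
  (\<open>exists_residual_limit\<close>). By (W2) the class \<open>W\<close> is convex, and the equation is affine in \<open>u\<close>,
  so convex combinations of approximate solutions are again approximate solutions. A bounded
  sequence has convex combinations of its tails that converge almost everywhere
  (\<open>midpoint_hull_AE_convergent\<close>). On the slab this gives the limit for almost every time; at each
  of the remaining times the same fact applied to the functions at that time gives a limit, which is
  determined by the equation. Condition (W4) then replaces the limit by an element of \<open>W\<close>.

  The passage \<open>N \<rightarrow> \<infinity>\<close> settles operators with finitely many jump sizes (\<open>finite_jump_solution\<close>). For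
  a general family \<open>\<nu>\<close> every jump \<open>y\<close> is replaced by \<open>q\<^sub>n(y)\<close>, where \<open>q\<^sub>n\<close> has finite range, vanishes
  near 0 and tends to the identity. The compensating drift \<open>-y \<cdot> \<nabla>\<zeta>\<close> is no jump operator, but it is
  the limit of the jump operators \<open>m (\<zeta>(x - q\<^sub>n(y) / m) - \<zeta>(x))\<close> with many small jumps in the opposite
  direction. By Taylor expansion and dominated convergence these operators converge to \<open>J\<close> in \<open>L\<^sub>1\<close>
  of the slab (\<open>discretisation_L1_convergence\<close>), and the convexity argument applies a second time.
\<close>

section \<open>Test functions\<close>

lemma foldr_partial_translate:
  "foldr partial is (translate b \<phi>) = translate b (foldr partial is \<phi>)"
proof (induction "is")
  case (Cons i "is")
  have "partial i (translate b \<psi>) = translate b (partial i \<psi>)" for \<psi> :: "real ^ 'a \<Rightarrow> real"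
    by (simp add: partial_def translate_def fun_eq_iff add_ac)
  then show ?case using Cons by simp
qed simp

lemma test_fun_foldr_differentiable:
  "\<phi> \<in> test_fun \<Longrightarrow> foldr partial is \<phi> differentiable (at x)"
  by (simp add: test_fun_def)

lemma test_fun_differentiable: "\<phi> \<in> test_fun \<Longrightarrow> \<phi> differentiable (at x)"
  using test_fun_foldr_differentiable[of \<phi> "[]"] by simp

lemma test_fun_compact: "\<phi> \<in> test_fun \<Longrightarrow> compact (closure {x. \<phi> x \<noteq> 0})"
  by (simp add: test_fun_def)

lemma test_fun_translate:
  assumes "\<phi> \<in> test_fun"
  shows "translate b \<phi> \<in> test_fun"
proof -
  have "foldr partial is (translate b \<phi>) differentiable (at x)" for "is" x
  proof -
    have "(foldr partial is \<phi> \<circ> (\<lambda>x. x + b)) differentiable (at x)"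
      by (intro differentiable_chain_at test_fun_foldr_differentiable assms)
         (auto intro!: derivative_intros)
    then show ?thesis
      by (simp add: foldr_partial_translate) (simp add: translate_def comp_def)
  qed
  moreover have "compact (closure {x. translate b \<phi> x \<noteq> 0})"
  proof -
    have "{x. translate b \<phi> x \<noteq> 0} = (\<lambda>x. -b + x) ` {x. \<phi> x \<noteq> 0}"
      by (auto simp: translate_def image_iff algebra_simps intro!: exI[of _ "_ + b"])
    then show ?thesis
      using test_fun_compact[OF assms] closure_translation[of "-b" "{x. \<phi> x \<noteq> 0}"]
      by (metis compact_translation)
  qed
  ultimately show ?thesis by (simp add: test_fun_def)
qed

lemma test_fun_has_derivative:
  fixes \<phi> :: "real ^ 'n::finite \<Rightarrow> real"
  assumes "\<phi> \<in> test_fun"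
  shows "(\<phi> has_derivative (\<lambda>y. \<Sum>i\<in>UNIV. y $ i * partial i \<phi> x)) (at x)"
proof -
  obtain D where D: "(\<phi> has_derivative D) (at x)"
    using test_fun_differentiable[OF assms] by (auto simp: differentiable_def)
  then interpret D: bounded_linear D by (rule has_derivative_bounded_linear)
  have part: "partial i \<phi> x = D (axis i 1)" for i
  proof -
    have "((\<lambda>s. x + s *\<^sub>R axis i 1) has_derivative (\<lambda>s. s *\<^sub>R axis i 1)) (at 0)"
      by (auto intro!: derivative_eq_intros)
    moreover have "(\<phi> has_derivative D) (at (x + 0 *\<^sub>R axis i 1))" using D by simp
    ultimately have "((\<lambda>s. \<phi> (x + s *\<^sub>R axis i 1)) has_derivative (\<lambda>s. D (s *\<^sub>R axis i 1))) (at 0)"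
      by (rule has_derivative_compose)
    then have "((\<lambda>s. \<phi> (x + s *\<^sub>R axis i 1)) has_field_derivative D (axis i 1)) (at 0)"
      by (rule has_derivative_imp_has_field_derivative) (simp add: D.scaleR)
    then show ?thesis unfolding partial_def by (rule DERIV_imp_deriv)
  qed
  have "D y = (\<Sum>i\<in>UNIV. y $ i * partial i \<phi> x)" for y
  proof -
    have "y = (\<Sum>i\<in>UNIV. (y $ i) *\<^sub>R axis i 1)"
      using basis_expansion[of y] by (simp add: scalar_mult_eq_scaleR)
    then have "D y = D (\<Sum>i\<in>UNIV. (y $ i) *\<^sub>R axis i 1)" by simp
    then show ?thesis by (simp add: D.sum D.scaleR part)
  qed
  then have "D = (\<lambda>y. \<Sum>i\<in>UNIV. y $ i * partial i \<phi> x)" by auto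
  with D show ?thesis by simp
qed

text \<open>
  The complement of the closed support is open, so \<open>\<phi>\<close> vanishes on a whole neighbourhood of \<open>x\<close>.
\<close>

lemma partial_outside_support:
  assumes "x \<notin> closure {x. \<phi> x \<noteq> 0}"
  shows "partial i \<phi> x = 0"
proof -
  let ?U = "- closure {x. \<phi> x \<noteq> 0}"
  have "((\<lambda>s. x + s *\<^sub>R axis i 1) \<longlongrightarrow> x + 0 *\<^sub>R axis i 1) (nhds (0::real))"
    by (intro tendsto_intros filterlim_ident)
  then have "\<forall>\<^sub>F s in nhds (0::real). x + s *\<^sub>R axis i 1 \<in> ?U"
    by (rule topological_tendstoD) (use assms in auto)
  then have "\<forall>\<^sub>F s in nhds (0::real). \<phi> (x + s *\<^sub>R axis i 1) = 0"
    by (rule eventually_mono) (use closure_subset[of "{x. \<phi> x \<noteq> 0}"] in auto)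
  then have "deriv (\<lambda>s. \<phi> (x + s *\<^sub>R axis i 1)) 0 = deriv (\<lambda>s. 0) (0::real)"
    by (intro deriv_cong_ev) auto
  then show ?thesis by (simp add: partial_def)
qed

lemma test_fun_partial:
  assumes "\<phi> \<in> test_fun"
  shows "partial i \<phi> \<in> test_fun"
proof -
  have "{x. partial i \<phi> x \<noteq> 0} \<subseteq> closure {x. \<phi> x \<noteq> 0}"
    using partial_outside_support by blast
  then have "closure {x. partial i \<phi> x \<noteq> 0} \<subseteq> closure {x. \<phi> x \<noteq> 0}"
    by (simp add: closure_minimal)
  then have "compact (closure {x. partial i \<phi> x \<noteq> 0})"
    using compact_Int_closed[OF test_fun_compact[OF assms] closed_closure, of "{x. partial i \<phi> x \<noteq> 0}"]
    by (metis Int_absorb1)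
  moreover have "foldr partial is (partial i \<phi>) differentiable (at x)" for "is" x
    using test_fun_foldr_differentiable[OF assms, of "is @ [i]"] by simp
  ultimately show ?thesis by (simp add: test_fun_def)
qed

lemma test_fun_continuous: "\<phi> \<in> test_fun \<Longrightarrow> continuous_on UNIV \<phi>"
  by (intro continuous_at_imp_continuous_on ballI differentiable_imp_continuous_within
      test_fun_differentiable)

lemma test_fun_measurable[measurable_dest]: "\<phi> \<in> test_fun \<Longrightarrow> \<phi> \<in> borel_measurable borel"
  by (intro borel_measurable_continuous_onI test_fun_continuous)

lemma test_fun_support:
  assumes "\<phi> \<in> test_fun"
  obtains R where "0 < R" "\<And>x. norm x > R \<Longrightarrow> \<phi> x = 0"
proof -
  obtain R where "R > 0" "\<And>x. x \<in> closure {x. \<phi> x \<noteq> 0} \<Longrightarrow> norm x \<le> R"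
    using compact_imp_bounded[OF test_fun_compact[OF assms]] by (auto simp: bounded_pos)
  then show ?thesis
    by (intro that[of R]) (use closure_subset[of "{x. \<phi> x \<noteq> 0}"] in \<open>auto simp: not_le[symmetric]\<close>)
qed

lemma test_fun_bounded:
  assumes "\<phi> \<in> test_fun"
  obtains C where "0 < C" "\<And>x. \<bar>\<phi> x\<bar> \<le> C"
proof -
  let ?S = "closure {x. \<phi> x \<noteq> 0}"
  have "compact (\<phi> ` ?S)"
    using assms by (intro compact_continuous_image test_fun_compact continuous_on_subset[OF test_fun_continuous]) auto
  then obtain C where C: "C > 0" "\<And>x. x \<in> ?S \<Longrightarrow> \<bar>\<phi> x\<bar> \<le> C"
    using compact_imp_bounded by (force simp: bounded_pos)
  have "\<bar>\<phi> x\<bar> \<le> C" for x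
    using C closure_subset[of "{x. \<phi> x \<noteq> 0}"] by (cases "\<phi> x = 0") auto
  with C show ?thesis by (auto intro: that)
qed

lemma test_fun_integrable:
  assumes "\<phi> \<in> test_fun"
  shows "integrable lborel \<phi>"
proof -
  obtain R where R: "0 < R" "\<And>x. norm x > R \<Longrightarrow> \<phi> x = 0" using test_fun_support[OF assms] by blast
  obtain C where C: "0 < C" "\<And>x. \<bar>\<phi> x\<bar> \<le> C" using test_fun_bounded[OF assms] by blast
  have "emeasure lborel (cball 0 R) < \<infinity>" 
    using emeasure_bounded_finite[OF bounded_cball] .
  then have "integrable lborel (\<lambda>x. C * indicator (cball 0 R) x)"
    by (intro integrable_mult_right) auto
  then show ?thesis
    by (rule Bochner_Integration.integrable_bound)
      (use assms R C in \<open>auto simp: indicator_def not_le[symmetric]\<close>)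
qed

text \<open>
  Along a segment the first and second derivatives are directional derivatives of \<open>\<phi>\<close> and of its
  partial derivatives. As partial derivatives of test functions are test functions, the second ones are
  bounded, and two applications of the mean value theorem give the remainder.
\<close>

lemma test_fun_taylor:
  fixes \<phi> :: "real ^ 'n::finite \<Rightarrow> real"
  assumes "\<phi> \<in> test_fun"
  obtains C where "0 < C" 
    "\<And>x y. \<bar>\<phi> (x + y) - \<phi> x - (\<Sum>i\<in>UNIV. y $ i * partial i \<phi> x)\<bar> \<le> C * (norm y)\<^sup>2"
proof -
  have "\<forall>i j. \<exists>C. 0 < C \<and> (\<forall>x. \<bar>partial j (partial i \<phi>) x\<bar> \<le> C)"
    using assms by (metis test_fun_bounded test_fun_partial)
  then obtain c where c: "\<And>i j. 0 < c i j" "\<And>i j x. \<bar>partial j (partial i \<phi>) x\<bar> \<le> c i j"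
    by metis
  define C where "C = (\<Sum>i\<in>UNIV. \<Sum>j\<in>UNIV. c i j)"
  have "0 < C" unfolding C_def by (intro sum_pos c) auto
  moreover have "\<bar>\<phi> (x + y) - \<phi> x - (\<Sum>i\<in>UNIV. y $ i * partial i \<phi> x)\<bar> \<le> C * (norm y)\<^sup>2" for x y
  proof -
    define g where "g \<psi> s = (\<Sum>i\<in>UNIV. y $ i * partial i \<psi> (x + s *\<^sub>R y))" for \<psi> s
    have deriv: "((\<lambda>s. \<psi> (x + s *\<^sub>R y)) has_field_derivative g \<psi> s) (at s)"
      if "\<psi> \<in> test_fun" for \<psi> s
    proof -
      have "((\<lambda>s. x + s *\<^sub>R y) has_derivative (\<lambda>s. s *\<^sub>R y)) (at s)"
        by (auto intro!: derivative_eq_intros)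
      from has_derivative_compose[OF this test_fun_has_derivative[OF that]]
      show ?thesis 
        by (rule has_derivative_imp_has_field_derivative) (simp add: g_def sum_distrib_left mult_ac)
    qed
    obtain s where s: "0 < s" "s < 1" "\<phi> (x + y) - \<phi> x = g \<phi> s"
      using MVT2[of 0 1 "\<lambda>s. \<phi> (x + s *\<^sub>R y)" "g \<phi>"] deriv[OF assms] by auto
    have "((\<lambda>s. g \<phi> s) has_field_derivative (\<Sum>i\<in>UNIV. y $ i * g (partial i \<phi>) s)) (at s)" for s
      unfolding g_def[of \<phi>]
      by (auto intro!: derivative_eq_intros deriv test_fun_partial assms simp: mult.commute)
    then obtain r where r: "g \<phi> s - g \<phi> 0 = s * (\<Sum>i\<in>UNIV. y $ i * g (partial i \<phi>) r)"
      using MVT2[of 0 s "g \<phi>" "\<lambda>s. \<Sum>i\<in>UNIV. y $ i * g (partial i \<phi>) s"] s by auto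
    have "\<bar>\<Sum>i\<in>UNIV. y $ i * g (partial i \<phi>) r\<bar> \<le> (\<Sum>i\<in>UNIV. \<Sum>j\<in>UNIV. (norm y)\<^sup>2 * c i j)"
      unfolding g_def sum_distrib_left
    proof (intro order_trans[OF sum_abs] sum_mono)
      fix i j
      have "\<bar>y $ i * (y $ j * partial j (partial i \<phi>) (x + r *\<^sub>R y))\<bar>
        = \<bar>y $ i\<bar> * \<bar>y $ j\<bar> * \<bar>partial j (partial i \<phi>) (x + r *\<^sub>R y)\<bar>"
        by (simp add: abs_mult)
      also have "\<dots> \<le> norm y * norm y * c i j"
        using component_le_norm_cart[of y] c by (intro mult_mono) auto
      finally show "\<bar>y $ i * (y $ j * partial j (partial i \<phi>) (x + r *\<^sub>R y))\<bar> \<le> (norm y)\<^sup>2 * c i j"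
        by (simp add: power2_eq_square)
    qed
    then have le: "\<bar>\<Sum>i\<in>UNIV. y $ i * g (partial i \<phi>) r\<bar> \<le> C * (norm y)\<^sup>2"
      by (simp add: C_def sum_distrib_left[symmetric] mult.commute[of "\<Sum>i\<in>UNIV. sum (c i) UNIV"])
    have "\<bar>\<phi> (x + y) - \<phi> x - g \<phi> 0\<bar> = s * \<bar>\<Sum>i\<in>UNIV. y $ i * g (partial i \<phi>) r\<bar>"
      using s r by (simp add: abs_mult)
    also have "\<dots> \<le> 1 * (C * (norm y)\<^sup>2)"
      using s le by (intro mult_mono) auto
    finally show ?thesis by (simp add: g_def)
  qed
  ultimately show ?thesis by (rule that)
qed

section \<open>Integrals over time slabs\<close>

lemma open_slab_borel [measurable]: "{a<..<b::real} \<times> (UNIV :: (real ^ 'n::finite) set) \<in> sets borel"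
  by (intro borel_open open_Times) auto

lemma borel_on_section:
  assumes "u \<in> borel_measurable (restrict_space borel (slab T))" "t \<in> {0..T}"
  shows "(\<lambda>x. u (t, x)) \<in> borel_measurable borel"
proof (rule measurable_compose[OF _ assms(1)])
  have "(\<lambda>x. (t, x)) \<in> borel \<rightarrow>\<^sub>M borel" by (intro borel_measurable_continuous_onI continuous_intros)
  then show "(\<lambda>x. (t, x)) \<in> borel \<rightarrow>\<^sub>M restrict_space borel (slab T)"
    using assms(2) by (intro measurable_restrict_space2) auto
qed

lemma bounded_borel_onD:
  assumes "u \<in> bounded_borel_on D"
  shows "u \<in> borel_measurable (restrict_space borel D)" "bounded (u ` D)"
  using assms by (auto simp: bounded_borel_on_def borel_on_def)

lemma bounded_borel_on_restrict:
  assumes "u \<in> borel_measurable (restrict_space borel D)" "bounded (u ` D)"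
  shows "restrict u D \<in> bounded_borel_on D"
proof -
  have "restrict u D \<in> borel_measurable (restrict_space borel D)"
    using assms(1) by (subst measurable_cong[where g = u]) (auto simp: space_restrict_space)
  moreover have "restrict u D ` D = u ` D" by auto
  ultimately show ?thesis using assms(2) by (simp add: bounded_borel_on_def borel_on_def)
qed

lemma set_integral_abs_le:
  fixes F G :: "'a \<Rightarrow> real"
  assumes "set_integrable M S F" "set_integrable M S G" "\<And>x. x \<in> S \<Longrightarrow> \<bar>F x\<bar> \<le> G x"
  shows "\<bar>LINT x:S|M. F x\<bar> \<le> (LINT x:S|M. G x)"
proof -
  have "\<bar>LINT x:S|M. F x\<bar> \<le> (LINT x:S|M. \<bar>F x\<bar>)"
    unfolding set_lebesgue_integral_def using integral_abs_bound[of M "\<lambda>x. indicator S x *\<^sub>R F x"] by (simp add: abs_mult)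
  also have "\<dots> \<le> (LINT x:S|M. G x)"
    by (rule set_integral_mono) (use assms set_integrable_abs in auto)
  finally show ?thesis .
qed

lemma set_integrable_bounded_mult:
  fixes u g :: "'a::euclidean_space \<Rightarrow> real"
  assumes g: "set_integrable lborel S g" and S[measurable]: "S \<in> sets borel"
    and u: "u \<in> borel_measurable (restrict_space borel S)" and K: "\<And>p. p \<in> S \<Longrightarrow> \<bar>u p\<bar> \<le> K"
  shows "set_integrable lborel S (\<lambda>p. u p * g p)"
proof -
  have [measurable]: "(\<lambda>p. indicator S p * u p) \<in> borel_measurable borel"
    using u by (subst (asm) borel_measurable_restrict_space_iff) auto
  have [measurable]: "(\<lambda>p. indicator S p * g p) \<in> borel_measurable borel"
    using borel_measurable_integrable[OF g[unfolded set_integrable_def]] by simp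
  have m: "(\<lambda>p. (indicator S p * u p) * (indicator S p * g p)) \<in> borel_measurable borel" by measurable
  have eq: "(\<lambda>p. (indicator S p * u p) * (indicator S p * g p)) = (\<lambda>p. indicator S p *\<^sub>R (u p * g p))"
    by (auto simp: indicator_def)
  show ?thesis
    unfolding set_integrable_def
  proof (rule Bochner_Integration.integrable_bound)
    show "integrable lborel (\<lambda>p. K * (indicator S p *\<^sub>R g p))"
      using g unfolding set_integrable_def by (rule integrable_mult_right)
    show "(\<lambda>p. indicator S p *\<^sub>R (u p * g p)) \<in> borel_measurable lborel" using m unfolding eq by simp
    have "\<bar>u p * g p\<bar> \<le> \<bar>K * g p\<bar>" if "p \<in> S" for p
      using K[OF that] by (auto simp: abs_mult intro!: mult_right_mono)
    then show "AE p in lborel. norm (indicator S p *\<^sub>R (u p * g p)) \<le> norm (K * (indicator S p *\<^sub>R g p))"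
      by (auto simp: indicator_def)
  qed
qed

lemma set_integral_sum_family:
  fixes g :: "'j \<Rightarrow> 'a \<Rightarrow> real"
  assumes "\<And>j. j \<in> J \<Longrightarrow> set_integrable M A (g j)"
  shows "set_integrable M A (\<lambda>x. \<Sum>j\<in>J. g j x)"
    and "(LINT x:A|M. \<Sum>j\<in>J. g j x) = (\<Sum>j\<in>J. LINT x:A|M. g j x)"
  using assms unfolding set_integrable_def set_lebesgue_integral_def scaleR_sum_right
  by (intro Bochner_Integration.integrable_sum Bochner_Integration.integral_sum; simp)+

lemma slab_product_integrable:
  fixes a :: "real \<Rightarrow> real" and \<psi> :: "real ^ 'n::finite \<Rightarrow> real"
  assumes a: "set_integrable lborel {0<..<T} a" and \<psi>: "integrable lborel \<psi>"
  shows "set_integrable lborel (open_slab T) (\<lambda>(s, x). a s * \<psi> x)"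
proof -
  define \<alpha> where "\<alpha> s = indicator {0<..<T} s *\<^sub>R a s" for s
  have \<alpha>: "integrable lborel \<alpha>" using a unfolding set_integrable_def \<alpha>_def .
  note [measurable] = borel_measurable_integrable[OF \<alpha>] borel_measurable_integrable[OF \<psi>]
  have "integrable (lborel \<Otimes>\<^sub>M lborel) (\<lambda>(s, x). \<alpha> s * \<psi> x)"
  proof (rule lborel_pair.Fubini_integrable)
    show "(\<lambda>(s, x). \<alpha> s * \<psi> x) \<in> borel_measurable (lborel \<Otimes>\<^sub>M lborel)" by measurable
    have "integrable lborel (\<lambda>s. \<bar>\<alpha> s\<bar> * (LINT x|lborel. \<bar>\<psi> x\<bar>))"
      using \<alpha> by (intro integrable_mult_left) auto
    then show "integrable lborel (\<lambda>s. LINT x|lborel. norm (case (s, x) of (s, x) \<Rightarrow> \<alpha> s * \<psi> x))"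
      by (simp add: abs_mult)
    show "AE s in lborel. integrable lborel (\<lambda>x. case (s, x) of (s, x) \<Rightarrow> \<alpha> s * \<psi> x)"
      using \<psi> by simp
  qed
  moreover have "(\<lambda>(s, x). \<alpha> s * \<psi> x) = (\<lambda>p. indicator (open_slab T) p *\<^sub>R (case p of (s, x) \<Rightarrow> a s * \<psi> x))"
    by (auto simp: \<alpha>_def indicator_def)
  ultimately show ?thesis unfolding set_integrable_def lborel_prod by simp
qed

text \<open>
  The equation is integrated over \<open>(0, t)\<close>, an open interval. Intervals closed on the left and cut
  at 0 make such integrals exactly additive, without an exceptional null set at the point of division.
\<close>

definition ival :: "real \<Rightarrow> real \<Rightarrow> real set" where
  "ival r t = {0<..} \<inter> {r..<t}"

lemma ival_0: "ival 0 t = {0<..<t}"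
  by (auto simp: ival_def)

lemma ival_borel [measurable]: "ival r t \<in> sets borel" 
  by (simp add: ival_def)

lemma ival_subset: "t \<le> T \<Longrightarrow> ival r t \<subseteq> {0<..<T}"
  by (auto simp: ival_def)

lemma ival_slab_borel [measurable]: "ival r t \<times> (UNIV :: (real ^ 'n::finite) set) \<in> sets borel"
proof -
  have "ival r t \<times> (UNIV :: (real ^ 'n) set) \<in> sets (borel \<Otimes>\<^sub>M borel)" by measurable
  then show ?thesis by (simp only: borel_prod)
qed

lemma ival_Un:
  assumes "r \<le> s" "s \<le> t"
  shows "ival r t = ival r s \<union> ival s t" "ival r s \<inter> ival s t = {}"
  using assms by (auto simp: ival_def)

lemma ival_integral_add:
  fixes g :: "real \<Rightarrow> real"
  assumes "set_integrable lborel {0<..<T} g" "r \<le> s" "s \<le> t" "t \<le> T"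
  shows "(LINT x:ival r t|lborel. g x) = (LINT x:ival r s|lborel. g x) + (LINT x:ival s t|lborel. g x)"
  unfolding ival_Un(1)[OF assms(2,3)]
  by (intro set_integral_Un ival_Un assms set_integrable_subset[OF assms(1)] ival_subset) (use assms in auto)

lemma slab_integral_add:
  fixes G :: "real \<times> (real ^ 'n::finite) \<Rightarrow> real"
  assumes "set_integrable lborel (open_slab T) G" "r \<le> s" "s \<le> t" "t \<le> T"
  shows "(LINT p:ival r t \<times> UNIV|lborel. G p) = 
    (LINT p:ival r s \<times> UNIV|lborel. G p) + (LINT p:ival s t \<times> UNIV|lborel. G p)"
proof -
  have "ival r t \<times> UNIV = ival r s \<times> UNIV \<union> ival s t \<times> (UNIV :: (real ^ 'n) set)"
    "(ival r s \<times> UNIV) \<inter> (ival s t \<times> (UNIV :: (real ^ 'n) set)) = {}"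
    using ival_Un[OF assms(2,3)] by auto
  moreover have "ival r s \<times> (UNIV :: (real ^ 'n) set) \<subseteq> open_slab T" "ival s t \<times> (UNIV :: (real ^ 'n) set) \<subseteq> open_slab T"
    using assms(3,4) by (auto simp: ival_def)
  ultimately show ?thesis
    using set_integrable_subset[OF assms(1), of "ival r s \<times> UNIV"]
      set_integrable_subset[OF assms(1), of "ival s t \<times> UNIV"] by (simp add: set_integral_Un)
qed

lemma set_integrable_slab:
  fixes G :: "real \<times> (real ^ 'n::finite) \<Rightarrow> real"
  assumes "set_integrable lborel (open_slab T) G" "t \<le> T"
  shows "set_integrable lborel (ival r t \<times> UNIV) G"
  by (rule set_integrable_subset[OF assms(1)]) (use ival_subset[OF assms(2)] in auto)

lemma slab_fubini_ival:
  fixes g :: "real \<times> (real ^ 'n::finite) \<Rightarrow> real"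
  assumes "set_integrable lborel (open_slab T) g" "t \<le> T"
  shows "(LINT s:ival r t|lborel. LINT x|lborel. g (s, x)) = (LINT p:ival r t \<times> UNIV|lborel. g p)"
    and "set_integrable lborel (ival r t) (\<lambda>s. LINT x|lborel. g (s, x))"
proof -
  let ?G = "\<lambda>p. indicator (ival r t \<times> UNIV) p *\<^sub>R g p"
  have I: "integrable (lborel \<Otimes>\<^sub>M lborel) ?G"
    using set_integrable_slab[OF assms] unfolding set_integrable_def lborel_prod .
  have eq: "(LINT x|lborel. ?G (s, x)) = indicator (ival r t) s *\<^sub>R (LINT x|lborel. g (s, x))" for s
    by (auto simp: indicator_def)
  have "(LINT s|lborel. LINT x|lborel. ?G (s, x)) = (LINT p|lborel. ?G p)"
    using lborel_pair.integral_fst'[OF I] unfolding lborel_prod .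
  then show "(LINT s:ival r t|lborel. LINT x|lborel. g (s, x)) = (LINT p:ival r t \<times> UNIV|lborel. g p)"
    unfolding eq set_lebesgue_integral_def by simp
  show "set_integrable lborel (ival r t) (\<lambda>s. LINT x|lborel. g (s, x))"
    using lborel_pair.integrable_fst'[OF I] unfolding eq set_integrable_def .
qed

text \<open>
  Absolute continuity of the integral: split \<open>g\<close> where \<open>\<bar>g\<bar>\<close> exceeds a level \<open>n\<close>. The part above the
  level has a small integral by dominated convergence, the part below contributes at most \<open>n\<close> times
  the length.
\<close>

lemma integrable_uniformly_small:
  fixes g :: "real \<Rightarrow> real"
  assumes g: "integrable lborel g" and e: "0 < e"
  obtains d where "0 < d" "\<And>r t. r \<le> t \<Longrightarrow> t - r < d \<Longrightarrow> (LINT s:{r..<t}|lborel. \<bar>g s\<bar>) < e"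
proof -
  note [measurable] = borel_measurable_integrable[OF g]
  define tail where "tail n = (LINT s|lborel. \<bar>g s\<bar> * indicator {s. \<bar>g s\<bar> > real n} s)" for n
  have "(\<lambda>n. tail n) \<longlonglongrightarrow> (LINT s|(lborel :: real measure). 0)"
    unfolding tail_def
  proof (rule integral_dominated_convergence[where w = "\<lambda>s. \<bar>g s\<bar>"])
    show "AE s in lborel. (\<lambda>n. \<bar>g s\<bar> * indicator {s. \<bar>g s\<bar> > real n} s) \<longlonglongrightarrow> 0"
    proof (rule AE_I2)
      fix s
      obtain N where "\<bar>g s\<bar> < real N" using reals_Archimedean2 by blast
      then have "\<forall>\<^sub>F n in sequentially. \<bar>g s\<bar> * indicator {s. \<bar>g s\<bar> > real n} s = 0"
        by (intro eventually_sequentiallyI[of N]) (auto simp: indicator_def)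
      then show "(\<lambda>n. \<bar>g s\<bar> * indicator {s. \<bar>g s\<bar> > real n} s) \<longlonglongrightarrow> 0" by (rule tendsto_eventually)
    qed
  qed (use g in \<open>auto simp: indicator_def\<close>)
  then have "\<forall>\<^sub>F n in sequentially. tail n < e / 2"
    using e by (intro order_tendstoD(2)) auto
  then obtain n where n: "tail n < e / 2" by (auto simp: eventually_sequentially)
  define d where "d = e / (2 * (real n + 1))"
  show ?thesis
  proof (rule that)
    show "0 < d" using e by (simp add: d_def)
    fix r t :: real assume rt: "r \<le> t" "t - r < d"
    have i2: "integrable lborel (\<lambda>s. \<bar>g s\<bar> * indicator {s. \<bar>g s\<bar> > real n} s)"
      by (rule Bochner_Integration.integrable_bound[OF g]) (auto simp: indicator_def)
    have i1: "integrable lborel (\<lambda>s. real n * indicator {r..<t} s)"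
      using rt by (intro integrable_mult_right) auto
    have "(LINT s:{r..<t}|lborel. \<bar>g s\<bar>) \<le> 
      (LINT s|lborel. real n * indicator {r..<t} s + \<bar>g s\<bar> * indicator {s. \<bar>g s\<bar> > real n} s)"
      unfolding set_lebesgue_integral_def
      by (rule Bochner_Integration.integral_mono') (use i1 i2 in \<open>auto simp: indicator_def\<close>)
    also have "\<dots> = real n * (t - r) + tail n"
      unfolding tail_def using i1 i2 rt by simp
    also have "\<dots> < e"
    proof -
      have "real n * (t - r) \<le> real n * d" using rt by (intro mult_left_mono) auto
      also have "\<dots> \<le> e / 2" unfolding d_def using e by (simp add: field_simps)
      finally show ?thesis using n by linarith
    qed
    finally show "(LINT s:{r..<t}|lborel. \<bar>g s\<bar>) < e" .
  qed
qed

lemma lborel_integral_translate: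
  fixes g :: "'a::euclidean_space \<Rightarrow> real"
  assumes "g \<in> borel_measurable borel"
  shows "(LINT x|lborel. g (x + c)) = (LINT x|lborel. g x)"
proof -
  have "(LINT x|lborel. g x) = (LINT x|distr lborel borel ((+) c). g x)"
    by (simp add: lborel_distr_plus)
  also have "\<dots> = (LINT x|lborel. g (c + x))"
    by (rule integral_distr) (use assms in auto)
  finally show ?thesis by (simp add: add.commute)
qed

lemma pairing_translate:
  assumes [measurable]: "\<phi> \<in> borel_measurable borel" and \<zeta>: "\<zeta> \<in> test_fun"
  shows "pairing (\<lambda>x. \<phi> (x + c)) \<zeta> = pairing \<phi> (translate (- c) \<zeta>)"
proof -
  note [measurable] = test_fun_measurable[OF \<zeta>]
  have "pairing \<phi> (translate (- c) \<zeta>) = (LINT x|lborel. \<phi> (x + c) * translate (- c) \<zeta> (x + c))"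
    unfolding pairing_def
    by (rule lborel_integral_translate[symmetric]) (simp add: translate_def)
  then show ?thesis by (simp add: pairing_def translate_def)
qed

lemma slab_integral_translate:
  fixes G :: "real \<times> (real ^ 'n::finite) \<Rightarrow> real"
  assumes "(\<lambda>p. indicator (ival r t \<times> UNIV) p * G p) \<in> borel_measurable borel"
  shows "(LINT p:ival r t \<times> UNIV|lborel. G p) = (LINT (s, x):ival r t \<times> UNIV|lborel. G (s, x + c))"
proof -
  have "(LINT p|lborel. indicator (ival r t \<times> UNIV) p * G p) = 
    (LINT p|lborel. indicator (ival r t \<times> UNIV) (p + (0, c)) * G (p + (0, c)))"
    by (rule lborel_integral_translate[OF assms, symmetric])
  moreover have "indicator (ival r t \<times> UNIV) (p + (0, c)) * G (p + (0, c)) =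
      indicator (ival r t \<times> UNIV) p * (case p of (s, x) \<Rightarrow> G (s, x + c))" for p
    by (cases p) (auto simp: indicator_def)
  ultimately show ?thesis
    by (simp add: set_lebesgue_integral_def)
qed

lemma pairing_tendsto:
  assumes "\<And>n. a n \<in> borel_measurable borel" "\<And>n x. \<bar>a n x\<bar> \<le> K" "\<phi> \<in> borel_measurable borel"
    and lim: "AE x in lborel. (\<lambda>n. a n x) \<longlonglongrightarrow> \<phi> x" and \<zeta>: "\<zeta> \<in> test_fun"
  shows "(\<lambda>n. pairing (a n) \<zeta>) \<longlonglongrightarrow> pairing \<phi> \<zeta>"
  unfolding pairing_def
proof (rule integral_dominated_convergence)
  note [measurable] = assms(1,3) test_fun_measurable[OF \<zeta>]
  show "(\<lambda>x. \<phi> x * \<zeta> x) \<in> borel_measurable lborel" "\<And>n. (\<lambda>x. a n x * \<zeta> x) \<in> borel_measurable lborel"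
    by measurable
  show "integrable lborel (\<lambda>x. K * \<bar>\<zeta> x\<bar>)" using test_fun_integrable[OF \<zeta>] by simp
  show "AE x in lborel. (\<lambda>n. a n x * \<zeta> x) \<longlonglongrightarrow> \<phi> x * \<zeta> x"
    using lim by eventually_elim (intro tendsto_intros)
  show "AE x in lborel. norm (a n x * \<zeta> x) \<le> K * \<bar>\<zeta> x\<bar>" for n
    using assms(2) by (auto simp: abs_mult intro!: mult_right_mono)
qed

lemma pairing_integrable:
  assumes "a \<in> borel_measurable borel" "\<And>x. \<bar>a x\<bar> \<le> K" "\<zeta> \<in> test_fun"
  shows "integrable lborel (\<lambda>x. a x * \<zeta> x)"
proof (rule Bochner_Integration.integrable_bound)
  note [measurable] = assms(1) test_fun_measurable[OF assms(3)]
  show "(\<lambda>x. a x * \<zeta> x) \<in> borel_measurable lborel" by measurable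
  show "integrable lborel (\<lambda>x. K * \<bar>\<zeta> x\<bar>)" using test_fun_integrable[OF assms(3)] by simp
  show "AE x in lborel. norm (a x * \<zeta> x) \<le> norm (K * \<bar>\<zeta> x\<bar>)"
    using assms(2) by (intro AE_I2) (simp add: abs_mult mult_right_mono order_trans[OF _ abs_ge_self])
qed

lemma pairing_midpoint:
  assumes "a \<in> borel_measurable borel" "\<And>x. \<bar>a x\<bar> \<le> K" "b \<in> borel_measurable borel" "\<And>x. \<bar>b x\<bar> \<le> K" "\<zeta> \<in> test_fun"
  shows "pairing (\<lambda>x. (a x + b x) / 2) \<zeta> = (pairing a \<zeta> + pairing b \<zeta>) / 2"
proof -
  have "(\<lambda>x. (a x + b x) / 2 * \<zeta> x) = (\<lambda>x. (a x * \<zeta> x + b x * \<zeta> x) / 2)" by (auto simp: field_simps)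
  then show ?thesis
    unfolding pairing_def
    using pairing_integrable[OF assms(1,2,5)] pairing_integrable[OF assms(3,4,5)] by simp
qed

section \<open>Almost everywhere convergent convex combinations\<close>

text \<open>
  Dyadic convex combinations of the tail \<open>f n, f (n + 1), \<dots>\<close>. Closure under midpoints already suffices
  for the parallelogram argument below, and an affine or convex property passes from the tail to
  the hull by rule induction, without any weights.
\<close>

inductive_set midpoint_hull :: "(nat \<Rightarrow> 'a \<Rightarrow> real) \<Rightarrow> nat \<Rightarrow> ('a \<Rightarrow> real) set"
  for f :: "nat \<Rightarrow> 'a \<Rightarrow> real" and n :: nat where
  base: "n \<le> m \<Longrightarrow> f m \<in> midpoint_hull f n"
| midpoint: "a \<in> midpoint_hull f n \<Longrightarrow> b \<in> midpoint_hull f n \<Longrightarrow>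
    (\<lambda>x. (a x + b x) / 2) \<in> midpoint_hull f n"

lemma midpoint_hull_antimono:
  assumes "n \<le> m" "g \<in> midpoint_hull f m"
  shows "g \<in> midpoint_hull f n"
  using assms(2) by induction (use assms(1) in \<open>auto intro: midpoint_hull.intros\<close>)

lemma midpoint_hull_measurable:
  assumes "\<And>m. f m \<in> borel_measurable M" "g \<in> midpoint_hull f n"
  shows "g \<in> borel_measurable M"
  using assms(2) by induction (use assms(1) in auto)

lemma midpoint_hull_abs_le:
  assumes "\<And>m. \<bar>f m x\<bar> \<le> K" "g \<in> midpoint_hull f n"
  shows "\<bar>g x\<bar> \<le> K"
  using assms(2) by induction (use assms(1) in \<open>auto simp: field_simps abs_le_iff\<close>)

text \<open>
  For an affine functional \<open>\<Lambda>\<close>, the condition that \<open>\<Lambda> a\<close> differs from the limit by less than \<open>e\<close> is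
  stable under midpoints, hence holds on the hull of a tail as soon as it holds on the tail.
\<close>

lemma midpoint_hull_tendsto:
  fixes \<Lambda> :: "('a \<Rightarrow> real) \<Rightarrow> real"
  assumes lim: "(\<lambda>m. \<Lambda> (f m)) \<longlonglongrightarrow> l"
    and g: "\<And>n. g n \<in> midpoint_hull f n"
    and affine: "\<And>n a b. a \<in> midpoint_hull f n \<Longrightarrow> b \<in> midpoint_hull f n \<Longrightarrow>
      \<Lambda> (\<lambda>x. (a x + b x) / 2) = (\<Lambda> a + \<Lambda> b) / 2"
  shows "(\<lambda>n. \<Lambda> (g n)) \<longlonglongrightarrow> l"
proof (rule LIMSEQ_I)
  fix e :: real assume "0 < e"
  then obtain N where N: "\<And>m. m \<ge> N \<Longrightarrow> \<bar>\<Lambda> (f m) - l\<bar> < e"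
    using LIMSEQ_D[OF lim] by fastforce
  have "\<bar>\<Lambda> a - l\<bar> < e" if "n \<ge> N" "a \<in> midpoint_hull f n" for n a
    using that(2)
  proof induction
    case (midpoint a b)
    then show ?case
      unfolding affine[OF midpoint.hyps] by (simp add: abs_less_iff field_simps)
  qed (use N that(1) in auto)
  then show "\<exists>no. \<forall>n\<ge>no. norm (\<Lambda> (g n) - l) < e"
    using g by auto
qed

text \<open>
  The classical argument for the element of least norm in a convex set. In the \<open>L\<^sub>2\<close> space of an
  equivalent finite measure with density \<open>w\<close>, the infimum \<open>i n\<close> of the squared norm over the hull of
  the \<open>n\<close>-th tail increases to a finite limit. For nearly minimal elements \<open>a n\<close> the parallelogram
  identity bounds the squared norm of \<open>a n - a m\<close> by \<open>i m - i n\<close> up to a small error, because the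
  midpoint also lies in the hull. So \<open>a\<close> is a Cauchy sequence, and a subsequence of it converges
  almost everywhere.
\<close>

lemma midpoint_hull_AE_convergent:
  fixes f :: "nat \<Rightarrow> 'a \<Rightarrow> real"
  assumes "sigma_finite_measure M"
    and f[measurable]: "\<And>m. f m \<in> borel_measurable M"
    and K: "\<And>m x. x \<in> space M \<Longrightarrow> \<bar>f m x\<bar> \<le> K"
  obtains g h where "\<And>n. g n \<in> midpoint_hull f n" "h \<in> borel_measurable M" "\<And>x. \<bar>h x\<bar> \<le> \<bar>K\<bar>"
    "AE x in M. (\<lambda>n. g n x) \<longlonglongrightarrow> h x"
proof -
  interpret sigma_finite_measure M by fact
  obtain w :: "'a \<Rightarrow> real" where w[measurable]: "w \<in> borel_measurable M"
    and w0: "\<And>x. 0 < w x" "\<And>x. w x \<le> 1" and wint: "integrable M w"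
    using obtain_positive_integrable_function by blast
  let ?H = "midpoint_hull f"
  have meas: "a \<in> borel_measurable M" if "a \<in> ?H n" for a n
    using midpoint_hull_measurable[OF f that] .
  have bd: "\<bar>a x\<bar> \<le> K" if "a \<in> ?H n" "x \<in> space M" for a n x
    using midpoint_hull_abs_le[OF K[OF that(2)] that(1)] .
  have int: "integrable M (\<lambda>x. w x * (a x * b x))" if "a \<in> ?H n" "b \<in> ?H m" for a b n m
  proof (rule Bochner_Integration.integrable_bound[OF integrable_mult_right[OF wint, of "K * K"]])
    show "(\<lambda>x. w x * (a x * b x)) \<in> borel_measurable M" using meas that by measurable
    show "AE x in M. norm (w x * (a x * b x)) \<le> norm (K * K * w x)"
    proof (rule AE_I2)
      fix x assume x: "x \<in> space M"
      have "\<bar>a x\<bar> * \<bar>b x\<bar> \<le> K * K" using bd[OF that(1) x] bd[OF that(2) x] by (intro mult_mono) auto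
      then have "w x * (\<bar>a x\<bar> * \<bar>b x\<bar>) \<le> w x * (K * K)" using w0 by (intro mult_left_mono) (auto simp: less_imp_le)
      then show "norm (w x * (a x * b x)) \<le> norm (K * K * w x)"
        using w0(1)[of x] by (simp add: abs_mult mult_ac)
    qed
  qed
  define Q where "Q a b = (LINT x|M. w x * (a x * b x))" for a b
  define i where "i n = Inf ((\<lambda>a. Q a a) ` ?H n)" for n
  have Q0: "0 \<le> Q a a" for a unfolding Q_def using w0 by (auto intro!: integral_nonneg_AE AE_I2 simp: less_imp_le)
  have bddb: "bdd_below ((\<lambda>a. Q a a) ` ?H n)" for n using Q0 by (auto intro!: bdd_belowI[of _ 0])
  have ne: "?H n \<noteq> {}" for n by (auto intro: midpoint_hull.base)
  have i_le: "i n \<le> Q a a" if "a \<in> ?H n" for a n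
    unfolding i_def by (rule cInf_lower) (use that bddb in auto)
  have i_mono: "i n \<le> i m" if "n \<le> m" for n m
    unfolding i_def[of m] by (rule cInf_greatest) (use ne i_le midpoint_hull_antimono[OF that] in blast)+
  have "\<exists>a\<in>?H n. Q a a < i n + 1 / Suc n" for n
    using cInf_lessD[of "(\<lambda>a. Q a a) ` ?H n" "i n + 1 / Suc n"] ne unfolding i_def by auto
  then obtain a where a: "\<And>n. a n \<in> ?H n" "\<And>n. Q (a n) (a n) < i n + 1 / Suc n" by metis
  obtain B where B: "\<And>n. i n \<le> B"
  proof -
    have "i n \<le> (LINT x|M. w x * (K * K))" for n
    proof -
      have "i n \<le> Q (a n) (a n)" using i_le a by blast
      also have "\<dots> \<le> (LINT x|M. w x * (K * K))"
        unfolding Q_def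
      proof (intro integral_mono int[OF a(1) a(1)] integrable_mult_left[OF wint])
        fix x assume x: "x \<in> space M"
        have "\<bar>a n x\<bar> * \<bar>a n x\<bar> \<le> K * K" using bd[OF a(1) x, of n] by (intro mult_mono) auto
        then show "w x * (a n x * a n x) \<le> w x * (K * K)" 
          using w0(1)[of x] by (intro mult_left_mono) (auto simp: less_imp_le)
      qed
      finally show ?thesis .
    qed
    then show ?thesis by (rule that)
  qed
  have "convergent i"
  proof (rule Bseq_mono_convergent)
    have "norm (i n) \<le> max \<bar>B\<bar> \<bar>i 0\<bar>" for n
      using B[of n] i_mono[of 0 n] by auto
    then show "Bseq i"
      unfolding Bseq_eq_bounded bounded_iff by blast
  qed (use i_mono in auto)
  then have i_Cauchy: "Cauchy i" by (rule convergent_Cauchy)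
  have Q_diff: "Q (\<lambda>x. a n x - a m x) (\<lambda>x. a n x - a m x) \<le> 2 * (i m - i n) + 4 * (1 / Suc n)" if "n \<le> m" for n m
  proof -
    let ?c = "\<lambda>x. (a n x + a m x) / 2"
    let ?Q = "\<lambda>n m x. w x * (a n x * a m x)"
    have am: "a m \<in> ?H n" using midpoint_hull_antimono[OF that a(1)] .
    have I: "integrable M (?Q n m)" for n m using int[OF a(1) a(1)] .
    have "i n \<le> Q ?c ?c" by (intro i_le midpoint_hull.midpoint a am)
    moreover have "Q (\<lambda>x. a n x - a m x) (\<lambda>x. a n x - a m x) = 
        Q (a n) (a n) + Q (a m) (a m) - 2 * Q (a n) (a m)"
    proof -
      have "(\<lambda>x. w x * ((a n x - a m x) * (a n x - a m x))) = (\<lambda>x. ?Q n n x + ?Q m m x - 2 * ?Q n m x)"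
        by (auto simp: algebra_simps)
      then show ?thesis unfolding Q_def using I by simp
    qed
    moreover have "Q ?c ?c = (Q (a n) (a n) + Q (a m) (a m) + 2 * Q (a n) (a m)) / 4"
    proof -
      have "(\<lambda>x. w x * (?c x * ?c x)) = (\<lambda>x. (?Q n n x + ?Q m m x + 2 * ?Q n m x) / 4)"
        by (auto simp: field_simps)
      then show ?thesis unfolding Q_def using I by simp
    qed
    moreover have "1 / Suc m \<le> 1 / Suc n" using that by (auto simp: field_simps)
    moreover have "qd \<le> 2 * (j - k) + 4 * d"
      if "k \<le> qc" "qd = qn + qm - 2 * x" "qc = (qn + qm + 2 * x) / 4" "d' \<le> d" "qn < k + d" "qm < j + d'"
      for qc qd qn qm x d d' j k :: real
      using that by simp
    ultimately show ?thesis using a(2)[of n] a(2)[of m] by blast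
  qed
  (* From squared norms to the L1 norm: \<bar>d\<bar> \<le> \<eta> + d\<^sup>2 / \<eta> for every \<eta> > 0, integrated against w. *)
  define w_total where "w_total = (LINT x|M. w x)"
  have w_total_nonneg: "0 \<le> w_total" unfolding w_total_def using w0 by (auto intro!: integral_nonneg_AE AE_I2 simp: less_imp_le)
  have L1_le: "(LINT x|M. norm (w x * a n x - w x * a m x)) \<le>
      \<eta> * w_total + Q (\<lambda>x. a n x - a m x) (\<lambda>x. a n x - a m x) / \<eta>" if "0 < \<eta>" for n m \<eta>
  proof -
    let ?d = "\<lambda>x. a n x - a m x"
    have i1: "integrable M (\<lambda>x. w x * (?d x * ?d x))"
    proof -
      have "(\<lambda>x. w x * (?d x * ?d x)) = (\<lambda>x. w x * (a n x * a n x) + w x * (a m x * a m x) - 2 * (w x * (a n x * a m x)))"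
        by (auto simp: algebra_simps)
      then show ?thesis using int[OF a(1) a(1)] by simp
    qed
    have "(LINT x|M. norm (w x * a n x - w x * a m x)) \<le> (LINT x|M. \<eta> * w x + w x * (?d x * ?d x) / \<eta>)"
    proof (rule Bochner_Integration.integral_mono')
      show "integrable M (\<lambda>x. \<eta> * w x + w x * (?d x * ?d x) / \<eta>)" using i1 wint by auto
      fix x
      have "0 \<le> \<eta> * \<bar>?d x\<bar>" using that by simp
      moreover have "2 * \<eta> * \<bar>?d x\<bar> \<le> \<eta>\<^sup>2 + \<bar>?d x\<bar>\<^sup>2" by (rule sum_squares_bound)
      ultimately have "\<eta> * \<bar>?d x\<bar> \<le> \<eta> * \<eta> + ?d x * ?d x"
        unfolding power2_abs power2_eq_square by linarith
      then have "\<bar>?d x\<bar> \<le> \<eta> + ?d x * ?d x / \<eta>" using that by (simp add: field_simps)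
      then have "w x * \<bar>?d x\<bar> \<le> w x * (\<eta> + ?d x * ?d x / \<eta>)"
        using w0 by (intro mult_left_mono) (auto simp: less_imp_le)
      moreover have "norm (w x * a n x - w x * a m x) = w x * \<bar>?d x\<bar>"
        using w0(1)[of x] by (simp add: abs_mult right_diff_distrib[symmetric])
      ultimately show "norm (w x * a n x - w x * a m x) \<le> \<eta> * w x + w x * (?d x * ?d x) / \<eta>"
        by (simp add: algebra_simps)
      show "0 \<le> \<eta> * w x + w x * (?d x * ?d x) / \<eta>"
        using that w0(1)[of x] by (auto intro!: add_nonneg_nonneg divide_nonneg_pos)
    qed
    also have "\<dots> = \<eta> * w_total + Q ?d ?d / \<eta>" unfolding w_total_def Q_def using i1 wint by simp
    finally show ?thesis .
  qed
  have int1: "integrable M (\<lambda>x. w x * a n x)" for n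
  proof (rule Bochner_Integration.integrable_bound[OF integrable_mult_left[OF wint, of K]])
    show "AE x in M. norm (w x * a n x) \<le> norm (w x * K)"
    proof (rule AE_I2)
      fix x assume "x \<in> space M"
      then have "\<bar>a n x\<bar> \<le> \<bar>K\<bar>" using bd[OF a(1), of x n] by linarith
      then show "norm (w x * a n x) \<le> norm (w x * K)" by (simp add: abs_mult mult_left_mono)
    qed
  qed (use meas[OF a(1)] in measurable)
  have "\<exists>N. \<forall>n\<ge>N. \<forall>m\<ge>N. (LINT x|M. norm (w x * a n x - w x * a m x)) < e" if "0 < e" for e
  proof -
    define \<eta> where "\<eta> = e / (2 * (w_total + 1))"
    have \<eta>: "0 < \<eta>" "\<eta> * w_total < e / 2" using that w_total_nonneg by (auto simp: \<eta>_def field_simps)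
    define q where "q = \<eta> * (e / 2)"
    have "0 < q" using \<eta> that by (simp add: q_def)
    obtain N1 where N1: "\<And>n m. n \<ge> N1 \<Longrightarrow> m \<ge> N1 \<Longrightarrow> \<bar>i m - i n\<bar> < q / 4"
      using CauchyD[OF i_Cauchy, of "q / 4"] \<open>0 < q\<close> by auto
    obtain N2 where N2: "1 / Suc N2 < q / 8" using nat_approx_posE[of "q / 8"] \<open>0 < q\<close> by auto
    have *: "(LINT x|M. norm (w x * a n x - w x * a m x)) < e" if "n \<ge> max N1 N2" "n \<le> m" for n m
    proof -
      have "1 / Suc n \<le> 1 / Suc N2" using that by (auto simp: field_simps)
      then have "4 * (1 / Suc n) < q / 2" using N2 by simp
      then have "Q (\<lambda>x. a n x - a m x) (\<lambda>x. a n x - a m x) < q"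
      proof -
        have "\<bar>i m - i n\<bar> < q / 4" by (rule N1) (use that in auto)
        moreover have "2 * x < q / 2" if "\<bar>x\<bar> < q / 4" for x :: real
          using that by (simp add: abs_less_iff)
        ultimately have "2 * (i m - i n) < q / 2" by blast
        then show ?thesis using \<open>4 * (1 / Suc n) < q / 2\<close> Q_diff[OF that(2)] by linarith
      qed
      then have "Q (\<lambda>x. a n x - a m x) (\<lambda>x. a n x - a m x) / \<eta> < e / 2"
        using \<eta> by (simp add: q_def field_simps)
      then show ?thesis using L1_le[OF \<eta>(1), of n m] \<eta>(2) by linarith
    qed
    have "(LINT x|M. norm (w x * a n x - w x * a m x)) < e" if "n \<ge> max N1 N2" "m \<ge> max N1 N2" for n m
    proof (cases "n \<le> m")
      case False
      have "(LINT x|M. norm (w x * a n x - w x * a m x)) = (LINT x|M. norm (w x * a m x - w x * a n x))"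
        by (intro Bochner_Integration.integral_cong refl norm_minus_commute)
      then show ?thesis using *[of m n] that False by simp
    qed (use * that in auto)
    then show ?thesis by blast
  qed
  from cauchy_L1_AE_cauchy_subseq[OF int1 this]
  obtain r where r: "strict_mono r" "AE x in M. Cauchy (\<lambda>i. w x * a (r i) x)" by blast
  (* Clipping makes the bound hold everywhere, also where the limit does not exist. *)
  define h where "h x = max (- \<bar>K\<bar>) (min \<bar>K\<bar> (lim (\<lambda>i. a (r i) x)))" for x
  have [measurable]: "a n \<in> borel_measurable M" for n using meas[OF a(1)] .
  show ?thesis
  proof (rule that)
    show "a (r n) \<in> ?H n" for n
      using midpoint_hull_antimono[OF seq_suble[OF r(1)] a(1)] .
    show "h \<in> borel_measurable M" unfolding h_def by measurable
    show "\<bar>h x\<bar> \<le> \<bar>K\<bar>" for x unfolding h_def by (simp add: abs_le_iff)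
    have "AE x in M. x \<in> space M" by (rule AE_space)
    with r(2) show "AE x in M. (\<lambda>n. a (r n) x) \<longlonglongrightarrow> h x"
    proof eventually_elim
      case (elim x)
      then obtain l where "(\<lambda>i. w x * a (r i) x) \<longlonglongrightarrow> l" by (auto simp: Cauchy_convergent_iff convergent_def)
      then have "(\<lambda>i. (w x * a (r i) x) / w x) \<longlonglongrightarrow> l / w x" by (intro tendsto_intros) (use w0(1)[of x] in auto)
      then have lim: "(\<lambda>i. a (r i) x) \<longlonglongrightarrow> l / w x" using w0(1)[of x] by simp
      have b: "\<bar>a (r i) x\<bar> \<le> K" for i using bd[OF a(1)] elim by blast
      have "\<bar>l / w x\<bar> \<le> K" by (rule LIMSEQ_le_const2[OF tendsto_rabs[OF lim]]) (use b in auto)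
      then have "h x = l / w x" using limI[OF lim] unfolding h_def by linarith
      then show ?case using lim by simp
    qed
  qed
qed

section \<open>Limits of approximate solutions\<close>

text \<open>
  The part of the equation that is linear in \<open>u\<close>. The time integral of pairings is written as one
  integral over the slab, to which dominated convergence applies directly.
\<close>

definition residual :: 
  "(real \<Rightarrow> (real ^ 'n \<Rightarrow> real) \<Rightarrow> (real ^ 'n \<Rightarrow> real)) \<Rightarrow> (real \<times> (real ^ 'n::finite) \<Rightarrow> real) \<Rightarrow> 
   real \<Rightarrow> (real ^ 'n \<Rightarrow> real) \<Rightarrow> real" where
  "residual A u t \<zeta> = pairing (\<lambda>x. u (t, x)) \<zeta> -
     (LINT p:{0<..<t} \<times> UNIV|lborel. u p * (case p of (s, x) \<Rightarrow> A s \<zeta> x))"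

definition source ::
  "(real ^ 'n \<Rightarrow> real) \<Rightarrow> (real \<times> (real ^ 'n) \<Rightarrow> real) \<Rightarrow> (real \<Rightarrow> real ^ 'n::finite) \<Rightarrow> 
   real \<Rightarrow> (real ^ 'n \<Rightarrow> real) \<Rightarrow> real" where
  "source u0 f h t \<zeta> = pairing u0 \<zeta> + 
     (LINT s:{0<..<t}|lborel. pairing (translate (h s) (\<lambda>x. f (s, x))) \<zeta>)"

lemma weak_solution_iff_residual:
  assumes u: "u \<in> borel_measurable (restrict_space borel (slab T))" "\<And>p. p \<in> slab T \<Longrightarrow> \<bar>u p\<bar> \<le> K"
    and A: "\<And>\<zeta>. \<zeta> \<in> test_fun \<Longrightarrow> set_integrable lborel (open_slab T) (\<lambda>(s, x). A s \<zeta> x)"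
  shows "weak_solution T A u0 f h u \<longleftrightarrow>
    (\<forall>\<zeta>\<in>test_fun. \<forall>t\<in>{0..T}. residual A u t \<zeta> = source u0 f h t \<zeta>)"
proof -
  have "(LINT s:{0<..<t}|lborel. pairing (\<lambda>x. u (s, x)) (A s \<zeta>)) = 
     (LINT p:{0<..<t} \<times> UNIV|lborel. u p * (case p of (s, x) \<Rightarrow> A s \<zeta> x))" 
    if "\<zeta> \<in> test_fun" "t \<in> {0..T}" for \<zeta> t
  proof -
    have "set_integrable lborel ({0<..<t} \<times> UNIV) (\<lambda>p. u p * (case p of (s, x) \<Rightarrow> A s \<zeta> x))"
    proof (rule set_integrable_bounded_mult[where K = K])
      show "set_integrable lborel ({0<..<t} \<times> UNIV) (\<lambda>(s, x). A s \<zeta> x)"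
        by (rule set_integrable_subset[OF A[OF that(1)]]) (use that(2) in auto)
      show "u \<in> borel_measurable (restrict_space borel ({0<..<t} \<times> UNIV))"
        by (rule measurable_restrict_mono[OF u(1)]) (use that(2) in auto)
    qed (use u(2) that in auto)
    from slab_fubini_ival(1)[OF this order_refl, of 0] show ?thesis by (simp add: pairing_def ival_0)
  qed
  then show ?thesis
    unfolding weak_solution_def residual_def source_def by (auto simp: algebra_simps)
qed

locale solution_class =
  fixes T K :: real and W :: "(real \<times> (real ^ 'n::finite) \<Rightarrow> real) set"
  assumes T_pos: "0 < T"
    and W_borel: "W \<subseteq> borel_on (slab T)"
    and W1: "cond_W1 T K W" and W2: "cond_W2 T W" and W3: "cond_W3 T W" and W4: "cond_W4 T W"
begin

lemma W_measurable: "u \<in> W \<Longrightarrow> u \<in> borel_measurable (restrict_space borel (slab T))"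
  using W_borel by (auto simp: borel_on_def)

lemma W_extensional: "u \<in> W \<Longrightarrow> u \<in> extensional (slab T)"
  using W_borel by (auto simp: borel_on_def)

lemma W_abs_le: "u \<in> W \<Longrightarrow> p \<in> slab T \<Longrightarrow> \<bar>u p\<bar> \<le> K"
  using W1 by (auto simp: cond_W1_def)

lemma W_zero_extension_measurable:
  assumes "u \<in> W"
  shows "(\<lambda>p. if p \<in> slab T then u p else 0) \<in> borel_measurable borel"
proof -
  have "slab T \<in> sets (borel :: (real \<times> (real ^ 'n)) measure)"
    by (intro borel_closed closed_Times) auto
  then have "(\<lambda>p. indicator (slab T) p *\<^sub>R u p) \<in> borel_measurable borel"
    using W_measurable[OF assms] by (subst (asm) borel_measurable_restrict_space_iff) auto
  also have "(\<lambda>p. indicator (slab T) p *\<^sub>R u p) = (\<lambda>p. if p \<in> slab T then u p else 0)"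
    by (auto simp: indicator_def)
  finally show ?thesis .
qed

text \<open>
  Condition (W2) speaks of probability spaces of sequences of reals. A law with finite support is carried there by
  numbering the points of its support; measurability in \<open>\<omega>\<close> is then trivial.
\<close>

lemma W_expectation:
  fixes p :: "'b pmf"
  assumes fin: "finite (set_pmf p)" and v: "\<And>\<omega>. \<omega> \<in> set_pmf p \<Longrightarrow> v \<omega> \<in> W"
  shows "restrict (\<lambda>q. measure_pmf.expectation p (\<lambda>\<omega>. v \<omega> q)) (slab T) \<in> W"
proof -
  define S where "S = set_pmf p"
  define enc :: "'b \<Rightarrow> nat \<Rightarrow> real" where "enc \<omega> = (\<lambda>_. real (to_nat_on S \<omega>))" for \<omega>
  have S: "finite S" using fin by (simp add: S_def)
  have inj: "inj_on enc S"
    using inj_on_to_nat_on[OF countable_finite[OF S]] by (auto simp: inj_on_def enc_def fun_eq_iff)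
  define dec where "dec = inv_into S enc"
  have dec: "dec (enc \<omega>) = \<omega>" if "\<omega> \<in> S" for \<omega> using inv_into_f_f[OF inj that] by (simp add: dec_def)
  define M where "M = point_measure (enc ` S) (\<lambda>e. ennreal (pmf p (dec e)))"
  have sum1: "(\<Sum>e\<in>enc ` S. pmf p (dec e)) = 1"
    using S sum_pmf_eq_1[OF S, of p] by (simp add: sum.reindex[OF inj] dec) (simp add: S_def)
  have "prob_space M"
    unfolding M_def by (rule prob_space_point_measure) (use S sum1 in auto)
  moreover have "(\<lambda>(e, q). v (dec e) q) \<in> borel_measurable (M \<Otimes>\<^sub>M restrict_space borel (slab T))"
  proof -
    have "(\<lambda>(e, q). v (dec e) q) \<in> borel_measurable (count_space (enc ` S) \<Otimes>\<^sub>M restrict_space borel (slab T))"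
      by (rule measurable_pair_measure_countable1)
         (use S in \<open>auto intro!: countable_finite W_measurable v simp: dec S_def[symmetric]\<close>)
    also have "borel_measurable (count_space (enc ` S) \<Otimes>\<^sub>M restrict_space borel (slab T))
      = borel_measurable (M \<Otimes>\<^sub>M restrict_space borel (slab T))"
      by (intro measurable_cong_sets sets_pair_measure_cong) (auto simp: M_def sets_point_measure)
    finally show ?thesis .
  qed
  moreover have "\<forall>e\<in>space M. v (dec e) \<in> W"
    using v by (auto simp: M_def space_point_measure dec S_def[symmetric])
  ultimately have "restrict (\<lambda>q. LINT e|M. v (dec e) q) (slab T) \<in> W"
    using W2[unfolded cond_W2_def, rule_format, of M "\<lambda>e. v (dec e)"] by blast
  moreover have "(LINT e|M. v (dec e) q) = measure_pmf.expectation p (\<lambda>\<omega>. v \<omega> q)" for q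
  proof -
    have "(LINT e|M. v (dec e) q) = (\<Sum>e\<in>enc ` S. pmf p (dec e) * v (dec e) q)"
      unfolding M_def using S by (subst lebesgue_integral_point_measure_finite) auto
    also have "\<dots> = (\<Sum>\<omega>\<in>S. v \<omega> q * pmf p \<omega>)"
      by (simp add: sum.reindex[OF inj] dec mult.commute)
    also have "\<dots> = measure_pmf.expectation p (\<lambda>\<omega>. v \<omega> q)"
      by (rule integral_measure_pmf_real[symmetric]) (use S in \<open>auto simp: S_def\<close>)
    finally show ?thesis .
  qed
  ultimately show ?thesis by simp
qed

lemma W_midpoint:
  assumes "u \<in> W" "v \<in> W"
  shows "restrict (\<lambda>p. (u p + v p) / 2) (slab T) \<in> W"
proof -
  have "restrict (\<lambda>q. measure_pmf.expectation (pmf_of_set {True, False}) (\<lambda>b. (if b then u else v) q)) (slab T) \<in> W"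
    by (rule W_expectation) (use assms in auto)
  moreover have "measure_pmf.expectation (pmf_of_set {True, False}) (\<lambda>b. (if b then u else v) q) = (u q + v q) / 2" for q
    by (subst integral_pmf_of_set) auto
  ultimately show ?thesis by simp
qed

text \<open>
  Convex combinations \<open>g n\<close> of the tails converge almost everywhere on the slab to some \<open>h\<close>, so the
  integrals over \<open>(0, t)\<close> converge, and then the equation forces \<open>(g n)\<^sub>t\<close> to converge when paired
  with test functions, with a limit \<open>l t \<zeta>\<close>, for every \<open>t\<close>. At almost every \<open>t\<close> this limit is
  given by \<open>h\<^sub>t\<close>. At another \<open>t\<close> the function representing it is found by taking convex combinations
  once more at that single time. Condition (W4) allows this choice to be made for each \<open>t\<close> separately, and
  the element \<open>w\<close> of \<open>W\<close> that it provides agrees with \<open>h\<close> almost everywhere on the slab.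
\<close>

lemma exists_residual_limit:
  assumes A: "\<And>\<zeta>. \<zeta> \<in> test_fun \<Longrightarrow> set_integrable lborel (open_slab T) (\<lambda>(s, x). A s \<zeta> x)"
    and v: "\<And>k. v k \<in> W"
    and lim: "\<And>\<zeta> t. \<zeta> \<in> test_fun \<Longrightarrow> t \<in> {0..T} \<Longrightarrow> (\<lambda>k. residual A (v k) t \<zeta>) \<longlonglongrightarrow> c t \<zeta>"
  obtains u where "u \<in> W" "\<And>\<zeta> t. \<zeta> \<in> test_fun \<Longrightarrow> t \<in> {0..T} \<Longrightarrow> residual A u t \<zeta> = c t \<zeta>"
proof -
  define I where "I t \<zeta> u = (LINT p:{0<..<t} \<times> UNIV|lborel. u p * (case p of (s, x) \<Rightarrow> A s \<zeta> x))" for t \<zeta> and u :: "real \<times> (real ^ 'n) \<Rightarrow> real"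
  have res: "residual A u t \<zeta> = pairing (\<lambda>x. u (t, x)) \<zeta> - I t \<zeta> u" for u t \<zeta>
    by (simp add: residual_def I_def)
  have "\<bar>v 0 (0, 0)\<bar> \<le> K" using T_pos by (intro W_abs_le v) auto
  then have K0: "0 \<le> K" by linarith
  have slab_sets[measurable]: "slab T \<in> sets (borel :: (real \<times> (real ^ 'n)) measure)"
    by (intro borel_closed closed_Times) auto
  (* Extension by 0: the elements of W have no prescribed values off the slab. *)
  define F where "F k p = (if p \<in> slab T then v k p else 0)" for k p
  have Fm: "F k \<in> borel_measurable borel" for k
    unfolding F_def by (rule W_zero_extension_measurable[OF v])
  have Fb: "\<bar>F k p\<bar> \<le> K" for k p using W_abs_le[OF v] K0 by (auto simp: F_def)
  let ?H = "midpoint_hull F"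
  have Hm: "a \<in> borel_measurable borel" if "a \<in> ?H n" for a n
    using midpoint_hull_measurable[OF Fm that] .
  have Hb: "\<bar>a p\<bar> \<le> K" if "a \<in> ?H n" for a n p
    using midpoint_hull_abs_le[OF Fb that] .
  have HW: "restrict a (slab T) \<in> W" if "a \<in> ?H n" for a n
    using that
  proof induction
    case (base m)
    have "restrict (F m) (slab T) = v m"
      using W_extensional[OF v[of m]] by (auto simp: F_def restrict_def extensional_def fun_eq_iff)
    then show ?case using v by simp
  next
    case (midpoint a b)
    have "restrict (\<lambda>p. (restrict a (slab T) p + restrict b (slab T) p) / 2) (slab T) = 
      restrict (\<lambda>p. (a p + b p) / 2) (slab T)" by (auto simp: restrict_def)
    then show ?case using W_midpoint[OF midpoint.IH] by metis
  qed
  have Iint: "set_integrable lborel ({0<..<t} \<times> UNIV) (\<lambda>p. a p * (case p of (s, x) \<Rightarrow> A s \<zeta> x))"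
    if "\<zeta> \<in> test_fun" "t \<in> {0..T}" "a \<in> borel_measurable borel" "\<And>p. \<bar>a p\<bar> \<le> K" for \<zeta> t a
  proof (rule set_integrable_bounded_mult)
    show "set_integrable lborel ({0<..<t} \<times> UNIV) (\<lambda>(s, x). A s \<zeta> x)"
      by (rule set_integrable_subset[OF A[OF that(1)]]) (use that(2) in auto)
  qed (use that measurable_restrict_space1 in auto)
  have sec: "(\<lambda>x. a (t, x)) \<in> borel_measurable borel" if "a \<in> borel_measurable borel" for a :: "real \<times> (real ^ 'n) \<Rightarrow> real" and t
    by (rule measurable_compose[OF _ that]) (intro borel_measurable_continuous_onI continuous_intros)
  obtain g h where g: "\<And>n. g n \<in> ?H n" and h[measurable]: "h \<in> borel_measurable lborel" and hb: "\<And>p. \<bar>h p\<bar> \<le> \<bar>K\<bar>"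
    and gh: "AE p in lborel. (\<lambda>n. g n p) \<longlonglongrightarrow> h p"
    by (rule midpoint_hull_AE_convergent[OF sigma_finite_lborel, of F K]) (use Fm Fb in auto)
  have [measurable]: "g n \<in> borel_measurable borel" for n using Hm g by blast
  have Ilim: "(\<lambda>n. I t \<zeta> (g n)) \<longlonglongrightarrow> I t \<zeta> h" if z: "\<zeta> \<in> test_fun" "t \<in> {0..T}" for \<zeta> t
    unfolding I_def set_lebesgue_integral_def
  proof (rule integral_dominated_convergence)
    let ?A = "\<lambda>p. case p of (s, x) \<Rightarrow> A s \<zeta> x"
    let ?D = "{0<..<t} \<times> UNIV :: (real \<times> (real ^ 'n)) set"
    have "set_integrable lborel ?D ?A"
      by (rule set_integrable_subset[OF A[OF z(1)]]) (use z(2) in auto)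
    then show "integrable lborel (\<lambda>p. K * norm (indicator ?D p *\<^sub>R ?A p))"
      unfolding set_integrable_def by (intro integrable_mult_right integrable_norm)
    show "(\<lambda>p. indicator ?D p *\<^sub>R (h p * ?A p)) \<in> borel_measurable lborel"
      using Iint[OF z, of h] h hb K0 unfolding set_integrable_def by (auto dest!: borel_measurable_integrable)
    show "(\<lambda>p. indicator ?D p *\<^sub>R (g n p * ?A p)) \<in> borel_measurable lborel" for n
      using Iint[OF z Hm Hb, OF g g] unfolding set_integrable_def by (rule borel_measurable_integrable)
    show "AE p in lborel. (\<lambda>n. indicator ?D p *\<^sub>R (g n p * ?A p)) \<longlonglongrightarrow> indicator ?D p *\<^sub>R (h p * ?A p)"
      using gh by eventually_elim (intro tendsto_intros)
    show "AE p in lborel. norm (indicator ?D p *\<^sub>R (g n p * ?A p)) \<le> K * norm (indicator ?D p *\<^sub>R ?A p)" for n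
      using Hb[OF g] by (auto simp: abs_mult indicator_def intro!: mult_right_mono)
  qed
  define l where "l t \<zeta> = c t \<zeta> + I t \<zeta> h" for t \<zeta>
  have glim: "(\<lambda>n. pairing (\<lambda>x. g n (t, x)) \<zeta>) \<longlonglongrightarrow> l t \<zeta>" if z: "\<zeta> \<in> test_fun" "t \<in> {0..T}" for \<zeta> t
  proof -
    have "(\<lambda>n. residual A (g n) t \<zeta>) \<longlonglongrightarrow> c t \<zeta>"
    proof (rule midpoint_hull_tendsto[OF _ g])
      have "residual A (F k) t \<zeta> = residual A (v k) t \<zeta>" for k
        unfolding res I_def F_def pairing_def
        using z(2) by (auto intro!: set_lebesgue_integral_cong arg_cong2[of _ _ _ _ "(-)"])
      then show "(\<lambda>k. residual A (F k) t \<zeta>) \<longlonglongrightarrow> c t \<zeta>" using lim[OF z] by simp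
    next
      fix n a b assume ab: "a \<in> ?H n" "b \<in> ?H n"
      have "I t \<zeta> (\<lambda>p. (a p + b p) / 2) = (I t \<zeta> a + I t \<zeta> b) / 2"
      proof -
        have "(\<lambda>p. (a p + b p) / 2 * (case p of (s, x) \<Rightarrow> A s \<zeta> x)) = 
          (\<lambda>p. (a p * (case p of (s, x) \<Rightarrow> A s \<zeta> x) + b p * (case p of (s, x) \<Rightarrow> A s \<zeta> x)) / 2)"
          by (auto simp: field_simps)
        then show ?thesis
          unfolding I_def using set_integral_add[OF Iint[OF z Hm Hb, OF ab(1) ab(1)] Iint[OF z Hm Hb, OF ab(2) ab(2)]]
          by simp
      qed
      moreover have "pairing (\<lambda>x. (a (t, x) + b (t, x)) / 2) \<zeta> = 
          (pairing (\<lambda>x. a (t, x)) \<zeta> + pairing (\<lambda>x. b (t, x)) \<zeta>) / 2"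
        by (rule pairing_midpoint[OF sec[OF Hm] Hb sec[OF Hm] Hb]) (use ab z in auto)
      ultimately show "residual A (\<lambda>p. (a p + b p) / 2) t \<zeta> = (residual A a t \<zeta> + residual A b t \<zeta>) / 2"
        unfolding res by (simp add: field_simps)
    qed
    from tendsto_add[OF this Ilim[OF z]] show ?thesis by (simp add: res l_def)
  qed
  (* At good times the limit at time t has to be the section of h itself,
     since the integral term only sees h. *)
  define good where "good t \<longleftrightarrow> (AE x in lborel. (\<lambda>n. g n (t, x)) \<longlonglongrightarrow> h (t, x))" for t
  have AE_good: "AE t in lborel. good t"
    unfolding good_def by (rule lborel_pair.AE_pair) (use gh in \<open>simp only: lborel_prod\<close>)
  have hb': "\<bar>h p\<bar> \<le> K" for p using hb[of p] K0 by simp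
  have "\<exists>\<phi>. \<phi> \<in> borel_measurable borel \<and> (\<forall>x. \<bar>\<phi> x\<bar> \<le> K) \<and> (\<forall>\<zeta>\<in>test_fun. pairing \<phi> \<zeta> = l t \<zeta>) \<and> 
    (good t \<longrightarrow> \<phi> = (\<lambda>x. h (t, x)))" if t: "t \<in> {0..T}" for t
  proof (cases "good t")
    case True
    have "pairing (\<lambda>x. h (t, x)) \<zeta> = l t \<zeta>" if "\<zeta> \<in> test_fun" for \<zeta>
      by (rule LIMSEQ_unique[OF pairing_tendsto[OF sec[OF Hm[OF g]] Hb[OF g] sec] glim])
         (use True that t h in \<open>auto simp: good_def\<close>)
    moreover have "h \<in> borel_measurable borel" using h by simp
    ultimately show ?thesis using sec[of h t] hb' by (intro exI[of _ "\<lambda>x. h (t, x)"]) auto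
  next
    case False
    obtain k \<phi> where k: "\<And>n. k n \<in> midpoint_hull (\<lambda>n x. g n (t, x)) n" and \<phi>: "\<phi> \<in> borel_measurable lborel" "\<And>x. \<bar>\<phi> x\<bar> \<le> \<bar>K\<bar>"
      and lim': "AE x in lborel. (\<lambda>n. k n x) \<longlonglongrightarrow> \<phi> x"
      by (rule midpoint_hull_AE_convergent[OF sigma_finite_lborel, of "\<lambda>n x. g n (t, x)" K])
         (use sec[OF Hm[OF g]] Hb[OF g] in auto)
    have m: "a \<in> borel_measurable borel" if "a \<in> midpoint_hull (\<lambda>n x. g n (t, x)) n" for a n
      using midpoint_hull_measurable[OF _ that] sec[OF Hm[OF g]] by blast
    have b: "\<bar>a x\<bar> \<le> K" if "a \<in> midpoint_hull (\<lambda>n x. g n (t, x)) n" for a n x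
      using midpoint_hull_abs_le[OF _ that] Hb[OF g] by blast
    have "pairing \<phi> \<zeta> = l t \<zeta>" if z: "\<zeta> \<in> test_fun" for \<zeta>
    proof (rule LIMSEQ_unique)
      show "(\<lambda>n. pairing (k n) \<zeta>) \<longlonglongrightarrow> pairing \<phi> \<zeta>"
        by (rule pairing_tendsto[OF m[OF k] b[OF k] _ lim' z]) (use \<phi> in auto)
      show "(\<lambda>n. pairing (k n) \<zeta>) \<longlonglongrightarrow> l t \<zeta>"
        by (rule midpoint_hull_tendsto[OF glim[OF z t] k]) (rule pairing_midpoint[OF m b m b z])
    qed
    moreover have "\<phi> \<in> borel_measurable borel" "\<bar>\<phi> x\<bar> \<le> K" for x using \<phi>(1) \<phi>(2)[of x] K0 by simp_all
    ultimately show ?thesis using False by blast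
  qed
  then have "\<exists>\<phi>. \<forall>t\<in>{0..T}. \<phi> t \<in> borel_measurable borel \<and> (\<forall>x. \<bar>\<phi> t x\<bar> \<le> K) \<and>
      (\<forall>\<zeta>\<in>test_fun. pairing (\<phi> t) \<zeta> = l t \<zeta>) \<and> (good t \<longrightarrow> \<phi> t = (\<lambda>x. h (t, x)))"
    by (intro bchoice ballI)
  then obtain \<phi> where \<phi>: "\<And>t. t \<in> {0..T} \<Longrightarrow> \<phi> t \<in> borel_measurable borel" "\<And>t x. t \<in> {0..T} \<Longrightarrow> \<bar>\<phi> t x\<bar> \<le> K"
     "\<And>t \<zeta>. t \<in> {0..T} \<Longrightarrow> \<zeta> \<in> test_fun \<Longrightarrow> pairing (\<phi> t) \<zeta> = l t \<zeta>" 
     "\<And>t. t \<in> {0..T} \<Longrightarrow> good t \<Longrightarrow> \<phi> t = (\<lambda>x. h (t, x))"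
    by blast
  have "\<exists>w\<in>W. \<forall>t\<in>{0..T}. AE x in lborel. w (t, x) = (case (t, x) of (t, x) \<Rightarrow> \<phi> t x)"
  proof (rule W4[unfolded cond_W4_def, rule_format, of "\<lambda>n. restrict (g n) (slab T)"])
    show "restrict (g n) (slab T) \<in> W" for n using HW[OF g] .
    show "bounded ((\<lambda>(t, x). \<phi> t x) ` slab T)"
      unfolding bounded_iff using \<phi>(2) by (intro exI[of _ K]) auto
    show "(\<lambda>x. case (t, x) of (t, x) \<Rightarrow> \<phi> t x) \<in> borel_measurable borel" if "t \<in> {0..T}" for t
      using \<phi>(1)[OF that] by simp
    show "(\<lambda>n. pairing (\<lambda>x. restrict (g n) (slab T) (t, x)) \<zeta>) \<longlonglongrightarrow> 
      pairing (\<lambda>x. case (t, x) of (t, x) \<Rightarrow> \<phi> t x) \<zeta>" if "t \<in> {0..T}" "\<zeta> \<in> test_fun" for t \<zeta>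
      using glim[OF that(2,1)] \<phi>(3)[OF that] that(1) by simp
  qed
  then obtain w where w: "w \<in> W" "\<And>t. t \<in> {0..T} \<Longrightarrow> AE x in lborel. w (t, x) = \<phi> t x"
    by auto
  define w' where "w' p = (if p \<in> slab T then w p else 0)" for p
  have w'm: "w' \<in> borel_measurable borel"
    unfolding w'_def by (rule W_zero_extension_measurable[OF w(1)])
  have w'b: "\<bar>w' p\<bar> \<le> K" for p using W_abs_le[OF w(1)] K0 by (auto simp: w'_def)
  have "AE p in lborel \<Otimes>\<^sub>M lborel. p \<in> slab T \<longrightarrow> w' p = h p"
  proof (rule lborel_pair.AE_pair_measure)
    note [measurable] = w'm
    have "{p \<in> space lborel. p \<in> slab T \<longrightarrow> w' p = h p} \<in> sets lborel" by measurable
    then show "{p \<in> space (lborel \<Otimes>\<^sub>M lborel). p \<in> slab T \<longrightarrow> w' p = h p} \<in> sets (lborel \<Otimes>\<^sub>M lborel)"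
      by (simp only: lborel_prod)
    show "AE t in lborel. AE x in lborel. (t, x) \<in> slab T \<longrightarrow> w' (t, x) = h (t, x)"
      using AE_good
    proof eventually_elim
      case (elim t)
      show ?case
      proof (cases "t \<in> {0..T}")
        case True
        from w(2)[OF True] show ?thesis 
          by eventually_elim (use \<phi>(4)[OF True elim] True in \<open>simp add: w'_def\<close>)
      qed auto
    qed
  qed
  then have AEw: "AE p in lborel. p \<in> slab T \<longrightarrow> w' p = h p" by (simp only: lborel_prod)
  show ?thesis
  proof (rule that[OF w(1)])
    fix \<zeta> :: "real ^ 'n \<Rightarrow> real" and t assume z: "\<zeta> \<in> test_fun" "t \<in> {0..T}"
    have "I t \<zeta> w = I t \<zeta> w'"
      unfolding I_def using z(2) by (intro set_lebesgue_integral_cong) (auto simp: w'_def)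
    also have "\<dots> = I t \<zeta> h"
      unfolding I_def set_lebesgue_integral_def
    proof (rule integral_cong_AE)
      let ?A = "\<lambda>p. case p of (s, x) \<Rightarrow> A s \<zeta> x"
      let ?D = "{0<..<t} \<times> UNIV :: (real \<times> (real ^ 'n)) set"
      show "(\<lambda>p. indicator ?D p *\<^sub>R (w' p * ?A p)) \<in> borel_measurable lborel"
        using Iint[OF z w'm w'b] unfolding set_integrable_def by (rule borel_measurable_integrable)
      show "(\<lambda>p. indicator ?D p *\<^sub>R (h p * ?A p)) \<in> borel_measurable lborel"
        using Iint[OF z _ hb'] h unfolding set_integrable_def by (auto dest!: borel_measurable_integrable)
      show "AE p in lborel. indicator ?D p *\<^sub>R (w' p * ?A p) = indicator ?D p *\<^sub>R (h p * ?A p)"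
        using AEw by eventually_elim (use z(2) in \<open>auto simp: indicator_def\<close>)
    qed
    finally have 1: "I t \<zeta> w = I t \<zeta> h" .
    have "pairing (\<lambda>x. w (t, x)) \<zeta> = pairing (\<phi> t) \<zeta>"
      unfolding pairing_def
    proof (rule integral_cong_AE)
      note [measurable] = borel_on_section[OF W_measurable[OF w(1)] z(2)] \<phi>(1)[OF z(2)] test_fun_measurable[OF z(1)]
      show "(\<lambda>x. w (t, x) * \<zeta> x) \<in> borel_measurable lborel" "(\<lambda>x. \<phi> t x * \<zeta> x) \<in> borel_measurable lborel"
        by measurable
      show "AE x in lborel. w (t, x) * \<zeta> x = \<phi> t x * \<zeta> x" using w(2)[OF z(2)] by eventually_elim simp
    qed
    then show "residual A w t \<zeta> = c t \<zeta>" using 1 \<phi>(3)[OF z(2,1)] by (simp add: res l_def)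
  qed
qed

end

section \<open>Independent jumps on a time grid\<close>

text \<open>
  The law of a jump: \<open>None\<close> stands for no jump and takes the remaining probability.
\<close>

lemma exists_pmf_option:
  fixes c :: "'j \<Rightarrow> real"
  assumes J: "finite J" and c: "\<And>j. j \<in> J \<Longrightarrow> 0 \<le> c j" "sum c J \<le> 1"
  obtains p :: "'j option pmf" where "finite (set_pmf p)" 
    "\<And>G :: 'j option \<Rightarrow> real. measure_pmf.expectation p G = G None + (\<Sum>j\<in>J. c j * (G (Some j) - G None))"
proof -
  define w where "w x = (case x of None \<Rightarrow> 1 - sum c J | Some j \<Rightarrow> if j \<in> J then c j else 0)" for x
  define S where "S = insert None (Some ` J)"
  have S: "finite S" using J by (simp add: S_def)
  have w0: "0 \<le> w x" for x using c by (auto simp: w_def split: option.split)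
  have sum: "(\<Sum>x\<in>S. w x * G x) = G None + (\<Sum>j\<in>J. c j * (G (Some j) - G None))" for G
  proof -
    have "(\<Sum>x\<in>S. w x * G x) = w None * G None + (\<Sum>x\<in>Some ` J. w x * G x)"
      unfolding S_def using J by (intro sum.insert) auto
    also have "(\<Sum>x\<in>Some ` J. w x * G x) = (\<Sum>j\<in>J. c j * G (Some j))"
      by (simp add: sum.reindex w_def)
    finally show ?thesis by (simp add: w_def algebra_simps sum_subtractf sum_distrib_left)
  qed
  have "(\<integral>\<^sup>+x. ennreal (w x) \<partial>count_space UNIV) = (\<Sum>x\<in>S. ennreal (w x))"
    by (rule nn_integral_count_space'[OF S]) (auto simp: w_def S_def image_iff split: option.split_asm)
  also have "\<dots> = ennreal (\<Sum>x\<in>S. w x)" using w0 by simp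
  also have "(\<Sum>x\<in>S. w x) = 1" using sum[of "\<lambda>_. 1"] by simp
  finally have pmf: "pmf (embed_pmf w) x = w x" for x
    using w0 by (intro pmf_embed_pmf) auto
  have sub: "set_pmf (embed_pmf w) \<subseteq> S"
    by (auto simp: set_pmf_eq pmf w_def S_def split: option.split_asm if_splits)
  show ?thesis
  proof (rule that)
    show "finite (set_pmf (embed_pmf w))" using sub S finite_subset by blast
    fix G :: "'j option \<Rightarrow> real"
    have "measure_pmf.expectation (embed_pmf w) G = (\<Sum>x\<in>S. G x * pmf (embed_pmf w) x)"
      by (rule integral_measure_pmf_real[OF S]) (use sub in auto)
    then show "measure_pmf.expectation (embed_pmf w) G = G None + (\<Sum>j\<in>J. c j * (G (Some j) - G None))"
      using sum[of G] by (simp add: pmf mult.commute)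
  qed
qed

text \<open>
  If \<open>F\<close> ignores the coordinate \<open>k\<close> of \<open>\<omega>\<close>, then \<open>\<omega> k\<close> is independent of it and can be integrated
  separately.
\<close>

lemma Pi_pmf_expectation_indep:
  fixes p :: "'i \<Rightarrow> 'j pmf" and F :: "('i \<Rightarrow> 'j) \<Rightarrow> 'j \<Rightarrow> real"
  assumes I: "finite I" and k: "k \<in> I" and fin: "\<And>i. i \<in> I \<Longrightarrow> finite (set_pmf (p i))"
    and F: "\<And>\<omega> y z. F (fun_upd \<omega> k y) z = F \<omega> z"
  shows "measure_pmf.expectation (Pi_pmf I d p) (\<lambda>\<omega>. F \<omega> (\<omega> k)) = 
    measure_pmf.expectation (p k) (\<lambda>z. measure_pmf.expectation (Pi_pmf I d p) (\<lambda>\<omega>. F \<omega> z))"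
proof -
  let ?I = "I - {k}" and ?P = "Pi_pmf (I - {k}) d p"
  have Pi: "Pi_pmf I d p = map_pmf (\<lambda>(y, \<omega>). fun_upd \<omega> k y) (pair_pmf (p k) ?P)"
    using Pi_pmf_insert[of ?I k d p] I k by (simp add: insert_absorb)
  have fP: "finite (set_pmf ?P)" using I fin by (auto simp: set_Pi_pmf)
  have fin_pair: "finite (set_pmf (pair_pmf (p k) ?P))" using fP fin[OF k] by simp
  have E: "measure_pmf.expectation (Pi_pmf I d p) G = 
      (\<Sum>y\<in>set_pmf (p k). \<Sum>\<omega>\<in>set_pmf ?P. pmf (p k) y * pmf ?P \<omega> * G (fun_upd \<omega> k y))" for G :: "('i \<Rightarrow> 'j) \<Rightarrow> real"
  proof -
    have "measure_pmf.expectation (Pi_pmf I d p) G = 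
      measure_pmf.expectation (pair_pmf (p k) ?P) (\<lambda>(y, \<omega>). G (fun_upd \<omega> k y))"
      unfolding Pi by (simp add: case_prod_beta')
    also have "\<dots> = (\<Sum>q\<in>set_pmf (p k) \<times> set_pmf ?P. (\<lambda>(y, \<omega>). G (fun_upd \<omega> k y)) q * pmf (pair_pmf (p k) ?P) q)"
      by (rule integral_measure_pmf_real) (use fP fin[OF k] in auto)
    also have "\<dots> = (\<Sum>y\<in>set_pmf (p k). \<Sum>\<omega>\<in>set_pmf ?P. pmf (p k) y * pmf ?P \<omega> * G (fun_upd \<omega> k y))"
      unfolding sum.cartesian_product by (intro sum.cong) (auto simp: pmf_pair mult_ac)
    finally show ?thesis .
  qed
  have E1: "measure_pmf.expectation (p k) G = (\<Sum>y\<in>set_pmf (p k). pmf (p k) y * G y)" for G :: "'j \<Rightarrow> real"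
    by (subst integral_measure_pmf_real[of "set_pmf (p k)"]) (use fin[OF k] in \<open>auto simp: mult.commute\<close>)
  have s1: "(\<Sum>y\<in>set_pmf (p k). pmf (p k) y) = 1" using fin[OF k] by (intro sum_pmf_eq_1) auto
  have "measure_pmf.expectation (Pi_pmf I d p) (\<lambda>\<omega>. F \<omega> z) = (\<Sum>\<omega>\<in>set_pmf ?P. pmf ?P \<omega> * F \<omega> z)" for z
    unfolding E F by (simp add: mult.assoc sum_distrib_left[symmetric] sum_distrib_right[symmetric] s1)
  then show ?thesis
    unfolding E E1 F by (simp add: sum_distrib_left mult.assoc)
qed

lemma expectation_integral_swap:
  fixes g :: "'b \<Rightarrow> 'a \<Rightarrow> real"
  assumes fin: "finite (set_pmf p)" and g: "\<And>\<omega>. integrable M (g \<omega>)"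
  shows "(LINT x|M. measure_pmf.expectation p (\<lambda>\<omega>. g \<omega> x)) = measure_pmf.expectation p (\<lambda>\<omega>. LINT x|M. g \<omega> x)"
proof -
  have E: "measure_pmf.expectation p G = (\<Sum>\<omega>\<in>set_pmf p. pmf p \<omega> * G \<omega>)" for G :: "'b \<Rightarrow> real"
    by (subst integral_measure_pmf_real[OF fin]) (auto simp: mult.commute)
  show ?thesis unfolding E using g by simp
qed

text \<open>
  The end points of the \<open>N\<close> cells, and the number of the cell that contains \<open>s\<close>. Cells are closed on
  the left, but the last one also contains \<open>T\<close>, whence the minimum in \<open>slot\<close>: there is no jump at \<open>T\<close>.
\<close>

definition grid :: "real \<Rightarrow> nat \<Rightarrow> nat \<Rightarrow> real" where
  "grid T N k = real k * T / real N"

definition slot :: "real \<Rightarrow> nat \<Rightarrow> real \<Rightarrow> nat" where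
  "slot T N s = min (N - 1) (nat \<lfloor>s * real N / T\<rfloor>)"

lemma grid_simps [simp]: "grid T N 0 = 0" "0 < N \<Longrightarrow> grid T N N = T"
  by (auto simp: grid_def)

lemma grid_Suc: "grid T N (Suc k) = grid T N k + T / real N"
  by (simp add: grid_def add_divide_distrib algebra_simps)

lemma grid_mono: "0 < T \<Longrightarrow> j \<le> k \<Longrightarrow> grid T N j \<le> grid T N k"
  by (auto simp: grid_def intro!: divide_right_mono mult_right_mono)

lemma grid_range: "0 < T \<Longrightarrow> 0 < N \<Longrightarrow> k \<le> N \<Longrightarrow> 0 \<le> grid T N k \<and> grid T N k \<le> T"
  using grid_mono[of T 0 k N] grid_mono[of T k N N] by simp

lemma slot_measurable [measurable]: "slot T N \<in> borel \<rightarrow>\<^sub>M count_space UNIV"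
  unfolding slot_def by measurable

lemma slot_eq:
  assumes "0 < T" "0 < N" "k < N" "grid T N k \<le> s" "s < grid T N (Suc k)"
  shows "slot T N s = k"
proof -
  have "real k \<le> s * real N / T" "s * real N / T < real k + 1"
    using assms by (auto simp: grid_def field_simps)
  then have "\<lfloor>s * real N / T\<rfloor> = int k" by (intro floor_unique) auto
  then show ?thesis using assms by (simp add: slot_def)
qed

lemma slot_less: "0 < N \<Longrightarrow> slot T N s < N"
  by (auto simp: slot_def min_def)

lemma slot_bounds:
  assumes "0 < T" "0 < N" "s \<in> {0..T}"
  shows "grid T N (slot T N s) \<le> s" "s \<le> grid T N (Suc (slot T N s))"
proof -
  let ?r = "s * real N / T"
  have r: "0 \<le> ?r" "?r \<le> real N" using assms by (auto simp: field_simps intro: mult_right_mono)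
  have fl: "real (nat \<lfloor>?r\<rfloor>) \<le> ?r" "?r < real (nat \<lfloor>?r\<rfloor>) + 1" using r(1) by linarith+
  have "real (slot T N s) \<le> ?r" using fl(1) by (auto simp: slot_def min_def)
  then show "grid T N (slot T N s) \<le> s" using assms by (simp add: grid_def field_simps)
  have "?r \<le> real (Suc (slot T N s))"
  proof (cases "nat \<lfloor>?r\<rfloor> \<le> N - 1")
    case True then show ?thesis using fl(2) by (simp add: slot_def min_def)
  next
    case False then show ?thesis using r(2) assms(2) by (simp add: slot_def min_def of_nat_diff)
  qed
  then show "s \<le> grid T N (Suc (slot T N s))" using assms by (simp add: grid_def field_simps)
qed

lemma eventually_cell_mass_small:
  fixes a :: "real \<Rightarrow> real"
  assumes T: "0 < T" and a: "set_integrable lborel {0<..<T} a" and e: "0 < e"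
  shows "\<forall>\<^sub>F N in sequentially. \<forall>k<N. \<forall>r s. grid T N k \<le> r \<longrightarrow> r \<le> s \<longrightarrow> s \<le> grid T N (Suc k) \<longrightarrow>
    (LINT x:ival r s|lborel. \<bar>a x\<bar>) \<le> e"
proof -
  define \<gamma> where "\<gamma> s = indicator {0<..<T} s *\<^sub>R a s" for s
  have int: "integrable lborel \<gamma>" using a unfolding set_integrable_def \<gamma>_def by simp
  obtain d where d: "0 < d" "\<And>r t. r \<le> t \<Longrightarrow> t - r < d \<Longrightarrow> (LINT s:{r..<t}|lborel. \<bar>\<gamma> s\<bar>) < e"
    using integrable_uniformly_small[OF int e] by blast
  obtain N0 :: nat where N0: "T / d < real N0" using reals_Archimedean2 by blast
  show ?thesis
  proof (rule eventually_sequentiallyI[of N0], intro allI impI)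
    fix N k r s assume N: "N0 \<le> N" "k < N" and rs: "grid T N k \<le> r" "r \<le> s" "s \<le> grid T N (Suc k)"
    have "0 < N" using N by simp
    have sT: "s \<le> T" using rs(3) grid_range[OF T \<open>0 < N\<close>, of "Suc k"] N(2) by simp
    have r0: "0 \<le> r" using rs(1) grid_range[OF T \<open>0 < N\<close>, of k] N(2) by simp
    have "T / d < real N" using N0 N(1) by linarith
    then have "T / real N < d" using d(1) \<open>0 < N\<close> by (simp add: field_simps)
    moreover have "s - r \<le> T / real N" using rs by (simp add: grid_Suc)
    ultimately have "(LINT x:{r..<s}|lborel. \<bar>\<gamma> x\<bar>) < e" using rs(2) by (intro d) auto
    moreover have "(LINT x:ival r s|lborel. \<bar>a x\<bar>) = (LINT x:{r..<s}|lborel. \<bar>\<gamma> x\<bar>)"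
      unfolding set_lebesgue_integral_def
      by (rule Bochner_Integration.integral_cong) (use r0 sT in \<open>auto simp: \<gamma>_def ival_def indicator_def\<close>)
    ultimately show "(LINT x:ival r s|lborel. \<bar>a x\<bar>) \<le> e" by simp
  qed
qed

lemma eventually_cell_integral_small:
  fixes G :: "real \<times> (real ^ 'n::finite) \<Rightarrow> real"
  assumes T: "0 < T" and G: "set_integrable lborel (open_slab T) G" and e: "0 < e"
  shows "\<forall>\<^sub>F N in sequentially. \<forall>k<N. \<forall>r s. grid T N k \<le> r \<longrightarrow> r \<le> s \<longrightarrow> s \<le> grid T N (Suc k) \<longrightarrow>
    (LINT p:ival r s \<times> UNIV|lborel. \<bar>G p\<bar>) \<le> e"
proof -
  have absG: "set_integrable lborel (open_slab T) (\<lambda>p. \<bar>G p\<bar>)"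
    using G by (rule set_integrable_abs)
  have "set_integrable lborel {0<..<T} (\<lambda>s. LINT x|lborel. \<bar>G (s, x)\<bar>)"
    using slab_fubini_ival(2)[OF absG order_refl, of 0] by (simp add: ival_0)
  from eventually_cell_mass_small[OF T this e] show ?thesis
  proof eventually_elim
    case (elim N)
    show ?case
    proof (intro allI impI)
      fix k r s assume k: "k < N" and rs: "grid T N k \<le> r" "r \<le> s" "s \<le> grid T N (Suc k)"
      have "s \<le> T" using rs(3) grid_range[OF T, of N "Suc k"] k by simp
      from slab_fubini_ival(1)[OF absG this, of r]
      have "(LINT p:ival r s \<times> UNIV|lborel. \<bar>G p\<bar>) = (LINT x:ival r s|lborel. \<bar>LINT y|lborel. \<bar>G (x, y)\<bar>\<bar>)"
        by simp
      also have "\<dots> \<le> e" using elim k rs by blast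
      finally show "(LINT p:ival r s \<times> UNIV|lborel. \<bar>G p\<bar>) \<le> e" .
    qed
  qed
qed

text \<open>
  A solvable equation that is invariant under translations. The control \<open>h\<close> moves the forcing term.
\<close>

locale translation_family = solution_class T K W
  for T K :: real and W :: "(real \<times> (real ^ 'n::finite) \<Rightarrow> real) set" +
  fixes L :: "real \<Rightarrow> (real ^ 'n \<Rightarrow> real) \<Rightarrow> (real ^ 'n \<Rightarrow> real)"
    and u0 :: "real ^ 'n \<Rightarrow> real"
    and f :: "real \<times> (real ^ 'n) \<Rightarrow> real"
    and U :: "(real \<Rightarrow> real ^ 'n) \<Rightarrow> (real \<times> (real ^ 'n) \<Rightarrow> real)"
  assumes f: "f \<in> bounded_borel_on (open_slab T)"
    and L_translate: "\<And>t b \<phi>. t \<in> {0<..<T} \<Longrightarrow> \<phi> \<in> test_fun \<Longrightarrow> translate b (L t \<phi>) = L t (translate b \<phi>)"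
    and L_integrable: "\<And>\<zeta>. \<zeta> \<in> test_fun \<Longrightarrow> set_integrable lborel (open_slab T) (\<lambda>(t, x). L t \<zeta> x)"
    and U_solution: "\<And>h. h \<in> bounded_borel_on {0<..<T} \<Longrightarrow> U h \<in> W \<and> weak_solution T L u0 f h (U h)"
    and U_lipschitz: "\<And>h' h'' t x. h' \<in> bounded_borel_on {0<..<T} \<Longrightarrow> h'' \<in> bounded_borel_on {0<..<T} \<Longrightarrow>
        t \<in> {0..T} \<Longrightarrow> \<bar>U h' (t, x) - U h'' (t, x)\<bar> \<le>
          K * (LINT r:{0<..<t}|lebesgue. (SUP y. \<bar>f (r, y + h' r) - f (r, y + h'' r)\<bar>))"
begin

text \<open>
  Controls that agree up to time \<open>t\<close> make the integrand in the Lipschitz bound vanish identically.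
\<close>

lemma U_causal:
  assumes "h' \<in> bounded_borel_on {0<..<T}" "h'' \<in> bounded_borel_on {0<..<T}" "t \<in> {0..T}"
    and eq: "\<And>r. r \<in> {0<..<t} \<Longrightarrow> h' r = h'' r"
  shows "U h' (t, x) = U h'' (t, x)"
proof -
  have "(LINT r:{0<..<t}|lebesgue. (SUP y. \<bar>f (r, y + h' r) - f (r, y + h'' r)\<bar>)) = 
    (LINT r|(lebesgue :: real measure). 0)"
    unfolding set_lebesgue_integral_def
    by (rule Bochner_Integration.integral_cong) (auto simp: indicator_def eq)
  then show ?thesis using U_lipschitz[OF assms(1-3), of x] by simp
qed

lemma U_W: "h \<in> bounded_borel_on {0<..<T} \<Longrightarrow> U h \<in> W"
  using U_solution by blast

lemma U_residual:
  assumes "h \<in> bounded_borel_on {0<..<T}" "\<zeta> \<in> test_fun" "t \<in> {0..T}"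
  shows "residual L (U h) t \<zeta> = source u0 f h t \<zeta>"
  using weak_solution_iff_residual[of "U h" T K L u0 f h,
      OF W_measurable[OF U_W[OF assms(1)]] W_abs_le[OF U_W[OF assms(1)]] L_integrable]
    U_solution[OF assms(1)] assms(2,3) by blast

definition forcing :: "(real \<Rightarrow> real ^ 'n) \<Rightarrow> (real ^ 'n \<Rightarrow> real) \<Rightarrow> real \<times> (real ^ 'n) \<Rightarrow> real" where
  "forcing h \<zeta> = (\<lambda>(s, x). f (s, x + h s) * \<zeta> x)"

lemma forcing_integrable:
  assumes h: "h \<in> bounded_borel_on {0<..<T}" and \<zeta>: "\<zeta> \<in> test_fun"
  shows "set_integrable lborel (open_slab T) (forcing h \<zeta>)"
proof -
  obtain C where C: "\<And>p. p \<in> open_slab T \<Longrightarrow> \<bar>f p\<bar> \<le> C"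
    using bounded_borel_onD(2)[OF f] unfolding bounded_iff by auto
  have "set_integrable lborel (open_slab T) (\<lambda>p. f (fst p, snd p + h (fst p)) * (case p of (s, x) \<Rightarrow> 1 * \<zeta> x))"
  proof (rule set_integrable_bounded_mult)
    have "set_integrable lborel {0<..<T} (\<lambda>s. 1 :: real)"
      unfolding set_integrable_def using T_pos by (simp add: integrable_indicator_iff)
    then show "set_integrable lborel (open_slab T) (\<lambda>(s, x). 1 * \<zeta> x)"
      by (rule slab_product_integrable) (rule test_fun_integrable[OF \<zeta>])
    let ?R = "restrict_space borel (open_slab T :: (real \<times> (real ^ 'n)) set)"
    have fst_snd: "fst \<in> (borel \<Otimes>\<^sub>M borel :: (real \<times> (real ^ 'n)) measure) \<rightarrow>\<^sub>M borel"
      "snd \<in> (borel \<Otimes>\<^sub>M borel :: (real \<times> (real ^ 'n)) measure) \<rightarrow>\<^sub>M borel"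
      by (rule measurable_fst measurable_snd)+
    have "h \<in> borel_measurable (restrict_space borel {0<..<T})" using bounded_borel_onD(1)[OF h] .
    moreover have "fst \<in> ?R \<rightarrow>\<^sub>M restrict_space borel {0<..<T}"
      by (rule measurable_restrict_space2)
         (use measurable_restrict_space1[OF fst_snd(1)[unfolded borel_prod]] in \<open>auto simp: space_restrict_space\<close>)
    ultimately have [measurable]: "(\<lambda>p. h (fst p)) \<in> borel_measurable ?R"
      by (rule measurable_compose[rotated])
    have [measurable]: "fst \<in> borel_measurable ?R" "snd \<in> borel_measurable ?R"
      using fst_snd unfolding borel_prod by (auto intro: measurable_restrict_space1)
    have "(\<lambda>p. (fst p, snd p + h (fst p))) \<in> ?R \<rightarrow>\<^sub>M borel" 
      by measurable
    then have "(\<lambda>p. (fst p, snd p + h (fst p))) \<in> ?R \<rightarrow>\<^sub>M ?R"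
      by (rule measurable_restrict_space2[rotated]) (auto simp: space_restrict_space)
    then show "(\<lambda>p. f (fst p, snd p + h (fst p))) \<in> borel_measurable ?R"
      by (rule measurable_compose[OF _ bounded_borel_onD(1)[OF f]])
    show "\<bar>f (fst p, snd p + h (fst p))\<bar> \<le> C" if "p \<in> open_slab T" for p
      by (rule C) (use that in auto)
  qed simp
  then show ?thesis by (simp add: forcing_def case_prod_beta')
qed

lemma source_eq:
  assumes "h \<in> bounded_borel_on {0<..<T}" "\<zeta> \<in> test_fun" "t \<in> {0..T}"
  shows "source u0 f h t \<zeta> = pairing u0 \<zeta> + (LINT p:ival 0 t \<times> UNIV|lborel. forcing h \<zeta> p)"
  unfolding source_def ival_0[symmetric]
  using slab_fubini_ival(1)[OF forcing_integrable[OF assms(1,2)], of t 0] assms(3)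
  by (simp add: pairing_def translate_def forcing_def)

lemma residual_eq:
  "residual A u t \<zeta> = pairing (\<lambda>x. u (t, x)) \<zeta> - (LINT p:ival 0 t \<times> UNIV|lborel. u p * (case p of (s, x) \<Rightarrow> A s \<zeta> x))"
  by (simp add: residual_def ival_0)

lemma W_mult_integrable:
  assumes u: "u \<in> W" and G: "set_integrable lborel (open_slab T) G"
  shows "set_integrable lborel (open_slab T) (\<lambda>p. u p * G p)"
proof (rule set_integrable_bounded_mult[OF G, where K = K])
  show "u \<in> borel_measurable (restrict_space borel (open_slab T))"
    by (rule measurable_restrict_mono[OF W_measurable[OF u]]) auto
qed (use W_abs_le[OF u] in auto)

text \<open>
  \<open>\<xi> k\<close> is the position of the path during the cell \<open>k\<close>. A jump path solves the unperturbed equation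
  inside every cell. In \<open>branch\<close> the cell index and the time are independent arguments, so that at a
  grid point the value before the jump (index \<open>k\<close>) and after it (index \<open>k + 1\<close>) are both available.
\<close>

definition jump_control where
  "jump_control N h \<xi> = restrict (\<lambda>s. h s - \<xi> (slot T N s) :: real ^ 'n) {0<..<T}"

definition jump_path where
  "jump_path N h \<xi> = restrict (\<lambda>(t, x). U (jump_control N h \<xi>) (t, x + \<xi> (slot T N t))) (slab T)"

definition branch where
  "branch N h \<xi> k t \<zeta> = pairing (\<lambda>x. U (jump_control N h \<xi>) (t, x + \<xi> k)) \<zeta>"

lemma slot_bounded: "0 < N \<Longrightarrow> bounded ((\<lambda>s. \<xi> (slot T N s) :: real ^ 'n) ` D)"
  by (rule bounded_subset[OF finite_imp_bounded[of "\<xi> ` {..<N}"]]) (auto simp: slot_less)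

lemma slot_comp_measurable [measurable]: "(\<lambda>s. \<xi> (slot T N s) :: real ^ 'n) \<in> borel_measurable borel"
  by (rule measurable_compose[OF slot_measurable]) simp

lemma jump_control_bounded_borel:
  assumes "0 < N" "h \<in> bounded_borel_on {0<..<T}"
  shows "jump_control N h \<xi> \<in> bounded_borel_on {0<..<T}"
  unfolding jump_control_def
proof (rule bounded_borel_on_restrict)
  show "(\<lambda>s. h s - \<xi> (slot T N s)) \<in> borel_measurable (restrict_space borel {0<..<T})"
    using bounded_borel_onD(1)[OF assms(2)] measurable_restrict_space1[OF slot_comp_measurable[of \<xi> N]]
    by (rule borel_measurable_diff)
  show "bounded ((\<lambda>s. h s - \<xi> (slot T N s)) ` {0<..<T})"
    by (rule bounded_minus_comp[OF bounded_borel_onD(2)[OF assms(2)] slot_bounded[OF assms(1)]])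
qed

lemma jump_path_W:
  assumes "0 < N" "h \<in> bounded_borel_on {0<..<T}"
  shows "jump_path N h \<xi> \<in> W"
proof -
  have g: "restrict (\<lambda>s. \<xi> (slot T N s)) {0..T} \<in> bounded_borel_on {0..T}"
    by (intro bounded_borel_on_restrict slot_bounded measurable_restrict_space1 slot_comp_measurable assms)
  have "restrict (\<lambda>(t, x). U (jump_control N h \<xi>) (t, x + restrict (\<lambda>s. \<xi> (slot T N s)) {0..T} t)) (slab T) \<in> W"
    using W3[unfolded cond_W3_def] U_W[OF jump_control_bounded_borel[OF assms]] g by blast
  also have "restrict (\<lambda>(t, x). U (jump_control N h \<xi>) (t, x + restrict (\<lambda>s. \<xi> (slot T N s)) {0..T} t)) (slab T)
     = jump_path N h \<xi>"
    by (auto simp: jump_path_def restrict_def fun_eq_iff)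
  finally show ?thesis .
qed

lemma pairing_jump_path:
  assumes "t \<in> {0..T}"
  shows "pairing (\<lambda>x. jump_path N h \<xi> (t, x)) \<zeta> = branch N h \<xi> (slot T N t) t \<zeta>"
  using assms by (simp add: jump_path_def branch_def)

lemma branch_translate:
  assumes "0 < N" "h \<in> bounded_borel_on {0<..<T}" "t \<in> {0..T}" "\<zeta> \<in> test_fun"
  shows "branch N h \<xi> k t \<zeta> = pairing (\<lambda>x. U (jump_control N h \<xi>) (t, x)) (translate (- \<xi> k) \<zeta>)"
  unfolding branch_def
  by (rule pairing_translate[OF borel_on_section[OF W_measurable[OF U_W] assms(3)] assms(4)])
     (rule jump_control_bounded_borel[OF assms(1,2)])

lemma branch_Suc:
  assumes "0 < N" "h \<in> bounded_borel_on {0<..<T}" "t \<in> {0..T}" "\<zeta> \<in> test_fun"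
  shows "branch N h \<xi> (Suc k) t \<zeta> = branch N h \<xi> k t (translate (\<xi> k - \<xi> (Suc k)) \<zeta>)"
  by (simp add: branch_translate[OF assms] branch_translate[OF assms(1-3) test_fun_translate[OF assms(4)]])
     (simp add: translate_def)

text \<open>
  Before the end of cell \<open>k\<close> the control has only used the positions \<open>\<xi> 0, \<dots>, \<xi> k\<close>.
\<close>

lemma branch_causal:
  assumes "0 < N" "h \<in> bounded_borel_on {0<..<T}" "k < N" "t \<in> {0..T}" "t \<le> grid T N (Suc k)"
    and eq: "\<And>i. i \<le> k \<Longrightarrow> \<xi> i = \<xi>' i"
  shows "branch N h \<xi> k t \<zeta> = branch N h \<xi>' k t \<zeta>"
proof -
  have "U (jump_control N h \<xi>) (t, x) = U (jump_control N h \<xi>') (t, x)" for x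
  proof (rule U_causal)
    fix r assume r: "r \<in> {0<..<t}"
    have "slot T N r \<le> k"
    proof (rule ccontr)
      assume "\<not> slot T N r \<le> k"
      then have "grid T N (Suc k) \<le> grid T N (slot T N r)" by (intro grid_mono T_pos) auto
      also have "\<dots> \<le> r" using slot_bounds(1)[OF T_pos assms(1), of r] r assms(4) by auto
      finally show False using r assms(5) by simp
    qed
    then show "jump_control N h \<xi> r = jump_control N h \<xi>' r" by (simp add: jump_control_def eq)
  qed (use assms(4) jump_control_bounded_borel[OF assms(1,2)] in auto)
  then show ?thesis by (simp add: branch_def eq)
qed

text \<open>
  Write the equation of \<open>u[h - \<xi>]\<close> with the test function \<open>\<zeta>(x - \<xi> k)\<close> and substitute \<open>x + \<xi> k\<close> for
  \<open>x\<close>. In cell \<open>k\<close> the shift cancels in the forcing term, and by translation invariance it disappears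
  from \<open>L\<close>.
\<close>

lemma branch_increment:
  assumes N: "0 < N" and h: "h \<in> bounded_borel_on {0<..<T}" and \<zeta>: "\<zeta> \<in> test_fun" and k: "k < N"
    and t: "grid T N k \<le> t" "t \<le> t'" "t' \<le> grid T N (Suc k)"
  shows "branch N h \<xi> k t' \<zeta> - branch N h \<xi> k t \<zeta> = 
    (LINT p:ival t t' \<times> UNIV|lborel. jump_path N h \<xi> p * (case p of (s, x) \<Rightarrow> L s \<zeta> x)) + 
    (LINT p:ival t t' \<times> UNIV|lborel. forcing h \<zeta> p)"
proof -
  define hx where "hx = jump_control N h \<xi>"
  define \<zeta>' where "\<zeta>' = translate (- \<xi> k) \<zeta>"
  have hx: "hx \<in> bounded_borel_on {0<..<T}" unfolding hx_def by (rule jump_control_bounded_borel[OF N h])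
  have \<zeta>': "\<zeta>' \<in> test_fun" unfolding \<zeta>'_def by (rule test_fun_translate[OF \<zeta>])
  have tT: "0 \<le> t" "t' \<le> T"
    using grid_range[OF T_pos N, of k] grid_range[OF T_pos N, of "Suc k"] k t by auto
  have slot: "slot T N s = k" if "s \<in> ival t t'" for s
    by (rule slot_eq[OF T_pos N k]) (use that t in \<open>auto simp: ival_def\<close>)
  let ?L = "\<lambda>\<zeta> p. case p of (s, x) \<Rightarrow> L s \<zeta> x"
  have UL: "set_integrable lborel (open_slab T) (\<lambda>p. U hx p * ?L \<zeta>' p)"
    by (rule W_mult_integrable[OF U_W[OF hx] L_integrable[OF \<zeta>']])
  note F = forcing_integrable[OF hx \<zeta>']
  have eq: "branch N h \<xi> k \<tau> \<zeta> = pairing u0 \<zeta>' + (LINT p:ival 0 \<tau> \<times> UNIV|lborel. forcing hx \<zeta>' p) +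
     (LINT p:ival 0 \<tau> \<times> UNIV|lborel. U hx p * ?L \<zeta>' p)" if "\<tau> \<in> {0..T}" for \<tau>
    using branch_translate[OF N h that \<zeta>, of \<xi> k] U_residual[OF hx \<zeta>' that] source_eq[OF hx \<zeta>' that]
    by (simp add: residual_eq hx_def \<zeta>'_def)
  have "branch N h \<xi> k t' \<zeta> - branch N h \<xi> k t \<zeta> = 
    (LINT p:ival t t' \<times> UNIV|lborel. forcing hx \<zeta>' p) + (LINT p:ival t t' \<times> UNIV|lborel. U hx p * ?L \<zeta>' p)"
    using eq[of t] eq[of t'] tT t(2) slab_integral_add[OF UL tT(1) t(2) tT(2)] slab_integral_add[OF F tT(1) t(2) tT(2)]
    by simp
  also have "(LINT p:ival t t' \<times> UNIV|lborel. forcing hx \<zeta>' p) = (LINT p:ival t t' \<times> UNIV|lborel. forcing h \<zeta> p)"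
  proof -
    have "(LINT p:ival t t' \<times> UNIV|lborel. forcing hx \<zeta>' p) = 
      (LINT (s, x):ival t t' \<times> UNIV|lborel. forcing hx \<zeta>' (s, x + \<xi> k))"
      using borel_measurable_integrable[OF set_integrable_slab[OF F tT(2), of t, unfolded set_integrable_def]]
      by (intro slab_integral_translate) simp
    also have "\<dots> = (LINT p:ival t t' \<times> UNIV|lborel. forcing h \<zeta> p)"
    proof (rule set_lebesgue_integral_cong)
      show "\<forall>p. p \<in> ival t t' \<times> UNIV \<longrightarrow> (case p of (s, x) \<Rightarrow> forcing hx \<zeta>' (s, x + \<xi> k)) = forcing h \<zeta> p"
        using ival_subset[OF tT(2), of t] slot
        by (auto simp: forcing_def hx_def jump_control_def \<zeta>'_def translate_def)
    qed simp
    finally show ?thesis .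
  qed
  also have "(LINT p:ival t t' \<times> UNIV|lborel. U hx p * ?L \<zeta>' p) = 
    (LINT p:ival t t' \<times> UNIV|lborel. jump_path N h \<xi> p * ?L \<zeta> p)"
  proof -
    have "(LINT p:ival t t' \<times> UNIV|lborel. U hx p * ?L \<zeta>' p) = 
      (LINT (s, x):ival t t' \<times> UNIV|lborel. U hx (s, x + \<xi> k) * ?L \<zeta>' (s, x + \<xi> k))"
      using borel_measurable_integrable[OF set_integrable_slab[OF UL tT(2), of t, unfolded set_integrable_def]]
      by (intro slab_integral_translate) simp
    also have "\<dots> = (LINT p:ival t t' \<times> UNIV|lborel. jump_path N h \<xi> p * ?L \<zeta> p)"
    proof (rule set_lebesgue_integral_cong)
      have "L s \<zeta>' (x + \<xi> k) = L s \<zeta> x" if "s \<in> {0<..<T}" for s x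
        using L_translate[OF that \<zeta>, of "- \<xi> k"] by (simp add: \<zeta>'_def translate_def fun_eq_iff)
          (metis add_diff_cancel_right')
      moreover have "s \<in> {0<..<T}" if "s \<in> ival t t'" for s using ival_subset[OF tT(2), of t] that by blast
      ultimately show "\<forall>p. p \<in> ival t t' \<times> UNIV \<longrightarrow> (case p of (s, x) \<Rightarrow> U hx (s, x + \<xi> k) * ?L \<zeta>' (s, x + \<xi> k)) = 
          jump_path N h \<xi> p * ?L \<zeta> p"
        using slot by (force simp: jump_path_def hx_def)
    qed simp
    finally show ?thesis .
  qed
  finally show ?thesis by simp
qed

end

text \<open>
  Jumps \<open>b j\<close> with intensities \<open>a j\<close>, acting on test functions.
\<close>

definition jump_gen :: "'j set \<Rightarrow> ('j \<Rightarrow> real \<Rightarrow> real) \<Rightarrow> ('j \<Rightarrow> real ^ 'n::finite) \<Rightarrow> real \<Rightarrow> (real ^ 'n \<Rightarrow> real) \<Rightarrow> real ^ 'n \<Rightarrow> real" where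
  "jump_gen J a b s \<phi> x = (\<Sum>j\<in>J. a j s * (\<phi> (x + b j) - \<phi> x))"

context translation_family begin

text \<open>
  What is known about the averaged path \<open>V\<close>. The number \<open>M k t \<zeta>\<close> is the average of \<open>branch\<close>: inside
  the cells it is \<open>(V\<^sub>t, \<zeta>)\<close> and moves according to the unperturbed equation; at a grid point the
  integral of the intensities over the preceding cell takes effect at once.
\<close>

definition jump_scheme ::
  "nat \<Rightarrow> 'j set \<Rightarrow> ('j \<Rightarrow> real \<Rightarrow> real) \<Rightarrow> ('j \<Rightarrow> real ^ 'n) \<Rightarrow> (real \<Rightarrow> real ^ 'n) \<Rightarrow> (real \<times> (real ^ 'n) \<Rightarrow> real) \<Rightarrow>
   (nat \<Rightarrow> real \<Rightarrow> (real ^ 'n \<Rightarrow> real) \<Rightarrow> real) \<Rightarrow> bool" where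
  "jump_scheme N J a b h V M \<longleftrightarrow> (\<forall>\<zeta>\<in>test_fun.
     M 0 0 \<zeta> = pairing u0 \<zeta> \<and>
     (\<forall>t\<in>{0..T}. pairing (\<lambda>x. V (t, x)) \<zeta> = M (slot T N t) t \<zeta>) \<and>
     (\<forall>k<N. \<forall>t t'. grid T N k \<le> t \<longrightarrow> t \<le> t' \<longrightarrow> t' \<le> grid T N (Suc k) \<longrightarrow>
        M k t' \<zeta> - M k t \<zeta> =
          (LINT p:ival t t' \<times> UNIV|lborel. V p * (case p of (s, x) \<Rightarrow> L s \<zeta> x)) +
          (LINT p:ival t t' \<times> UNIV|lborel. forcing h \<zeta> p)) \<and>
     (\<forall>k. Suc k < N \<longrightarrow>
        M (Suc k) (grid T N (Suc k)) \<zeta> = M k (grid T N (Suc k)) \<zeta> +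
          (\<Sum>j\<in>J. (LINT s:ival (grid T N k) (grid T N (Suc k))|lborel. a j s) *
             (M k (grid T N (Suc k)) (translate (b j) \<zeta>) - M k (grid T N (Suc k)) \<zeta>))))"

text \<open>
  The jumps at the grid points are independent, and the jump at the end of cell \<open>k\<close> is \<open>- b j\<close> with
  probability equal to the mass of \<open>a j\<close> in that cell. The hypothesis on the masses makes these
  numbers probabilities. The jump relation comes from independence, since by causality the state at
  the end of cell \<open>k\<close> is a function of the earlier jumps.
\<close>

lemma exists_jump_scheme:
  fixes J :: "'j set" and a :: "'j \<Rightarrow> real \<Rightarrow> real" and b :: "'j \<Rightarrow> real ^ 'n"
  assumes N: "0 < N" and J: "finite J"
    and a: "\<And>j. j \<in> J \<Longrightarrow> set_integrable lborel {0<..<T} (a j)"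
    and a0: "\<And>j s. j \<in> J \<Longrightarrow> s \<in> {0<..<T} \<Longrightarrow> 0 \<le> a j s"
    and small: "\<And>k. k < N \<Longrightarrow> (\<Sum>j\<in>J. LINT s:ival (grid T N k) (grid T N (Suc k))|lborel. a j s) \<le> 1"
    and h: "h \<in> bounded_borel_on {0<..<T}"
  obtains V M where "V \<in> W" "jump_scheme N J a b h V M"
proof -
  define c where "c k j = (LINT s:ival (grid T N k) (grid T N (Suc k))|lborel. a j s)" for k j
  have c0: "0 \<le> c k j" if "k < N" "j \<in> J" for k j
    unfolding c_def set_lebesgue_integral_def
  proof (rule Bochner_Integration.integral_nonneg)
    have "grid T N (Suc k) \<le> T" using grid_range[OF T_pos N, of "Suc k"] that by simp
    then show "0 \<le> indicator (ival (grid T N k) (grid T N (Suc k))) s *\<^sub>R a j s" for s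
      using ival_subset[of "grid T N (Suc k)" T "grid T N k"] a0[OF that(2)] by (auto simp: indicator_def)
  qed
  have "\<exists>p :: 'j option pmf. finite (set_pmf p) \<and> (k < N \<longrightarrow> (\<forall>G :: 'j option \<Rightarrow> real. 
      measure_pmf.expectation p G = G None + (\<Sum>j\<in>J. c k j * (G (Some j) - G None))))" for k
  proof (cases "k < N")
    case True
    obtain p :: "'j option pmf" where "finite (set_pmf p)" 
      "\<And>G :: 'j option \<Rightarrow> real. measure_pmf.expectation p G = G None + (\<Sum>j\<in>J. c k j * (G (Some j) - G None))"
      by (rule exists_pmf_option[OF J, of "c k"]) (use c0[OF True] small[OF True] in \<open>auto simp: c_def\<close>)
    then show ?thesis by blast
  next
    case False
    then show ?thesis by (intro exI[of _ "return_pmf None"]) auto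
  qed
  then obtain p :: "nat \<Rightarrow> 'j option pmf" where fin: "\<And>k. finite (set_pmf (p k))" and
    p: "\<And>k (G :: 'j option \<Rightarrow> real). k < N \<Longrightarrow> 
      measure_pmf.expectation (p k) G = G None + (\<Sum>j\<in>J. c k j * (G (Some j) - G None))"
    by metis
  define P where "P = Pi_pmf {..<N} None p"
  have finP: "finite (set_pmf P)" using fin by (auto simp: P_def set_Pi_pmf)
  define \<beta> where "\<beta> z = (case z of None \<Rightarrow> 0 | Some j \<Rightarrow> b j)" for z
  (* The sign turns a jump of the path by -b into the translation \<zeta>(x + b) of the test function.
     The coordinate k of \<omega> is the jump at the end of cell k, so \<xi> k depends on coordinates below k. *)
  define \<xi> where "\<xi> \<omega> k = - (\<Sum>i<k. \<beta> (\<omega> i))" for \<omega> :: "nat \<Rightarrow> 'j option" and k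
  have \<xi>_Suc: "\<xi> \<omega> k - \<xi> \<omega> (Suc k) = \<beta> (\<omega> k)" for \<omega> k by (simp add: \<xi>_def)
  define path where "path \<omega> = jump_path N h (\<xi> \<omega>)" for \<omega>
  have pathW: "path \<omega> \<in> W" for \<omega> unfolding path_def by (rule jump_path_W[OF N h])
  define V where "V = restrict (\<lambda>q. measure_pmf.expectation P (\<lambda>\<omega>. path \<omega> q)) (slab T)"
  define M where "M k t \<zeta> = measure_pmf.expectation P (\<lambda>\<omega>. branch N h (\<xi> \<omega>) k t \<zeta>)" for k t \<zeta>
  have VW: "V \<in> W" unfolding V_def by (rule W_expectation[OF finP pathW])
  note intP = integrable_measure_pmf_finite[OF finP]
  show ?thesis
  proof (rule that[OF VW, of M], unfold jump_scheme_def, intro ballI conjI allI impI)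
    fix \<zeta> :: "real ^ 'n \<Rightarrow> real" and t assume t: "t \<in> {0..T}" and \<zeta>: "\<zeta> \<in> test_fun"
    have "pairing (\<lambda>x. V (t, x)) \<zeta> = (LINT x|lborel. measure_pmf.expectation P (\<lambda>\<omega>. path \<omega> (t, x) * \<zeta> x))"
      unfolding pairing_def V_def using t by simp
    also have "\<dots> = measure_pmf.expectation P (\<lambda>\<omega>. LINT x|lborel. path \<omega> (t, x) * \<zeta> x)"
      by (rule expectation_integral_swap[OF finP pairing_integrable[OF borel_on_section[OF W_measurable[OF pathW] t] W_abs_le[OF pathW] \<zeta>]])
         (use t in auto)
    also have "\<dots> = M (slot T N t) t \<zeta>"
      unfolding M_def path_def using pairing_jump_path[OF t, of N h] by (simp add: pairing_def)
    finally show "pairing (\<lambda>x. V (t, x)) \<zeta> = M (slot T N t) t \<zeta>" .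
  next
    fix \<zeta> :: "real ^ 'n \<Rightarrow> real" assume \<zeta>: "\<zeta> \<in> test_fun"
    have "branch N h (\<xi> \<omega>) 0 0 \<zeta> = pairing u0 \<zeta>" for \<omega>
      using U_residual[OF jump_control_bounded_borel[OF N h, of "\<xi> \<omega>"] \<zeta>, of 0] T_pos
      by (simp add: branch_def \<xi>_def residual_def source_def set_lebesgue_integral_def)
    then show "M 0 0 \<zeta> = pairing u0 \<zeta>" by (simp add: M_def)
  next
    fix \<zeta> :: "real ^ 'n \<Rightarrow> real" and k t t'
    assume \<zeta>: "\<zeta> \<in> test_fun" and k: "k < N" and t: "grid T N k \<le> t" "t \<le> t'" "t' \<le> grid T N (Suc k)"
    have t'T: "t' \<le> T" using grid_range[OF T_pos N, of "Suc k"] k t by simp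
    let ?L = "\<lambda>p. case p of (s, x) \<Rightarrow> L s \<zeta> x" and ?S = "ival t t' \<times> UNIV :: (real \<times> (real ^ 'n)) set"
    have "M k t' \<zeta> - M k t \<zeta> = measure_pmf.expectation P (\<lambda>\<omega>. branch N h (\<xi> \<omega>) k t' \<zeta> - branch N h (\<xi> \<omega>) k t \<zeta>)"
      unfolding M_def by (rule Bochner_Integration.integral_diff[symmetric]) (rule intP)+
    also have "\<dots> = measure_pmf.expectation P (\<lambda>\<omega>. (LINT p:?S|lborel. path \<omega> p * ?L p) + (LINT p:?S|lborel. forcing h \<zeta> p))"
      unfolding branch_increment[OF N h \<zeta> k t] path_def ..
    also have "\<dots> = measure_pmf.expectation P (\<lambda>\<omega>. LINT p:?S|lborel. path \<omega> p * ?L p) + (LINT p:?S|lborel. forcing h \<zeta> p)"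
      by (subst Bochner_Integration.integral_add[OF intP intP]) simp
    also have "measure_pmf.expectation P (\<lambda>\<omega>. LINT p:?S|lborel. path \<omega> p * ?L p) = 
      (LINT p|lborel. measure_pmf.expectation P (\<lambda>\<omega>. indicator ?S p *\<^sub>R (path \<omega> p * ?L p)))"
      unfolding set_lebesgue_integral_def
      by (rule expectation_integral_swap[OF finP, symmetric], fold set_integrable_def)
         (rule set_integrable_slab[OF W_mult_integrable[OF pathW L_integrable[OF \<zeta>]] t'T])
    also have "\<dots> = (LINT p:?S|lborel. measure_pmf.expectation P (\<lambda>\<omega>. path \<omega> p) * ?L p)"
      unfolding set_lebesgue_integral_def by simp
    also have "\<dots> = (LINT p:?S|lborel. V p * ?L p)"
      by (rule set_lebesgue_integral_cong) (use ival_subset[OF t'T, of t] in \<open>auto simp: V_def\<close>)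
    finally show "M k t' \<zeta> - M k t \<zeta> = (LINT p:?S|lborel. V p * ?L p) + (LINT p:?S|lborel. forcing h \<zeta> p)" .
  next
    fix \<zeta> :: "real ^ 'n \<Rightarrow> real" and k
    assume \<zeta>: "\<zeta> \<in> test_fun" and k: "Suc k < N"
    let ?g = "grid T N (Suc k)"
    have g: "?g \<in> {0..T}" using grid_range[OF T_pos N, of "Suc k"] k by simp
    define F where "F \<omega> z = branch N h (\<xi> \<omega>) k ?g (translate (\<beta> z) \<zeta>)" for \<omega> z
    have "M (Suc k) ?g \<zeta> = measure_pmf.expectation P (\<lambda>\<omega>. F \<omega> (\<omega> k))"
      unfolding M_def F_def by (simp add: branch_Suc[OF N h g \<zeta>] \<xi>_Suc)
    also have "\<dots> = measure_pmf.expectation (p k) (\<lambda>z. measure_pmf.expectation P (\<lambda>\<omega>. F \<omega> z))"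
      unfolding P_def
    proof (rule Pi_pmf_expectation_indep)
      fix \<omega> y z
      show "F (fun_upd \<omega> k y) z = F \<omega> z"
        unfolding F_def
        by (rule branch_causal[OF N h _ g]) (use k in \<open>auto simp: \<xi>_def intro!: sum.cong\<close>)
    qed (use k fin in auto)
    also have "\<dots> = M k ?g \<zeta> + (\<Sum>j\<in>J. c k j * (M k ?g (translate (b j) \<zeta>) - M k ?g \<zeta>))"
      using k by (simp add: p F_def M_def \<beta>_def translate_def)
    finally show "M (Suc k) ?g \<zeta> = M k ?g \<zeta> + (\<Sum>j\<in>J. (LINT s:ival (grid T N k) ?g|lborel. a j s) * 
           (M k ?g (translate (b j) \<zeta>) - M k ?g \<zeta>))" by (simp add: c_def)
  qed
qed

lemma jump_gen_integrable:
  assumes J: "finite J" and a: "\<And>j. j \<in> J \<Longrightarrow> set_integrable lborel {0<..<T} (a j)" and \<zeta>: "\<zeta> \<in> test_fun"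
  shows "set_integrable lborel (open_slab T) (\<lambda>(s, x). jump_gen J a b s \<zeta> x)"
proof -
  have "set_integrable lborel (open_slab T) (\<lambda>p. \<Sum>j\<in>J. case p of (s, x) \<Rightarrow> a j s * (translate (b j) \<zeta> x - \<zeta> x))"
    by (rule set_integral_sum_family(1)) 
       (intro slab_product_integrable a Bochner_Integration.integrable_diff test_fun_integrable test_fun_translate \<zeta>)
  then show ?thesis by (simp add: jump_gen_def translate_def case_prod_beta')
qed

lemma jump_gen_pairing:
  assumes J: "finite J" and a: "\<And>j. j \<in> J \<Longrightarrow> set_integrable lborel {0<..<T} (a j)" and \<zeta>: "\<zeta> \<in> test_fun"
    and V: "V \<in> W" and t: "0 \<le> r" "t \<le> T"
  shows "(LINT p:ival r t \<times> UNIV|lborel. V p * (case p of (s, x) \<Rightarrow> jump_gen J a b s \<zeta> x)) = 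
      (\<Sum>j\<in>J. LINT s:ival r t|lborel. a j s * (pairing (\<lambda>x. V (s, x)) (translate (b j) \<zeta>) - pairing (\<lambda>x. V (s, x)) \<zeta>))"
    and "j \<in> J \<Longrightarrow> set_integrable lborel (ival r t) 
      (\<lambda>s. a j s * (pairing (\<lambda>x. V (s, x)) (translate (b j) \<zeta>) - pairing (\<lambda>x. V (s, x)) \<zeta>))"
proof -
  let ?D = "\<lambda>j p. case p of (s, x) \<Rightarrow> a j s * (translate (b j) \<zeta> x - \<zeta> x)"
  let ?P = "\<lambda>j s. a j s * (pairing (\<lambda>x. V (s, x)) (translate (b j) \<zeta>) - pairing (\<lambda>x. V (s, x)) \<zeta>)"
  have D: "set_integrable lborel (open_slab T) (\<lambda>p. V p * ?D j p)" if "j \<in> J" for j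
    by (rule W_mult_integrable[OF V])
       (intro slab_product_integrable a that Bochner_Integration.integrable_diff test_fun_integrable test_fun_translate \<zeta>)
  have P: "(LINT x|lborel. V (s, x) * ?D j (s, x)) = ?P j s" if s: "s \<in> ival r t" for j s
  proof -
    have "s \<in> {0..T}" using s t by (auto simp: ival_def)
    then have I: "integrable lborel (\<lambda>x. V (s, x) * \<psi> x)" if "\<psi> \<in> test_fun" for \<psi>
      by (intro pairing_integrable[OF borel_on_section[OF W_measurable[OF V]] W_abs_le[OF V] that]) auto
    have "(LINT x|lborel. V (s, x) * ?D j (s, x)) = 
      (LINT x|lborel. a j s * (V (s, x) * translate (b j) \<zeta> x - V (s, x) * \<zeta> x))"
      by (intro Bochner_Integration.integral_cong) (auto simp: algebra_simps)
    then show ?thesis unfolding pairing_def using I[OF \<zeta>] I[OF test_fun_translate[OF \<zeta>]] by simp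
  qed
  have F: "(LINT p:ival r t \<times> UNIV|lborel. V p * ?D j p) = (LINT s:ival r t|lborel. ?P j s)" if "j \<in> J" for j
    unfolding slab_fubini_ival(1)[OF D[OF that] t(2), symmetric]
    by (rule set_lebesgue_integral_cong) (use P in auto)
  have "(LINT p:ival r t \<times> UNIV|lborel. V p * (case p of (s, x) \<Rightarrow> jump_gen J a b s \<zeta> x)) = 
    (LINT p:ival r t \<times> UNIV|lborel. \<Sum>j\<in>J. V p * ?D j p)"
    by (rule set_lebesgue_integral_cong) (auto simp: jump_gen_def translate_def sum_distrib_left)
  also have "\<dots> = (\<Sum>j\<in>J. LINT p:ival r t \<times> UNIV|lborel. V p * ?D j p)"
    by (rule set_integral_sum_family(2)) (rule set_integrable_slab[OF D t(2)])
  also have "\<dots> = (\<Sum>j\<in>J. LINT s:ival r t|lborel. ?P j s)" by (intro sum.cong refl F)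
  finally show "(LINT p:ival r t \<times> UNIV|lborel. V p * (case p of (s, x) \<Rightarrow> jump_gen J a b s \<zeta> x)) = 
      (\<Sum>j\<in>J. LINT s:ival r t|lborel. ?P j s)" .
  assume j: "j \<in> J"
  have "set_integrable lborel (ival r t) (\<lambda>s. LINT x|lborel. V (s, x) * ?D j (s, x))"
    by (rule slab_fubini_ival(2)[OF D[OF j] t(2)])
  also have "?this \<longleftrightarrow> set_integrable lborel (ival r t) (?P j)"
    by (rule set_integrable_cong) (use P in auto)
  finally show "set_integrable lborel (ival r t) (?P j)" .
qed

end

section \<open>Finitely many jump sizes\<close>

context translation_family begin

text \<open>
  Let \<open>\<gamma> k t\<close> be the defect of the perturbed equation for \<open>M k t\<close>. Inside a cell it changes by minus
  the integral of the jump term, at the grid point by the lumped jump. Both use the same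
  intensities, but evaluate \<open>M\<close> at different times of one cell, so a cell adds at most \<open>2 e\<close> times its
  mass, where \<open>e\<close> bounds the oscillation of \<open>M\<close> in a cell. The part of the last cell before \<open>t\<close> has no
  jump to balance it and costs another \<open>e\<close>.
\<close>

lemma jump_scheme_residual_error:
  fixes J :: "'j set" and a :: "'j \<Rightarrow> real \<Rightarrow> real" and b :: "'j \<Rightarrow> real ^ 'n" and M :: "nat \<Rightarrow> real \<Rightarrow> (real ^ 'n \<Rightarrow> real) \<Rightarrow> real"
  assumes N: "0 < N" and J: "finite J"
    and a: "\<And>j. j \<in> J \<Longrightarrow> set_integrable lborel {0<..<T} (a j)"
    and a0: "\<And>j s. j \<in> J \<Longrightarrow> s \<in> {0<..<T} \<Longrightarrow> 0 \<le> a j s"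
    and h: "h \<in> bounded_borel_on {0<..<T}"
    and V: "V \<in> W"
    and scheme: "jump_scheme N J a b h V M"
    and \<zeta>: "\<zeta> \<in> test_fun" and t: "t \<in> {0..T}"
    and osc: "\<And>\<psi> k r s. \<psi> \<in> insert \<zeta> ((\<lambda>j. translate (b j) \<zeta>) ` J) \<Longrightarrow> k < N \<Longrightarrow> 
        grid T N k \<le> r \<Longrightarrow> r \<le> s \<Longrightarrow> s \<le> grid T N (Suc k) \<Longrightarrow> 
        (LINT p:ival r s \<times> UNIV|lborel. \<bar>\<bar>K * (case p of (s, x) \<Rightarrow> L s \<psi> x)\<bar> + \<bar>forcing h \<psi> p\<bar>\<bar>) \<le> e"
    and rest: "\<And>k r s. k < N \<Longrightarrow> grid T N k \<le> r \<Longrightarrow> r \<le> s \<Longrightarrow> s \<le> grid T N (Suc k) \<Longrightarrow>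
        (LINT p:ival r s \<times> UNIV|lborel. \<bar>K * (case p of (s, x) \<Rightarrow> jump_gen J a b s \<zeta> x)\<bar>) \<le> e"
  shows "\<bar>residual (\<lambda>s \<phi> x. L s \<phi> x + jump_gen J a b s \<phi> x) V t \<zeta> - source u0 f h t \<zeta>\<bar>
     \<le> e * (1 + 2 * (\<Sum>j\<in>J. LINT s:{0<..<T}|lborel. a j s))"
proof -
  have M0: "M 0 0 \<psi> = pairing u0 \<psi>"
    and V_M: "t \<in> {0..T} \<Longrightarrow> pairing (\<lambda>x. V (t, x)) \<psi> = M (slot T N t) t \<psi>"
    and M_incr: "k < N \<Longrightarrow> grid T N k \<le> t \<Longrightarrow> t \<le> t' \<Longrightarrow> t' \<le> grid T N (Suc k) \<Longrightarrow>
      M k t' \<psi> - M k t \<psi> =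
        (LINT p:ival t t' \<times> UNIV|lborel. V p * (case p of (s, x) \<Rightarrow> L s \<psi> x)) +
        (LINT p:ival t t' \<times> UNIV|lborel. forcing h \<psi> p)"
    and M_jump: "Suc k < N \<Longrightarrow> M (Suc k) (grid T N (Suc k)) \<psi> = M k (grid T N (Suc k)) \<psi> +
        (\<Sum>j\<in>J. (LINT s:ival (grid T N k) (grid T N (Suc k))|lborel. a j s) *
           (M k (grid T N (Suc k)) (translate (b j) \<psi>) - M k (grid T N (Suc k)) \<psi>))"
    if "\<psi> \<in> test_fun" for \<psi> k t t'
    using bspec[OF scheme[unfolded jump_scheme_def] that] by simp_all
  let ?L = "\<lambda>\<psi> p. case p of (s, x) \<Rightarrow> L s \<psi> x" and ?J = "\<lambda>p. case p of (s, x) \<Rightarrow> jump_gen J a b s \<zeta> x"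
  let ?g = "grid T N"
  have T0: "0 \<le> T" using T_pos by simp
  have K_bound: "\<bar>V p * x\<bar> \<le> \<bar>K * x\<bar>" if "p \<in> slab T" for p x
  proof -
    have "\<bar>V p\<bar> \<le> \<bar>K\<bar>" using W_abs_le[OF V that] by simp
    then show ?thesis by (simp add: abs_mult mult_right_mono)
  qed
  have LV: "set_integrable lborel (open_slab T) (\<lambda>p. V p * ?L \<psi> p)" if "\<psi> \<in> test_fun" for \<psi>
    by (rule W_mult_integrable[OF V L_integrable[OF that]])
  have JI: "set_integrable lborel (open_slab T) ?J" by (rule jump_gen_integrable[OF J a \<zeta>])
  have JV: "set_integrable lborel (open_slab T) (\<lambda>p. V p * ?J p)"
    by (rule W_mult_integrable[OF V JI])
  note F = forcing_integrable[OF h]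
  have M_osc: "\<bar>M k s \<psi> - M k r \<psi>\<bar> \<le> e"
    if \<psi>: "\<psi> \<in> insert \<zeta> ((\<lambda>j. translate (b j) \<zeta>) ` J)" and k: "k < N" and rs: "?g k \<le> r" "r \<le> s" "s \<le> ?g (Suc k)" for \<psi> k r s
  proof -
    have test: "\<psi> \<in> test_fun" using \<psi> \<zeta> by (auto intro: test_fun_translate)
    have sT: "s \<le> T" using grid_range[OF T_pos N, of "Suc k"] k rs by simp
    let ?S = "ival r s \<times> UNIV :: (real \<times> (real ^ 'n)) set"
    have i1: "set_integrable lborel ?S (\<lambda>p. V p * ?L \<psi> p)" by (rule set_integrable_slab[OF LV[OF test] sT])
    have i2: "set_integrable lborel ?S (forcing h \<psi>)" by (rule set_integrable_slab[OF F[OF test] sT])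
    have i3: "set_integrable lborel ?S (\<lambda>p. K * ?L \<psi> p)"
      using set_integrable_slab[OF L_integrable[OF test] sT] by (rule set_integrable_mult_right[rotated])  
    have i4: "set_integrable lborel ?S (\<lambda>p. \<bar>\<bar>K * ?L \<psi> p\<bar> + \<bar>forcing h \<psi> p\<bar>\<bar>)"
      by (intro set_integrable_abs set_integral_add i3 i2)
    have "M k s \<psi> - M k r \<psi> = (LINT p:?S|lborel. V p * ?L \<psi> p + forcing h \<psi> p)"
      unfolding M_incr[OF test k rs] by (rule set_integral_add(2)[OF i1 i2, symmetric])
    also have "\<bar>\<dots>\<bar> \<le> (LINT p:?S|lborel. \<bar>\<bar>K * ?L \<psi> p\<bar> + \<bar>forcing h \<psi> p\<bar>\<bar>)"
      proof (rule set_integral_abs_le[OF set_integral_add(1)[OF i1 i2] i4])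
      fix p assume "p \<in> ?S"
      then have "p \<in> slab T" using sT by (auto simp: ival_def)
      from K_bound[OF this, of "?L \<psi> p"]
      show "\<bar>V p * ?L \<psi> p + forcing h \<psi> p\<bar> \<le> \<bar>\<bar>K * ?L \<psi> p\<bar> + \<bar>forcing h \<psi> p\<bar>\<bar>" by linarith
    qed
    also have "\<dots> \<le> e" by (rule osc[OF \<psi> k rs])
    finally show ?thesis .
  qed
  define IL where "IL r s = (LINT p:ival r s \<times> UNIV|lborel. V p * ?L \<zeta> p)" for r s
  define IJ where "IJ r s = (LINT p:ival r s \<times> UNIV|lborel. V p * ?J p)" for r s
  define IF where "IF r s = (LINT p:ival r s \<times> UNIV|lborel. forcing h \<zeta> p)" for r s
  define \<gamma> where "\<gamma> k t = M k t \<zeta> - pairing u0 \<zeta> - IF 0 t - IL 0 t - IJ 0 t" for k t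
  have split: "IL 0 s = IL 0 r + IL r s" "IJ 0 s = IJ 0 r + IJ r s" "IF 0 s = IF 0 r + IF r s"
    if "0 \<le> r" "r \<le> s" "s \<le> T" for r s
    unfolding IL_def IJ_def IF_def 
    using slab_integral_add[OF LV[OF \<zeta>] that] slab_integral_add[OF JV that] slab_integral_add[OF F[OF \<zeta>] that] by auto
  have \<gamma>_incr: "\<gamma> k s - \<gamma> k r = - IJ r s" if k: "k < N" and rs: "?g k \<le> r" "r \<le> s" "s \<le> ?g (Suc k)" for k r s
  proof -
    have "0 \<le> r" "s \<le> T" using grid_range[OF T_pos N, of "Suc k"] grid_range[OF T_pos N, of k] k rs by auto
    from split[OF this(1) rs(2) this(2)] M_incr[OF \<zeta> k rs] show ?thesis
      by (simp add: \<gamma>_def IL_def IF_def)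
  qed
  define A where "A s = (\<Sum>j\<in>J. LINT x:ival 0 s|lborel. a j x)" for s
  have e0: "0 \<le> e" using rest[of 0 0 0] N grid_mono[OF T_pos, of 0 1 N] by (simp add: ival_def set_lebesgue_integral_def)
  have step: "\<bar>\<gamma> k (?g k)\<bar> \<le> e * (2 * A (?g k))" if "k < N" for k
    using that
  proof (induction k)
    case 0
    show ?case using M0[OF \<zeta>] by (simp add: \<gamma>_def IL_def IF_def IJ_def A_def ival_0 set_lebesgue_integral_def)
  next
    case (Suc k)
    let ?r = "?g k" and ?s = "?g (Suc k)"
    have k: "k < N" using Suc by simp
    have rs: "0 \<le> ?r" "?r \<le> ?s" "?s \<le> T"
      using grid_range[OF T_pos N, of "Suc k"] grid_range[OF T_pos N, of k] grid_mono[OF T_pos, of k "Suc k" N] k by auto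
    let ?m = "\<lambda>j. LINT s:ival ?r ?s|lborel. a j s"
    let ?D = "\<lambda>j. M k ?s (translate (b j) \<zeta>) - M k ?s \<zeta>"
    let ?P = "\<lambda>j s. pairing (\<lambda>x. V (s, x)) (translate (b j) \<zeta>) - pairing (\<lambda>x. V (s, x)) \<zeta>"
    have ai: "set_integrable lborel (ival ?r ?s) (a j)" if "j \<in> J" for j
      by (rule set_integrable_subset[OF a[OF that]]) (use ival_subset[OF rs(3)] in auto)
    have cell: "\<bar>?m j * ?D j - (LINT s:ival ?r ?s|lborel. a j s * ?P j s)\<bar> \<le> 2 * e * ?m j" if j: "j \<in> J" for j
    proof -
      have P: "set_integrable lborel (ival ?r ?s) (\<lambda>s. a j s * ?P j s)"
        by (rule jump_gen_pairing(2)[OF J a \<zeta> V rs(1,3) j])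
      have aD: "set_integrable lborel (ival ?r ?s) (\<lambda>s. a j s * ?D j)"
        using ai[OF j] by (rule set_integrable_mult_left[rotated])
      have "?m j * ?D j - (LINT s:ival ?r ?s|lborel. a j s * ?P j s) = 
         (LINT s:ival ?r ?s|lborel. a j s * ?D j - a j s * ?P j s)"
        using set_integral_diff(2)[OF aD P] by simp
      also have "\<bar>\<dots>\<bar> \<le> (LINT s:ival ?r ?s|lborel. 2 * e * a j s)"
      proof (rule set_integral_abs_le[OF set_integral_diff(1)[OF aD P]])
        show "set_integrable lborel (ival ?r ?s) (\<lambda>s. 2 * e * a j s)"
          using ai[OF j] by (rule set_integrable_mult_right[rotated])
        fix s assume s: "s \<in> ival ?r ?s"
        have s': "?r \<le> s" "s < ?s" using s by (auto simp: ival_def)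
        have sT: "s \<in> {0..T}" "s \<in> {0<..<T}" using s rs by (auto simp: ival_def)
        have slot: "slot T N s = k" by (rule slot_eq[OF T_pos N k s'])
        have "\<bar>M k ?s (translate (b j) \<zeta>) - M k s (translate (b j) \<zeta>)\<bar> \<le> e" "\<bar>M k ?s \<zeta> - M k s \<zeta>\<bar> \<le> e"
          using s' j by (auto intro!: M_osc[OF _ k])
        moreover have "?P j s = M k s (translate (b j) \<zeta>) - M k s \<zeta>"
          using V_M[OF \<zeta> sT(1)] V_M[OF test_fun_translate[OF \<zeta>] sT(1), of "b j"] slot by simp
        ultimately have "\<bar>?D j - ?P j s\<bar> \<le> 2 * e" by linarith
        then have "a j s * \<bar>?D j - ?P j s\<bar> \<le> a j s * (2 * e)" using a0[OF j sT(2)] by (rule mult_left_mono)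
        moreover have "\<bar>a j s * ?D j - a j s * ?P j s\<bar> = a j s * \<bar>?D j - ?P j s\<bar>"
          using a0[OF j sT(2)] by (simp add: abs_mult right_diff_distrib[symmetric])
        ultimately show "\<bar>a j s * ?D j - a j s * ?P j s\<bar> \<le> 2 * e * a j s" by (simp add: mult_ac)
      qed
      also have "\<dots> = 2 * e * ?m j" by simp
      finally show ?thesis .
    qed
    have "IJ ?r ?s = (\<Sum>j\<in>J. LINT s:ival ?r ?s|lborel. a j s * ?P j s)"
      unfolding IJ_def by (rule jump_gen_pairing(1)[OF J a \<zeta> V rs(1,3)])
    moreover have "\<gamma> (Suc k) ?s = \<gamma> k ?s + (\<Sum>j\<in>J. ?m j * ?D j)"
      using M_jump[OF \<zeta> Suc.prems] by (simp add: \<gamma>_def)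
    moreover have "\<gamma> k ?s - \<gamma> k ?r = - IJ ?r ?s" by (rule \<gamma>_incr[OF k]) (use rs in auto)
    ultimately have "\<gamma> (Suc k) ?s = \<gamma> k ?r + (\<Sum>j\<in>J. ?m j * ?D j - (LINT s:ival ?r ?s|lborel. a j s * ?P j s))"
      by (simp add: sum_subtractf)
    moreover have "\<bar>\<Sum>j\<in>J. ?m j * ?D j - (LINT s:ival ?r ?s|lborel. a j s * ?P j s)\<bar> \<le> (\<Sum>j\<in>J. 2 * e * ?m j)"
      by (rule order_trans[OF sum_abs], rule sum_mono, rule cell)
    ultimately have "\<bar>\<gamma> (Suc k) ?s\<bar> \<le> \<bar>\<gamma> k ?r\<bar> + (\<Sum>j\<in>J. 2 * e * ?m j)"
      by linarith
    also have "\<dots> \<le> e * (2 * A ?r) + (\<Sum>j\<in>J. 2 * e * ?m j)"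
      by (rule add_right_mono) (rule Suc.IH[OF k])
    also have "\<dots> = e * (2 * A ?s)"
    proof -
      have "A ?s = A ?r + (\<Sum>j\<in>J. ?m j)"
        unfolding A_def sum.distrib[symmetric] by (intro sum.cong refl ival_integral_add[OF a rs])
      then show ?thesis by (simp add: sum_distrib_left[symmetric] distrib_left)
    qed
    finally show ?case .
  qed
  define k where "k = slot T N t"
  have k: "k < N" "?g k \<le> t" "t \<le> ?g (Suc k)"
    unfolding k_def using slot_less[OF N] slot_bounds[OF T_pos N t] by auto
  have "\<bar>IJ (?g k) t\<bar> \<le> (LINT p:ival (?g k) t \<times> UNIV|lborel. \<bar>K * ?J p\<bar>)"
    unfolding IJ_def
  proof (rule set_integral_abs_le)
    have tT: "t \<le> T" using t by simp
    show "set_integrable lborel (ival (?g k) t \<times> UNIV) (\<lambda>p. V p * ?J p)"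
      by (rule set_integrable_slab[OF JV tT])
    show "set_integrable lborel (ival (?g k) t \<times> UNIV) (\<lambda>p. \<bar>K * ?J p\<bar>)"
      using set_integrable_slab[OF JI tT] by (intro set_integrable_abs set_integrable_mult_right)
    show "\<bar>V p * ?J p\<bar> \<le> \<bar>K * ?J p\<bar>" if "p \<in> ival (?g k) t \<times> UNIV" for p
      by (rule K_bound) (use that tT in \<open>auto simp: ival_def\<close>)
  qed
  also have "\<dots> \<le> e" by (rule rest[OF k(1) order_refl k(2,3)])
  finally have "\<bar>\<gamma> k t - \<gamma> k (?g k)\<bar> \<le> e" using \<gamma>_incr[OF k(1) order_refl k(2,3)] by simp
  moreover have "\<bar>\<gamma> k (?g k)\<bar> \<le> e * (2 * A (?g k))" by (rule step[OF k(1)])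
  moreover have "A (?g k) \<le> (\<Sum>j\<in>J. LINT s:{0<..<T}|lborel. a j s)"
    unfolding A_def
  proof (rule sum_mono)
    fix j assume j: "j \<in> J"
    have kT: "0 \<le> ?g k" "?g k \<le> T" using grid_range[OF T_pos N, of k] k by auto
    have "0 \<le> (LINT s:ival (?g k) T|lborel. a j s)"
      unfolding set_lebesgue_integral_def
      by (rule Bochner_Integration.integral_nonneg)
         (use a0[OF j] ival_subset[of T T "?g k"] in \<open>auto simp: indicator_def\<close>)
    then show "(LINT x:ival 0 (?g k)|lborel. a j x) \<le> (LINT s:{0<..<T}|lborel. a j s)"
      using ival_integral_add[OF a[OF j] kT(1) kT(2) order_refl] by (simp add: ival_0)
  qed
  then have "e * (2 * A (?g k)) \<le> e * (2 * (\<Sum>j\<in>J. LINT s:{0<..<T}|lborel. a j s))"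
    using e0 by (intro mult_left_mono) auto
  ultimately have "\<bar>\<gamma> k t\<bar> \<le> e * (1 + 2 * (\<Sum>j\<in>J. LINT s:{0<..<T}|lborel. a j s))"
    unfolding distrib_left by linarith
  moreover have "residual (\<lambda>s \<phi> x. L s \<phi> x + jump_gen J a b s \<phi> x) V t \<zeta> - source u0 f h t \<zeta> = \<gamma> k t"
  proof -
    have tT: "t \<le> T" using t by simp
    have "(LINT p:ival 0 t \<times> UNIV|lborel. V p * (case p of (s, x) \<Rightarrow> L s \<zeta> x + jump_gen J a b s \<zeta> x)) = 
      (LINT p:ival 0 t \<times> UNIV|lborel. V p * ?L \<zeta> p + V p * ?J p)"
      by (rule set_lebesgue_integral_cong) (auto simp: algebra_simps)
    also have "\<dots> = IL 0 t + IJ 0 t"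
      unfolding IL_def IJ_def
      by (rule set_integral_add(2)) (rule set_integrable_slab[OF LV[OF \<zeta>] tT] set_integrable_slab[OF JV tT])+
    finally show ?thesis
      unfolding residual_eq source_eq[OF h \<zeta> t] \<gamma>_def IF_def k_def using V_M[OF \<zeta> t] by simp
  qed
  ultimately show ?thesis by simp
qed

text \<open>
  As the mesh tends to 0, absolute continuity of the integral makes the masses of the cells and the
  oscillation bounds arbitrarily small. The bounds depend on the test function, but the scheme does
  not, so a single sequence serves all test functions.
\<close>

lemma finite_jump_solution:
  fixes J :: "'j set" and a :: "'j \<Rightarrow> real \<Rightarrow> real" and b :: "'j \<Rightarrow> real ^ 'n"
  assumes J: "finite J"
    and a: "\<And>j. j \<in> J \<Longrightarrow> set_integrable lborel {0<..<T} (a j)"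
    and a0: "\<And>j s. j \<in> J \<Longrightarrow> s \<in> {0<..<T} \<Longrightarrow> 0 \<le> a j s"
    and h: "h \<in> bounded_borel_on {0<..<T}"
  obtains u where "u \<in> W" "\<And>\<zeta> t. \<zeta> \<in> test_fun \<Longrightarrow> t \<in> {0..T} \<Longrightarrow> 
    residual (\<lambda>s \<phi> x. L s \<phi> x + jump_gen J a b s \<phi> x) u t \<zeta> = source u0 f h t \<zeta>"
proof -
  let ?A = "\<lambda>s \<phi> x. L s \<phi> x + jump_gen J a b s \<phi> x"
  let ?small = "\<lambda>N. 0 < N \<and> (\<forall>k<N. (\<Sum>j\<in>J. LINT s:ival (grid T N k) (grid T N (Suc k))|lborel. a j s) \<le> 1)"
  have "\<forall>\<^sub>F N in sequentially. \<forall>j\<in>J. \<forall>k<N. \<forall>r s. grid T N k \<le> r \<longrightarrow> r \<le> s \<longrightarrow> s \<le> grid T N (Suc k) \<longrightarrow>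
      (LINT x:ival r s|lborel. \<bar>a j x\<bar>) \<le> 1 / (real (card J) + 1)"
    by (rule eventually_ball_finite[OF J], rule ballI, rule eventually_cell_mass_small[OF T_pos a]) auto
  then have "\<forall>\<^sub>F N in sequentially. ?small N"
    using eventually_gt_at_top[of 0]
  proof eventually_elim
    case (elim N)
    have "(\<Sum>j\<in>J. LINT s:ival (grid T N k) (grid T N (Suc k))|lborel. a j s) \<le> 1" if k: "k < N" for k
    proof -
      let ?I = "ival (grid T N k) (grid T N (Suc k))"
      have I: "?I \<subseteq> {0<..<T}"
        using grid_range[OF T_pos, of N "Suc k"] k by (intro ival_subset) auto
      have "(\<Sum>j\<in>J. LINT s:?I|lborel. a j s) \<le> (\<Sum>j\<in>J. 1 / (real (card J) + 1))"
      proof (rule sum_mono)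
        fix j assume j: "j \<in> J"
        have "(LINT s:?I|lborel. a j s) = (LINT s:?I|lborel. \<bar>a j s\<bar>)"
          by (rule set_lebesgue_integral_cong) (use a0[OF j] I in auto)
        then show "(LINT s:?I|lborel. a j s) \<le> 1 / (real (card J) + 1)"
          using elim(1) j k grid_mono[OF T_pos, of k "Suc k" N] by auto
      qed
      also have "\<dots> \<le> 1" by (simp add: field_simps)
      finally show ?thesis .
    qed
    then show ?case using elim by simp
  qed
  then obtain N0 where N0: "\<And>N. N0 \<le> N \<Longrightarrow> ?small N" by (auto simp: eventually_sequentially)
  define S where "S = (\<Sum>j\<in>J. LINT s:{0<..<T}|lborel. a j s)"
  let ?osc = "\<lambda>N e \<psi>. \<forall>k<N. \<forall>r s. grid T N k \<le> r \<longrightarrow> r \<le> s \<longrightarrow> s \<le> grid T N (Suc k) \<longrightarrow>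
        (LINT p:ival r s \<times> UNIV|lborel. \<bar>\<bar>K * (case p of (s, x) \<Rightarrow> L s \<psi> x)\<bar> + \<bar>forcing h \<psi> p\<bar>\<bar>) \<le> e"
  let ?rest = "\<lambda>N e \<zeta>. \<forall>k<N. \<forall>r s. grid T N k \<le> r \<longrightarrow> r \<le> s \<longrightarrow> s \<le> grid T N (Suc k) \<longrightarrow>
        (LINT p:ival r s \<times> UNIV|lborel. \<bar>K * (case p of (s, x) \<Rightarrow> jump_gen J a b s \<zeta> x)\<bar>) \<le> e"
  (* The error bound of the scheme, quantified over all test functions, so that V can be chosen
     before a test function is fixed. *)
  define accurate where "accurate N V \<longleftrightarrow> (\<forall>\<zeta>\<in>test_fun. \<forall>t\<in>{0..T}. \<forall>e. 
      (\<forall>\<psi>\<in>insert \<zeta> ((\<lambda>j. translate (b j) \<zeta>) ` J). ?osc N e \<psi>) \<longrightarrow>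
      ?rest N e \<zeta> \<longrightarrow> \<bar>residual ?A V t \<zeta> - source u0 f h t \<zeta>\<bar> \<le> e * (1 + 2 * S))" for N V
  have "\<exists>V. V \<in> W \<and> accurate N V" if N: "N0 \<le> N" for N
  proof -
    have N': "0 < N" and small: "\<And>k. k < N \<Longrightarrow> (\<Sum>j\<in>J. LINT s:ival (grid T N k) (grid T N (Suc k))|lborel. a j s) \<le> 1"
      using N0[OF N] by auto
    show ?thesis
    proof (rule exists_jump_scheme[where b = b, OF N' J a a0 small h])
      fix V M
      assume V: "V \<in> W" and scheme: "jump_scheme N J a b h V M"
      show ?thesis
        unfolding accurate_def
        by (intro exI[of _ V] conjI V ballI allI impI, unfold S_def,
            rule jump_scheme_residual_error[OF N' J a a0 h V scheme]) blast+
    qed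
  qed
  then have "\<exists>V. \<forall>N\<in>{N0..}. V N \<in> W \<and> accurate N (V N)"
    by (intro bchoice) auto
  then obtain V where V: "\<And>N. N0 \<le> N \<Longrightarrow> V N \<in> W" and V_acc: "\<And>N. N0 \<le> N \<Longrightarrow> accurate N (V N)"
    by auto
  have err: "\<bar>residual ?A (V N) t \<zeta> - source u0 f h t \<zeta>\<bar> \<le> e * (1 + 2 * S)"
    if "N0 \<le> N" "\<zeta> \<in> test_fun" "t \<in> {0..T}"
      "\<forall>\<psi>\<in>insert \<zeta> ((\<lambda>j. translate (b j) \<zeta>) ` J). ?osc N e \<psi>" "?rest N e \<zeta>" for N \<zeta> t e
    using V_acc[OF that(1), unfolded accurate_def, THEN bspec, OF that(2), THEN bspec, OF that(3),
        THEN spec, of e, THEN mp, OF that(4), THEN mp, OF that(5)] .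
  have S0: "0 \<le> S"
    unfolding S_def set_lebesgue_integral_def
    by (intro sum_nonneg Bochner_Integration.integral_nonneg) (use a0 in \<open>auto simp: indicator_def\<close>)
  have JI: "set_integrable lborel (open_slab T) (\<lambda>(s, x). jump_gen J a b s \<zeta> x)" if "\<zeta> \<in> test_fun" for \<zeta>
    by (rule jump_gen_integrable[OF J a that])
  have A_int: "set_integrable lborel (open_slab T) (\<lambda>(s, x). ?A s \<zeta> x)" if \<zeta>: "\<zeta> \<in> test_fun" for \<zeta>
    using set_integral_add(1)[OF L_integrable[OF \<zeta>] JI[OF \<zeta>]] by (simp add: case_prod_beta')
  define v where "v n = V (N0 + n)" for n
  have vW: "v n \<in> W" for n unfolding v_def by (rule V) simp
  have lim: "(\<lambda>n. residual ?A (v n) t \<zeta>) \<longlonglongrightarrow> source u0 f h t \<zeta>" if \<zeta>: "\<zeta> \<in> test_fun" and t: "t \<in> {0..T}" for \<zeta> t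
  proof (rule tendstoI)
    fix \<epsilon> :: real assume \<epsilon>: "0 < \<epsilon>"
    define e where "e = \<epsilon> / (2 * (1 + 2 * S))"
    have "0 < 1 + 2 * S" using S0 by simp
    moreover have "\<epsilon> / (2 * c) * c < \<epsilon>" "0 < \<epsilon> / (2 * c)" if "0 < c" for c :: real
      using that \<epsilon> by auto
    ultimately have e: "0 < e" "e * (1 + 2 * S) < \<epsilon>" unfolding e_def by blast+
    have "\<forall>\<^sub>F N in sequentially. \<forall>\<psi>\<in>insert \<zeta> ((\<lambda>j. translate (b j) \<zeta>) ` J). ?osc N e \<psi>"
    proof (rule eventually_ball_finite, use J in simp, rule ballI)
      fix \<psi> assume "\<psi> \<in> insert \<zeta> ((\<lambda>j. translate (b j) \<zeta>) ` J)"
      then have \<psi>: "\<psi> \<in> test_fun" using \<zeta> by (auto intro: test_fun_translate)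
      show "\<forall>\<^sub>F N in sequentially. ?osc N e \<psi>"
        by (rule eventually_cell_integral_small[OF T_pos _ e(1)])
           (intro set_integral_add(1) set_integrable_abs set_integrable_mult_right L_integrable forcing_integrable h \<psi>)
    qed
    moreover have "\<forall>\<^sub>F N in sequentially. ?rest N e \<zeta>"
      by (rule eventually_cell_integral_small[OF T_pos _ e(1)]) (intro set_integrable_mult_right JI[OF \<zeta>])
    ultimately have "\<forall>\<^sub>F N in sequentially. N0 \<le> N \<longrightarrow> dist (residual ?A (V N) t \<zeta>) (source u0 f h t \<zeta>) < \<epsilon>"
    proof eventually_elim
      case (elim N)
      then show ?case using err[OF _ \<zeta> t, of N e] e(2) by (auto simp: dist_real_def)
    qed
    then obtain N1 where "\<And>N. N1 \<le> N \<Longrightarrow> N0 \<le> N \<Longrightarrow> dist (residual ?A (V N) t \<zeta>) (source u0 f h t \<zeta>) < \<epsilon>"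
      by (auto simp: eventually_sequentially)
    then show "\<forall>\<^sub>F n in sequentially. dist (residual ?A (v n) t \<zeta>) (source u0 f h t \<zeta>) < \<epsilon>"
      unfolding v_def by (intro eventually_sequentiallyI[of N1]) auto
  qed
  obtain u where "u \<in> W" "\<And>\<zeta> t. \<zeta> \<in> test_fun \<Longrightarrow> t \<in> {0..T} \<Longrightarrow> residual ?A u t \<zeta> = source u0 f h t \<zeta>"
    using exists_residual_limit[where A = ?A and v = v and c = "source u0 f h", OF A_int vW lim] by blast
  then show ?thesis by (rule that)
qed

end

section \<open>Discretised jump kernels\<close>

text \<open>
  Vanishing near 0 matters because a Levy measure may have infinite mass there.
\<close>

lemma simple_approximation_vanishing_near_0:
  obtains q :: "nat \<Rightarrow> 'a::euclidean_space \<Rightarrow> 'a" where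
    "\<And>n. q n \<in> borel_measurable borel" "\<And>n. finite (range (q n))"
    "\<And>n y. norm (q n y) \<le> 2 * norm y" "\<And>y. (\<lambda>n. q n y) \<longlonglongrightarrow> y"
    "\<And>n y. norm y < 1 / Suc n \<Longrightarrow> q n y = 0"
proof -
  have "(\<lambda>y :: 'a. y) \<in> borel_measurable borel" by simp
  from borel_measurable_implies_sequence_metric[OF this, of 0]
  obtain F :: "nat \<Rightarrow> 'a \<Rightarrow> 'a" where F: "\<And>i. simple_function borel (F i)" 
    "\<And>y. (\<lambda>i. F i y) \<longlonglongrightarrow> y" "\<And>i y. norm (F i y) \<le> 2 * norm y"
    by (auto simp: dist_norm)
  define q where "q n y = (if norm y < 1 / Suc n then 0 else F n y)" for n y
  show ?thesis
  proof (rule that)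
    fix n
    have [measurable]: "F n \<in> borel_measurable borel" by (rule borel_measurable_simple_function[OF F(1)])
    show "q n \<in> borel_measurable borel" unfolding q_def by measurable
    have "finite (range (F n))" using simple_functionD(1)[OF F(1)[of n]] by simp
    moreover have "range (q n) \<subseteq> insert 0 (range (F n))" by (auto simp: q_def)
    ultimately show "finite (range (q n))" by (meson finite_insert finite_subset)
    show "norm (q n y) \<le> 2 * norm y" for y using F(3) by (simp add: q_def)
  next
    fix y :: 'a
    show "(\<lambda>n. q n y) \<longlonglongrightarrow> y"
    proof (cases "y = 0")
      case True
      then have "q n y = 0" for n by (simp add: q_def)
      then show ?thesis using True by simp
    next
      case False
      then obtain n0 where n0: "1 / Suc n0 < norm y" using nat_approx_posE[of "norm y"] by auto
      have "\<forall>\<^sub>F n in sequentially. F n y = q n y"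
      proof (rule eventually_sequentiallyI[of n0])
        fix n assume "n0 \<le> n"
        then have "1 / Suc n \<le> 1 / Suc n0" by (simp add: field_simps)
        then show "F n y = q n y" using n0 by (simp add: q_def)
      qed
      then show ?thesis by (rule Lim_transform_eventually[OF F(2)])
    qed
  qed (simp add: q_def)
qed

text \<open>
  The integrand of the jump operator, and its replacement when \<open>y\<close> is moved to \<open>z\<close> and the drift
  \<open>-z \<cdot> \<nabla>\<phi>\<close> is realised by jumps \<open>- z / m\<close> with intensity \<open>m\<close>. The cut-off still depends on the original
  \<open>y\<close>.
\<close>

definition jump_kernel :: "(real ^ 'n::finite \<Rightarrow> real) \<Rightarrow> real ^ 'n \<Rightarrow> real ^ 'n \<Rightarrow> real" where
  "jump_kernel \<phi> x y = \<phi> (x + y) - \<phi> x - (\<Sum>i\<in>UNIV. y $ i * partial i \<phi> x) * indicator {y. norm y \<le> 1} y"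

definition discrete_kernel :: "real \<Rightarrow> real ^ 'n::finite \<Rightarrow> (real ^ 'n \<Rightarrow> real) \<Rightarrow> real ^ 'n \<Rightarrow> real ^ 'n \<Rightarrow> real" where
  "discrete_kernel m z \<phi> x y = \<phi> (x + z) - \<phi> x + indicator {y. norm y \<le> 1} y * (m * (\<phi> (x + (- (1 / m)) *\<^sub>R z) - \<phi> x))"

lemma jump_op_kernel: "jump_op \<nu> \<phi> x = (LINT y|\<nu>. jump_kernel \<phi> x y)"
  by (simp add: jump_op_def jump_kernel_def)

lemma kernel_support:
  assumes \<phi>: "\<phi> \<in> test_fun" and R: "\<And>x. norm x > R \<Longrightarrow> \<phi> x = 0"
    and m: "1 \<le> m" and z: "norm z \<le> 2 * norm y" and x: "norm x > R + 2 * norm y"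
  shows "discrete_kernel m z \<phi> x y = 0" "jump_kernel \<phi> x y = 0"
proof -
  have far: "\<phi> (x + w) = 0" if "norm w \<le> 2 * norm y" for w
    using norm_diff_ineq[of x w] that x by (intro R) linarith
  have x': "norm x > R" using x norm_ge_zero[of y] by linarith
  have "{x. \<phi> x \<noteq> 0} \<subseteq> cball 0 R" using R by (auto simp: not_less[symmetric])
  then have "closure {x. \<phi> x \<noteq> 0} \<subseteq> cball 0 R" by (rule closure_minimal) simp
  then have "x \<notin> closure {x. \<phi> x \<noteq> 0}" using x' by auto
  then have "partial i \<phi> x = 0" for i by (rule partial_outside_support)
  moreover have "norm ((- (1 / m)) *\<^sub>R z) \<le> 2 * norm y"
  proof -
    have "norm ((- (1 / m)) *\<^sub>R z) = norm z / m" using m by simp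
    also have "\<dots> \<le> norm z / 1" using m by (intro divide_left_mono) auto
    finally show ?thesis using z by simp
  qed
  moreover have "norm y \<le> 2 * norm y" by simp
  ultimately show "discrete_kernel m z \<phi> x y = 0" "jump_kernel \<phi> x y = 0"
    using far[OF z] far[of y] far[of "(- (1 / m)) *\<^sub>R z"] far[of 0] unfolding discrete_kernel_def jump_kernel_def by auto
qed

text \<open>
  For small \<open>y\<close> both kernels are combinations of second order Taylor remainders; in the discrete kernel the
  linear parts of its two terms cancel. For large \<open>y\<close> only differences of values of \<open>\<phi>\<close> remain.
\<close>

lemma kernel_bounds:
  fixes \<phi> :: "real ^ 'n::finite \<Rightarrow> real"
  assumes \<phi>: "\<phi> \<in> test_fun"
  obtains C where "0 < C"
    "\<And>m z x y. 1 \<le> m \<Longrightarrow> norm z \<le> 2 * norm y \<Longrightarrow> \<bar>discrete_kernel m z \<phi> x y\<bar> \<le> C * min 1 ((norm y)\<^sup>2)"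
    "\<And>x y. \<bar>jump_kernel \<phi> x y\<bar> \<le> C * min 1 ((norm y)\<^sup>2)"
proof -
  obtain B where B: "0 < B" "\<And>x. \<bar>\<phi> x\<bar> \<le> B" using test_fun_bounded[OF \<phi>] by blast
  obtain D where D: "0 < D" 
    "\<And>x y. \<bar>\<phi> (x + y) - \<phi> x - (\<Sum>i\<in>UNIV. y $ i * partial i \<phi> x)\<bar> \<le> D * (norm y)\<^sup>2"
    using test_fun_taylor[OF \<phi>] by blast
  define C where "C = 2 * B + 8 * D"
  show ?thesis
  proof (rule that)
    show "0 < C" using B D by (simp add: C_def)
    fix x y :: "real ^ 'n"
    show "\<bar>jump_kernel \<phi> x y\<bar> \<le> C * min 1 ((norm y)\<^sup>2)"
    proof (cases "norm y \<le> 1")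
      case True
      then have min: "min 1 ((norm y)\<^sup>2) = (norm y)\<^sup>2" by (simp add: abs_square_le_1 min_absorb2)
      have "\<bar>jump_kernel \<phi> x y\<bar> \<le> D * (norm y)\<^sup>2" using D(2) True by (simp add: jump_kernel_def)
      also have "\<dots> \<le> C * (norm y)\<^sup>2" using B D by (intro mult_right_mono) (auto simp: C_def)
      finally show ?thesis by (simp add: min)
    next
      case False
      then have min: "min 1 ((norm y)\<^sup>2) = 1" by (simp add: min_absorb1)
      have "\<bar>\<phi> (x + y) - \<phi> x\<bar> \<le> 2 * B" using B(2)[of x] B(2)[of "x + y"] by linarith
      then show ?thesis using False D by (simp add: jump_kernel_def C_def min)
    qed
    fix m :: real and z :: "real ^ 'n" assume m: "1 \<le> m" and z: "norm z \<le> 2 * norm y"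
    show "\<bar>discrete_kernel m z \<phi> x y\<bar> \<le> C * min 1 ((norm y)\<^sup>2)"
    proof (cases "norm y \<le> 1")
      case True
      then have min: "min 1 ((norm y)\<^sup>2) = (norm y)\<^sup>2" by (simp add: abs_square_le_1 min_absorb2)
      let ?w = "(- (1 / m)) *\<^sub>R z"
      let ?g = "\<lambda>y. \<Sum>i\<in>UNIV. y $ i * partial i \<phi> x"
      (* The linear part of the fast small jumps cancels that of the jump z. *)
      have g: "m * ?g ?w = - ?g z" using m by (simp add: sum_distrib_left sum_negf[symmetric] mult.assoc)
      have "discrete_kernel m z \<phi> x y = (\<phi> (x + z) - \<phi> x - ?g z) + m * (\<phi> (x + ?w) - \<phi> x - ?g ?w)"
        using True g by (simp add: discrete_kernel_def right_diff_distrib)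
      also have "\<bar>\<dots>\<bar> \<le> \<bar>\<phi> (x + z) - \<phi> x - ?g z\<bar> + m * \<bar>\<phi> (x + ?w) - \<phi> x - ?g ?w\<bar>"
        using m by (intro order_trans[OF abs_triangle_ineq]) (simp add: abs_mult)
      also have "\<dots> \<le> D * (norm z)\<^sup>2 + m * (D * (norm ?w)\<^sup>2)"
        using m by (intro add_mono mult_left_mono D) auto
      also have "m * (D * (norm ?w)\<^sup>2) = D * (norm z)\<^sup>2 / m"
        using m by (simp add: power2_eq_square field_simps)
      also have "D * (norm z)\<^sup>2 + D * (norm z)\<^sup>2 / m \<le> D * (norm z)\<^sup>2 + D * (norm z)\<^sup>2 / 1"
        using m D by (intro add_left_mono divide_left_mono) auto
      also have "\<dots> = 2 * D * (norm z)\<^sup>2" by simp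
      also have "\<dots> \<le> 2 * D * (2 * norm y)\<^sup>2" using z D by (intro mult_left_mono power_mono) auto
      also have "\<dots> = 8 * D * (norm y)\<^sup>2" by (simp add: power_mult_distrib)
      also have "\<dots> \<le> C * (norm y)\<^sup>2" using B by (intro mult_right_mono) (auto simp: C_def)
      finally show ?thesis by (simp add: min)
    next
      case False
      then have min: "min 1 ((norm y)\<^sup>2) = 1" by (simp add: min_absorb1)
      have "\<bar>\<phi> (x + z) - \<phi> x\<bar> \<le> 2 * B" using B(2)[of x] B(2)[of "x + z"] by linarith
      then show ?thesis using False D by (simp add: discrete_kernel_def C_def min)
    qed
  qed
qed

lemma kernel_tendsto:
  fixes \<phi> :: "real ^ 'n::finite \<Rightarrow> real"
  assumes \<phi>: "\<phi> \<in> test_fun" and z: "z \<longlonglongrightarrow> y"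
  shows "(\<lambda>n. discrete_kernel (real (Suc n)) (z n) \<phi> x y) \<longlonglongrightarrow> jump_kernel \<phi> x y"
proof -
  let ?g = "\<lambda>y. \<Sum>i\<in>UNIV. y $ i * partial i \<phi> x"
  let ?m = "\<lambda>n. real (Suc n)" and ?w = "\<lambda>n. (- (1 / real (Suc n))) *\<^sub>R z n"
  obtain D where D: "0 < D" "\<And>x y. \<bar>\<phi> (x + y) - \<phi> x - (\<Sum>i\<in>UNIV. y $ i * partial i \<phi> x)\<bar> \<le> D * (norm y)\<^sup>2"
    using test_fun_taylor[OF \<phi>] by blast
  have "isCont \<phi> (x + y)"
    using test_fun_continuous[OF \<phi>] by (simp add: continuous_on_eq_continuous_at)
  then have c1: "(\<lambda>n. \<phi> (x + z n)) \<longlonglongrightarrow> \<phi> (x + y)"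
    by (rule isCont_tendsto_compose) (intro tendsto_intros z)
  have g: "(\<lambda>n. ?g (z n)) \<longlonglongrightarrow> ?g y" by (intro tendsto_intros z)
  have "(\<lambda>n. ?m n * (\<phi> (x + ?w n) - \<phi> x - ?g (?w n))) \<longlonglongrightarrow> 0"
  proof (rule tendsto_rabs_zero_cancel, rule tendsto_sandwich[OF _ _ tendsto_const])
    have "(\<lambda>n. D * (norm (z n))\<^sup>2 * (1 / real (Suc n))) \<longlonglongrightarrow> D * (norm y)\<^sup>2 * 0"
      by (intro tendsto_intros z LIMSEQ_Suc lim_1_over_n)
    then show "(\<lambda>n. D * (norm (z n))\<^sup>2 * (1 / real (Suc n))) \<longlonglongrightarrow> 0" by simp
    show "\<forall>\<^sub>F n in sequentially. \<bar>?m n * (\<phi> (x + ?w n) - \<phi> x - ?g (?w n))\<bar> \<le> D * (norm (z n))\<^sup>2 * (1 / real (Suc n))"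
    proof (rule always_eventually, rule allI)
      fix n
      have "\<bar>?m n * (\<phi> (x + ?w n) - \<phi> x - ?g (?w n))\<bar> = ?m n * \<bar>\<phi> (x + ?w n) - \<phi> x - ?g (?w n)\<bar>"
        by (simp add: abs_mult)
      also have "\<dots> \<le> ?m n * (D * (norm (?w n))\<^sup>2)" by (intro mult_left_mono D) auto
      also have "\<dots> = D * (norm (z n))\<^sup>2 * (1 / real (Suc n))"
        by (simp add: power2_eq_square divide_simps del: of_nat_Suc)
      finally show "\<bar>?m n * (\<phi> (x + ?w n) - \<phi> x - ?g (?w n))\<bar> \<le> D * (norm (z n))\<^sup>2 * (1 / real (Suc n))" .
    qed
  qed auto
  moreover have "?m n * ?g (?w n) = - ?g (z n)" for n
    by (simp add: sum_distrib_left sum_negf[symmetric] mult.assoc del: of_nat_Suc)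
  ultimately have c2: "(\<lambda>n. ?m n * (\<phi> (x + ?w n) - \<phi> x) + ?g (z n)) \<longlonglongrightarrow> 0"
    by (simp add: right_diff_distrib del: of_nat_Suc)
  have c3: "(\<lambda>n. ?m n * (\<phi> (x + ?w n) - \<phi> x)) \<longlonglongrightarrow> - ?g y"
    using tendsto_diff[OF c2 g] by simp
  have "(\<lambda>n. \<phi> (x + z n) - \<phi> x + indicator {y. norm y \<le> 1} y * (?m n * (\<phi> (x + ?w n) - \<phi> x))) \<longlonglongrightarrow>
     \<phi> (x + y) - \<phi> x + indicator {y. norm y \<le> 1} y * (- ?g y)"
    by (intro tendsto_intros c1 c3)
  then show ?thesis by (simp add: discrete_kernel_def jump_kernel_def mult.commute)
qed

lemma kernel_measurable:
  fixes \<phi> :: "real ^ 'n::finite \<Rightarrow> real"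
  assumes \<phi>: "\<phi> \<in> test_fun" and [measurable]: "q \<in> borel_measurable borel"
  shows "(\<lambda>(x, y). discrete_kernel m (q y) \<phi> x y) \<in> borel_measurable (borel \<Otimes>\<^sub>M borel)"
    and "(\<lambda>(x, y). jump_kernel \<phi> x y) \<in> borel_measurable (borel \<Otimes>\<^sub>M borel)"
proof -
  note [measurable] = test_fun_measurable[OF \<phi>] test_fun_measurable[OF test_fun_partial[OF \<phi>]]
  have [measurable]: "(\<lambda>y :: real ^ 'n. y $ i) \<in> borel_measurable borel" for i
    by (intro borel_measurable_continuous_onI continuous_intros)
  show "(\<lambda>(x, y). discrete_kernel m (q y) \<phi> x y) \<in> borel_measurable (borel \<Otimes>\<^sub>M borel)"
    unfolding discrete_kernel_def by measurable
  show "(\<lambda>(x, y). jump_kernel \<phi> x y) \<in> borel_measurable (borel \<Otimes>\<^sub>M borel)"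
    unfolding jump_kernel_def by measurable
qed

text \<open>
  Integrability against a Levy measure requires the bound \<open>C min 1 \<bar>y\<bar>\<^sup>2\<close> for the integral over all \<open>x\<close>.
  For \<open>\<bar>y\<bar> \<le> 1\<close> the kernels live on a fixed ball and the pointwise bounds suffice. For large \<open>y\<close> the
  supports wander off, but then the difference of the kernels is \<open>\<phi>(x + z) - \<phi>(x + y)\<close>, whose \<open>L\<^sub>1\<close>
  norm in \<open>x\<close> is at most twice that of \<open>\<phi>\<close>.
\<close>

lemma kernel_difference_L1:
  fixes \<phi> :: "real ^ 'n::finite \<Rightarrow> real"
  assumes \<phi>: "\<phi> \<in> test_fun"
  obtains C where "0 < C"
    "\<And>m z y. 1 \<le> m \<Longrightarrow> norm z \<le> 2 * norm y \<Longrightarrow> 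
      (\<integral>\<^sup>+x. ennreal \<bar>discrete_kernel m z \<phi> x y - jump_kernel \<phi> x y\<bar> \<partial>lborel) \<le> ennreal (C * min 1 ((norm y)\<^sup>2))"
    "\<And>z y. (\<And>n. norm (z n) \<le> 2 * norm y) \<Longrightarrow> z \<longlonglongrightarrow> y \<Longrightarrow>
      (\<lambda>n. \<integral>\<^sup>+x. ennreal \<bar>discrete_kernel (real (Suc n)) (z n) \<phi> x y - jump_kernel \<phi> x y\<bar> \<partial>lborel) \<longlonglongrightarrow> 0"
proof -
  obtain R where R: "0 < R" "\<And>x. norm x > R \<Longrightarrow> \<phi> x = 0" using test_fun_support[OF \<phi>] by blast
  obtain C0 where C0: "0 < C0"
    "\<And>m z x y. 1 \<le> m \<Longrightarrow> norm z \<le> 2 * norm y \<Longrightarrow> \<bar>discrete_kernel m z \<phi> x y\<bar> \<le> C0 * min 1 ((norm y)\<^sup>2)"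
    "\<And>x y. \<bar>jump_kernel \<phi> x y\<bar> \<le> C0 * min 1 ((norm y)\<^sup>2)"
    using kernel_bounds[OF \<phi>] by blast
  have bound: "\<bar>discrete_kernel m z \<phi> x y - jump_kernel \<phi> x y\<bar> \<le> 
      2 * C0 * min 1 ((norm y)\<^sup>2) * indicator (cball 0 (R + 2 * norm y)) x"
    if "1 \<le> m" "norm z \<le> 2 * norm y" for m z x y
  proof (cases "norm x > R + 2 * norm y")
    case True
    then show ?thesis using kernel_support[OF \<phi> R(2) that True] C0(1) by simp
  next
    case False
    have "\<bar>discrete_kernel m z \<phi> x y - jump_kernel \<phi> x y\<bar> \<le> 2 * C0 * min 1 ((norm y)\<^sup>2)"
      using C0(2)[OF that, of x] C0(3)[of x y] by linarith
    then show ?thesis using False by simp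
  qed
  have vol: "emeasure lborel (cball (0 :: real ^ 'n) r) < \<infinity>" for r
    using emeasure_bounded_finite[OF bounded_cball] .
  define v where "v = measure lborel (cball (0 :: real ^ 'n) (R + 2))"
  define I where "I = (LINT x|lborel. \<bar>\<phi> x\<bar>)"
  have I0: "0 \<le> I" by (simp add: I_def)
  define C where "C = 2 * C0 * v + 2 * I + 1"
  have v0: "0 \<le> v" by (simp add: v_def)
  have cball_borel[measurable]: "cball (0 :: real ^ 'n) r \<in> sets borel" for r
    by simp
  have meas[measurable]: "(\<lambda>x. discrete_kernel m z \<phi> x y) \<in> borel_measurable borel"
      "(\<lambda>x. jump_kernel \<phi> x y) \<in> borel_measurable borel" for m z y
    using measurable_compose[OF measurable_Pair2'[of y borel borel] kernel_measurable(1)[OF \<phi>, of "\<lambda>_. z" m]]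
      measurable_compose[OF measurable_Pair2'[of y borel borel] kernel_measurable(2)[OF \<phi>]] by simp_all
  show ?thesis
  proof (rule that)
    show "0 < C" using C0 v0 I0 by (simp add: C_def add_nonneg_pos)
    fix m :: real and z y :: "real ^ 'n" assume m: "1 \<le> m" and z: "norm z \<le> 2 * norm y"
    show "(\<integral>\<^sup>+x. ennreal \<bar>discrete_kernel m z \<phi> x y - jump_kernel \<phi> x y\<bar> \<partial>lborel) \<le> ennreal (C * min 1 ((norm y)\<^sup>2))"
    proof (cases "norm y \<le> 1")
      case True
      let ?c = "2 * C0 * min 1 ((norm y)\<^sup>2)"
      have c: "0 \<le> ?c" using C0 by simp
      have "(\<integral>\<^sup>+x. ennreal \<bar>discrete_kernel m z \<phi> x y - jump_kernel \<phi> x y\<bar> \<partial>lborel) \<le>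
        (\<integral>\<^sup>+x. ennreal ?c * indicator (cball 0 (R + 2)) x \<partial>(lborel :: (real ^ 'n) measure))"
      proof (rule nn_integral_mono)
        fix x :: "real ^ 'n"
        have "indicator (cball 0 (R + 2 * norm y)) x \<le> (indicator (cball 0 (R + 2)) x :: real)"
          using True by (auto simp: indicator_def)
        then have "\<bar>discrete_kernel m z \<phi> x y - jump_kernel \<phi> x y\<bar> \<le> ?c * indicator (cball 0 (R + 2)) x"
          using order_trans[OF bound[OF m z, of x] mult_left_mono[OF _ c]] by blast
        then have "ennreal \<bar>discrete_kernel m z \<phi> x y - jump_kernel \<phi> x y\<bar> \<le> ennreal (?c * indicator (cball 0 (R + 2)) x)"
          by (rule ennreal_leI)
        then show "ennreal \<bar>discrete_kernel m z \<phi> x y - jump_kernel \<phi> x y\<bar> \<le> ennreal ?c * indicator (cball 0 (R + 2)) x"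
          using c by (simp add: ennreal_mult ennreal_indicator)
      qed
      also have "\<dots> = ennreal ?c * emeasure lborel (cball (0 :: real ^ 'n) (R + 2))"
        by (rule nn_integral_cmult_indicator) simp
      also have "\<dots> = ennreal (?c * v)"
        unfolding v_def using c vol[of "R + 2"] by (subst emeasure_eq_ennreal_measure) (auto simp: ennreal_mult)
      also have "\<dots> \<le> ennreal (C * min 1 ((norm y)\<^sup>2))"
      proof (rule ennreal_leI)
        have "?c * v = (2 * C0 * v) * min 1 ((norm y)\<^sup>2)" by simp
        also have "\<dots> \<le> C * min 1 ((norm y)\<^sup>2)" using I0 by (intro mult_right_mono) (auto simp: C_def)
        finally show "?c * v \<le> C * min 1 ((norm y)\<^sup>2)" .
      qed
      finally show ?thesis .
    next
      case False
      then have min: "min 1 ((norm y)\<^sup>2) = 1" by (simp add: min_absorb1)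
      note [measurable] = test_fun_measurable[OF \<phi>]
      have nn: "(\<integral>\<^sup>+x. ennreal \<bar>\<phi> (x + w)\<bar> \<partial>lborel) = ennreal I" for w
      proof -
        have "integrable lborel (\<lambda>x. \<phi> (x + w))"
          using test_fun_integrable[OF test_fun_translate[OF \<phi>, of w]] by (simp add: translate_def)
        then have "(\<integral>\<^sup>+x. ennreal \<bar>\<phi> (x + w)\<bar> \<partial>lborel) = ennreal (LINT x|lborel. \<bar>\<phi> (x + w)\<bar>)"
          by (intro nn_integral_eq_integral) auto
        also have "(LINT x|lborel. \<bar>\<phi> (x + w)\<bar>) = I"
          unfolding I_def by (rule lborel_integral_translate) simp
        finally show ?thesis .
      qed
      have "(\<integral>\<^sup>+x. ennreal \<bar>discrete_kernel m z \<phi> x y - jump_kernel \<phi> x y\<bar> \<partial>lborel) \<le>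
        (\<integral>\<^sup>+x. ennreal \<bar>\<phi> (x + z)\<bar> + ennreal \<bar>\<phi> (x + y)\<bar> \<partial>lborel)"
      proof (rule nn_integral_mono)
        fix x :: "real ^ 'n"
        have "\<bar>discrete_kernel m z \<phi> x y - jump_kernel \<phi> x y\<bar> \<le> \<bar>\<phi> (x + z)\<bar> + \<bar>\<phi> (x + y)\<bar>"
          using False by (simp add: discrete_kernel_def jump_kernel_def)
        then show "ennreal \<bar>discrete_kernel m z \<phi> x y - jump_kernel \<phi> x y\<bar> \<le> ennreal \<bar>\<phi> (x + z)\<bar> + ennreal \<bar>\<phi> (x + y)\<bar>"
          by (simp add: ennreal_plus[symmetric] ennreal_leI del: ennreal_plus)
      qed
      also have "\<dots> = ennreal I + ennreal I" by (subst nn_integral_add) (auto simp: nn)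
      also have "\<dots> = ennreal (2 * I)" using I0 by (simp add: ennreal_plus[symmetric] del: ennreal_plus)
      also have "\<dots> \<le> ennreal (C * min 1 ((norm y)\<^sup>2))"
        unfolding min using C0 v0 by (intro ennreal_leI) (auto simp: C_def)
      finally show ?thesis .
    qed
  next
    fix z :: "nat \<Rightarrow> real ^ 'n" and y assume z: "\<And>n. norm (z n) \<le> 2 * norm y" "z \<longlonglongrightarrow> y"
    let ?\<Delta> = "\<lambda>n x. discrete_kernel (real (Suc n)) (z n) \<phi> x y - jump_kernel \<phi> x y"
    have "(\<lambda>n. \<integral>\<^sup>+x. ennreal \<bar>?\<Delta> n x\<bar> \<partial>lborel) \<longlonglongrightarrow> (\<integral>\<^sup>+x. 0 \<partial>(lborel :: (real ^ 'n) measure))"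
    proof (rule nn_integral_dominated_convergence[where w = "\<lambda>x. ennreal (2 * C0) * indicator (cball 0 (R + 2 * norm y)) x"])
      show "AE x in lborel. ennreal \<bar>?\<Delta> n x\<bar> \<le> ennreal (2 * C0) * indicator (cball 0 (R + 2 * norm y)) x" for n
      proof (rule AE_I2)
        fix x :: "real ^ 'n"
        have "\<bar>?\<Delta> n x\<bar> \<le> 2 * C0 * min 1 ((norm y)\<^sup>2) * indicator (cball 0 (R + 2 * norm y)) x"
          by (rule bound) (use z(1) in auto)
        also have "\<dots> \<le> 2 * C0 * 1 * indicator (cball 0 (R + 2 * norm y)) x"
          using C0(1) by (intro mult_right_mono mult_left_mono) auto
        finally have "ennreal \<bar>?\<Delta> n x\<bar> \<le> ennreal (2 * C0 * indicator (cball 0 (R + 2 * norm y)) x)"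
          by (intro ennreal_leI) simp
        then show "ennreal \<bar>?\<Delta> n x\<bar> \<le> ennreal (2 * C0) * indicator (cball 0 (R + 2 * norm y)) x"
          using C0(1) by (simp add: ennreal_mult ennreal_indicator)
      qed
      show "(\<integral>\<^sup>+x. ennreal (2 * C0) * indicator (cball 0 (R + 2 * norm y)) x \<partial>(lborel :: (real ^ 'n) measure)) < \<infinity>"
        using vol[of "R + 2 * norm y"] by (subst nn_integral_cmult_indicator) (auto simp: ennreal_mult_less_top)
      show "AE x in lborel. (\<lambda>n. ennreal \<bar>?\<Delta> n x\<bar>) \<longlonglongrightarrow> 0"
      proof (rule AE_I2)
        fix x :: "real ^ 'n"
        have "(\<lambda>n. \<bar>?\<Delta> n x\<bar>) \<longlonglongrightarrow> \<bar>jump_kernel \<phi> x y - jump_kernel \<phi> x y\<bar>"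
          by (intro tendsto_intros kernel_tendsto \<phi> z)
        then show "(\<lambda>n. ennreal \<bar>?\<Delta> n x\<bar>) \<longlonglongrightarrow> 0" 
          using tendsto_ennrealI[of "\<lambda>n. \<bar>?\<Delta> n x\<bar>" 0 sequentially] by simp
      qed
    qed measurable
    then show "(\<lambda>n. \<integral>\<^sup>+x. ennreal \<bar>?\<Delta> n x\<bar> \<partial>lborel) \<longlonglongrightarrow> 0" by simp
  qed
qed

section \<open>Levy families\<close>

locale levy_measures =
  fixes T :: real and \<nu> :: "real \<Rightarrow> (real ^ 'n::finite) measure"
  assumes levy: "levy_family T \<nu>"
begin

lemma sets_nu: "t \<in> {0<..<T} \<Longrightarrow> sets (\<nu> t) = sets borel"
  using levy by (auto simp: levy_family_def)

lemma measurable_nu: "t \<in> {0<..<T} \<Longrightarrow> g \<in> borel_measurable (\<nu> t) \<longleftrightarrow> g \<in> borel_measurable borel"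
  by (rule arg_cong2[where f = "(\<in>)"]) (auto intro!: measurable_cong_sets sets_nu)

definition mass :: "real \<Rightarrow> ennreal" where
  "mass t = (\<integral>\<^sup>+y. ennreal (min 1 ((norm y)\<^sup>2)) \<partial>\<nu> t)"

lemma mass_finite: "t \<in> {0<..<T} \<Longrightarrow> mass t < \<infinity>"
  using levy by (auto simp: levy_family_def mass_def)

lemma mass_integral_finite: "(\<integral>\<^sup>+t\<in>{0<..<T}. mass t \<partial>lborel) < \<infinity>"
  using levy by (auto simp: levy_family_def mass_def)

text \<open>
  The kernel \<open>\<nu>\<close> need not consist of finite measures, so this is proved directly by induction on \<open>g\<close>.
\<close>

lemma nn_integral_nu_measurable:
  assumes "g \<in> borel_measurable borel"
  shows "(\<lambda>t. \<integral>\<^sup>+y. g y \<partial>\<nu> t) \<in> borel_measurable (restrict_space borel {0<..<T})"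
  using assms
proof (induction g rule: borel_measurable_induct)
  case (cong g g')
  then show ?case by (auto simp: fun_eq_iff intro: measurable_cong[THEN iffD1, rotated])
next
  case (set A)
  have "(\<lambda>t. \<integral>\<^sup>+y. indicator A y \<partial>\<nu> t) \<in> borel_measurable (restrict_space borel {0<..<T}) \<longleftrightarrow>
    (\<lambda>t. emeasure (\<nu> t) A) \<in> borel_measurable (restrict_space borel {0<..<T})"
    by (rule measurable_cong) (use set sets_nu in \<open>auto simp: space_restrict_space\<close>)
  then show ?case using levy set by (auto simp: levy_family_def)
next
  case (mult g c)
  have "(\<lambda>t. \<integral>\<^sup>+y. c * g y \<partial>\<nu> t) \<in> borel_measurable (restrict_space borel {0<..<T}) \<longleftrightarrow>
    (\<lambda>t. c * (\<integral>\<^sup>+y. g y \<partial>\<nu> t)) \<in> borel_measurable (restrict_space borel {0<..<T})"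
    by (rule measurable_cong) (use mult in \<open>auto simp: space_restrict_space measurable_nu intro!: nn_integral_cmult\<close>)
  then show ?case using mult by simp
next
  case (add g g')
  have "(\<lambda>t. \<integral>\<^sup>+y. g' y + g y \<partial>\<nu> t) \<in> borel_measurable (restrict_space borel {0<..<T}) \<longleftrightarrow>
    (\<lambda>t. (\<integral>\<^sup>+y. g' y \<partial>\<nu> t) + (\<integral>\<^sup>+y. g y \<partial>\<nu> t)) \<in> borel_measurable (restrict_space borel {0<..<T})"
    by (rule measurable_cong) (use add in \<open>auto simp: space_restrict_space measurable_nu intro!: nn_integral_add\<close>)
  then show ?case using add by simp
next
  case (seq U)
  have "(\<lambda>t. \<integral>\<^sup>+y. (SUP i. U i) y \<partial>\<nu> t) \<in> borel_measurable (restrict_space borel {0<..<T}) \<longleftrightarrow>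
    (\<lambda>t. SUP i. \<integral>\<^sup>+y. U i y \<partial>\<nu> t) \<in> borel_measurable (restrict_space borel {0<..<T})"
  proof (rule measurable_cong)
    fix t assume "t \<in> space (restrict_space borel {0<..<T})"
    then have t: "t \<in> {0<..<T}" by (simp add: space_restrict_space)
    show "(\<integral>\<^sup>+y. (SUP i. U i) y \<partial>\<nu> t) = (SUP i. \<integral>\<^sup>+y. U i y \<partial>\<nu> t)"
      unfolding SUP_apply by (rule nn_integral_monotone_convergence_SUP) (use seq in \<open>auto simp: measurable_nu[OF t]\<close>)
  qed
  then show ?case using seq by (simp add: borel_measurable_SUP)
qed

lemma mass_measurable: "mass \<in> borel_measurable (restrict_space borel {0<..<T})"
  unfolding mass_def by (rule nn_integral_nu_measurable) measurable

lemma nu_integrable: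
  assumes t: "t \<in> {0<..<T}" and g: "g \<in> borel_measurable borel" and le: "\<And>y. \<bar>g y\<bar> \<le> C * min 1 ((norm y)\<^sup>2)"
  shows "integrable (\<nu> t) (g :: real ^ 'n \<Rightarrow> real)"
proof (rule Bochner_Integration.integrable_bound)
  have "integrable (\<nu> t) (\<lambda>y. min 1 ((norm y)\<^sup>2))"
    using mass_finite[OF t] by (intro integrableI_nonneg) (auto simp: measurable_nu[OF t] mass_def)
  then show "integrable (\<nu> t) (\<lambda>y. C * min 1 ((norm y)\<^sup>2))" by simp
  show "AE y in \<nu> t. norm (g y) \<le> norm (C * min 1 ((norm y)\<^sup>2))"
    using order_trans[OF le abs_ge_self] by (intro AE_I2) simp
qed (use g in \<open>simp add: measurable_nu[OF t]\<close>)

lemma nu_far: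
  assumes t: "t \<in> {0<..<T}" and A: "A \<in> sets borel" and far: "\<And>y. y \<in> A \<Longrightarrow> \<delta> \<le> norm y" and \<delta>: "0 < \<delta>"
  shows "emeasure (\<nu> t) A \<le> ennreal (1 / min 1 (\<delta>\<^sup>2)) * mass t" "emeasure (\<nu> t) A < \<infinity>"
proof -
  let ?k = "min 1 (\<delta>\<^sup>2)"
  have k: "0 < ?k" using \<delta> by simp
  have "emeasure (\<nu> t) A = (\<integral>\<^sup>+y. indicator A y \<partial>\<nu> t)"
    using A sets_nu[OF t] by simp
  also have "\<dots> \<le> (\<integral>\<^sup>+y. ennreal (1 / ?k) * ennreal (min 1 ((norm y)\<^sup>2)) \<partial>\<nu> t)"
  proof (rule nn_integral_mono)
    fix y
    show "indicator A y \<le> ennreal (1 / ?k) * ennreal (min 1 ((norm y)\<^sup>2))"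
    proof (cases "y \<in> A")
      case True
      then have "\<delta>\<^sup>2 \<le> (norm y)\<^sup>2" using far \<delta> by (intro power_mono) auto
      then have "?k \<le> min 1 ((norm y)\<^sup>2)" by auto
      then have "1 \<le> 1 / ?k * min 1 ((norm y)\<^sup>2)" using k by (simp add: field_simps)
      then have "ennreal 1 \<le> ennreal (1 / ?k * min 1 ((norm y)\<^sup>2))" by (rule ennreal_leI)
      also have "\<dots> = ennreal (1 / ?k) * ennreal (min 1 ((norm y)\<^sup>2))" using k by (intro ennreal_mult) auto
      finally show ?thesis using True by simp
    qed simp
  qed
  also have "\<dots> = ennreal (1 / ?k) * mass t"
    unfolding mass_def by (rule nn_integral_cmult) (simp add: measurable_nu[OF t])
  finally show 1: "emeasure (\<nu> t) A \<le> ennreal (1 / ?k) * mass t" .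
  also have "\<dots> < \<infinity>" using mass_finite[OF t] by (simp add: ennreal_mult_less_top)
  finally show "emeasure (\<nu> t) A < \<infinity>" .
qed

text \<open>
  Away from 0 the measure is finite on complements of balls, and the origin itself is a null set.
\<close>

lemma nu_sigma_finite:
  assumes t: "t \<in> {0<..<T}"
  shows "sigma_finite_measure (\<nu> t)"
proof
  let ?A = "\<lambda>k :: nat. {y :: real ^ 'n. 1 / real (Suc k) \<le> norm y}"
  have cover: "\<Union> (insert {0} (range ?A)) = UNIV"
  proof -
    have "\<exists>k :: nat. 1 / real (Suc k) \<le> norm y" if "y \<noteq> 0" for y :: "real ^ 'n"
      using nat_approx_posE[of "norm y"] that by (metis less_imp_le zero_less_norm_iff)
    then show ?thesis by auto
  qed
  have sets: "?A k \<in> sets borel" for k by measurable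
  have "emeasure (\<nu> t) (?A k) \<noteq> \<infinity>" for k
    using nu_far(2)[OF t sets[of k], where \<delta> = "1 / real (Suc k)"] by auto
  moreover have "emeasure (\<nu> t) {0} = 0" using levy t by (auto simp: levy_family_def)
  moreover have "space (\<nu> t) = UNIV" using sets_eq_imp_space_eq[OF sets_nu[OF t]] by simp
  ultimately show "\<exists>A. countable A \<and> A \<subseteq> sets (\<nu> t) \<and> \<Union> A = space (\<nu> t) \<and> (\<forall>a\<in>A. emeasure (\<nu> t) a \<noteq> \<infinity>)"
    using cover sets sets_nu[OF t] by (intro exI[of _ "insert {0} (range ?A)"]) auto
qed

lemma measure_nu_integrable:
  assumes A: "A \<in> sets borel" and far: "\<And>y. y \<in> A \<Longrightarrow> \<delta> \<le> norm y" and \<delta>: "0 < \<delta>"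
  shows "set_integrable lborel {0<..<T} (\<lambda>t. measure (\<nu> t) A)"
proof -
  have meas: "(\<lambda>t. indicator {0<..<T} t *\<^sub>R measure (\<nu> t) A) \<in> borel_measurable borel"
  proof -
    have "(\<lambda>t. measure (\<nu> t) A) \<in> borel_measurable (restrict_space borel {0<..<T})"
      using levy A unfolding levy_family_def measure_def by (intro borel_measurable_enn2real) auto
    then show ?thesis by (subst (asm) borel_measurable_restrict_space_iff) auto
  qed
  show ?thesis
    unfolding set_integrable_def
  proof (rule integrableI_nonneg)
    have "(\<integral>\<^sup>+t. ennreal (indicator {0<..<T} t *\<^sub>R measure (\<nu> t) A) \<partial>lborel) \<le>
      (\<integral>\<^sup>+t. ennreal (1 / min 1 (\<delta>\<^sup>2)) * (mass t * indicator {0<..<T} t) \<partial>lborel)"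
    proof (rule nn_integral_mono)
      fix t
      show "ennreal (indicator {0<..<T} t *\<^sub>R measure (\<nu> t) A) \<le> ennreal (1 / min 1 (\<delta>\<^sup>2)) * (mass t * indicator {0<..<T} t)"
      proof (cases "t \<in> {0<..<T}")
        case True
        then have "ennreal (measure (\<nu> t) A) = emeasure (\<nu> t) A"
          using nu_far(2)[OF True A far \<delta>] by (intro emeasure_eq_ennreal_measure[symmetric]) auto
        then show ?thesis using True nu_far(1)[OF True A far \<delta>] by simp
      qed simp
    qed
    also have "\<dots> = ennreal (1 / min 1 (\<delta>\<^sup>2)) * (\<integral>\<^sup>+t\<in>{0<..<T}. mass t \<partial>lborel)"
      by (rule nn_integral_cmult)
         (use mass_measurable in \<open>simp add: borel_measurable_restrict_space_iff_ennreal\<close>)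
    also have "\<dots> < \<infinity>" using mass_integral_finite by (simp add: ennreal_mult_less_top)
    finally show "(\<integral>\<^sup>+t. ennreal (indicator {0<..<T} t *\<^sub>R measure (\<nu> t) A) \<partial>lborel) < \<infinity>" .
  qed (use meas in auto)
qed

text \<open>
  The indices of the discretised jump operator: every nonzero value \<open>z\<close> of \<open>q\<close> gives one jump \<open>z\<close>, tagged
  \<open>False\<close>, and one compensating jump \<open>- z / m\<close>, tagged \<open>True\<close>.
\<close>

definition jump_indices :: "(real ^ 'n \<Rightarrow> real ^ 'n) \<Rightarrow> ((real ^ 'n) \<times> bool) set" where
  "jump_indices q = (range q - {0}) \<times> UNIV"

definition jump_rate :: "real \<Rightarrow> (real ^ 'n \<Rightarrow> real ^ 'n) \<Rightarrow> (real ^ 'n) \<times> bool \<Rightarrow> real \<Rightarrow> real" where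
  "jump_rate m q j s = (case j of (z, compensating) \<Rightarrow>
     if compensating then m * measure (\<nu> s) {y. norm y \<le> 1 \<and> q y = z} else measure (\<nu> s) {y. q y = z})"

definition jump_shift :: "real \<Rightarrow> (real ^ 'n) \<times> bool \<Rightarrow> real ^ 'n" where
  "jump_shift m j = (case j of (z, compensating) \<Rightarrow> if compensating then (- (1 / m)) *\<^sub>R z else z)"

context
  fixes m :: real and q :: "real ^ 'n \<Rightarrow> real ^ 'n" and \<delta> :: real
  assumes m: "1 \<le> m" and q[measurable]: "q \<in> borel_measurable borel" and fin: "finite (range q)"
    and q_le: "\<And>y. norm (q y) \<le> 2 * norm y" and \<delta>: "0 < \<delta>" and q_near: "\<And>y. norm y < \<delta> \<Longrightarrow> q y = 0"
begin

lemma level_sets: 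
  "{y. q y = z} \<in> sets borel" "{y. norm y \<le> 1 \<and> q y = z} \<in> sets borel"
  by measurable

lemma level_far: "z \<noteq> 0 \<Longrightarrow> q y = z \<Longrightarrow> \<delta> \<le> norm y"
  using q_near[of y] by (cases "norm y < \<delta>") auto

lemma finite_jump_indices: "finite (jump_indices q)"
  using fin by (simp add: jump_indices_def)

lemma jump_rate_integrable:
  assumes "j \<in> jump_indices q"
  shows "set_integrable lborel {0<..<T} (jump_rate m q j)"
proof -
  obtain z c where j: "j = (z, c)" "z \<noteq> 0" using assms by (auto simp: jump_indices_def)
  have "set_integrable lborel {0<..<T} (\<lambda>s. measure (\<nu> s) {y. q y = z})"
    "set_integrable lborel {0<..<T} (\<lambda>s. m * measure (\<nu> s) {y. norm y \<le> 1 \<and> q y = z})"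
    by (intro set_integrable_mult_right measure_nu_integrable[OF level_sets(1) _ \<delta>] measure_nu_integrable[OF level_sets(2) _ \<delta>];
        use level_far[OF j(2)] in auto)+
  then show ?thesis by (cases c) (simp_all add: jump_rate_def[abs_def] j)
qed

lemma jump_rate_nonneg: "0 \<le> jump_rate m q j s"
  using m by (simp add: jump_rate_def split: prod.split)

lemma discrete_kernel_integrable:
  assumes t: "t \<in> {0<..<T}" and \<phi>: "\<phi> \<in> test_fun"
  shows "integrable (\<nu> t) (\<lambda>y. discrete_kernel m (q y) \<phi> x y)" "integrable (\<nu> t) (jump_kernel \<phi> x)"
proof -
  obtain C where C: "0 < C"
    "\<And>m z x y. 1 \<le> m \<Longrightarrow> norm z \<le> 2 * norm y \<Longrightarrow> \<bar>discrete_kernel m z \<phi> x y\<bar> \<le> C * min 1 ((norm y)\<^sup>2)"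
    "\<And>x y. \<bar>jump_kernel \<phi> x y\<bar> \<le> C * min 1 ((norm y)\<^sup>2)"
    using kernel_bounds[OF \<phi>] by blast
  show "integrable (\<nu> t) (\<lambda>y. discrete_kernel m (q y) \<phi> x y)"
    using measurable_compose[OF measurable_Pair1'[of x borel borel] kernel_measurable(1)[OF \<phi> q, of m]] C(2)[OF m q_le]
    by (intro nu_integrable[OF t]) auto
  show "integrable (\<nu> t) (jump_kernel \<phi> x)"
    using measurable_compose[OF measurable_Pair1'[of x borel borel] kernel_measurable(2)[OF \<phi> q]] C(3)
    by (intro nu_integrable[OF t]) auto
qed

text \<open>
  Sort the points \<open>y\<close> by the value of \<open>q\<close>; where \<open>q\<close> vanishes, so does the kernel.
\<close>

lemma jump_gen_discrete_kernel:
  assumes t: "t \<in> {0<..<T}"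
  shows "jump_gen (jump_indices q) (jump_rate m q) (jump_shift m) t \<phi> x = (LINT y|\<nu> t. discrete_kernel m (q y) \<phi> x y)"
proof -
  let ?Z = "range q - {0}"
  let ?A = "\<lambda>z. {y. q y = z}" and ?B = "\<lambda>z. {y. norm y \<le> 1 \<and> q y = z}"
  let ?D = "\<lambda>w. \<phi> (x + w) - \<phi> x"
  have kernel: "discrete_kernel m (q y) \<phi> x y = 
    (\<Sum>z\<in>?Z. indicator (?A z) y * ?D z + indicator (?B z) y * (m * ?D ((- (1 / m)) *\<^sub>R z)))" for y
  proof (cases "q y = 0")
    case True
    then show ?thesis by (auto simp: discrete_kernel_def indicator_def intro!: sum.neutral)
  next
    case False
    have "(\<Sum>z\<in>?Z. indicator (?A z) y * ?D z + indicator (?B z) y * (m * ?D ((- (1 / m)) *\<^sub>R z))) =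
      (\<Sum>z\<in>{q y}. indicator (?A z) y * ?D z + indicator (?B z) y * (m * ?D ((- (1 / m)) *\<^sub>R z)))"
      by (rule sum.mono_neutral_right) (use fin False in \<open>auto simp: indicator_def\<close>)
    also have "\<dots> = discrete_kernel m (q y) \<phi> x y" by (simp add: discrete_kernel_def indicator_def)
    finally show ?thesis by simp
  qed
  have ind: "integrable (\<nu> t) (indicator (?A z) :: _ \<Rightarrow> real)" "integrable (\<nu> t) (indicator (?B z) :: _ \<Rightarrow> real)" if z: "z \<in> ?Z" for z
    using nu_far(2)[OF t level_sets(1) _ \<delta>, of z] nu_far(2)[OF t level_sets(2) _ \<delta>, of z] level_far[of z] z level_sets[of z] sets_nu[OF t]
    by (auto intro!: integrable_real_indicator)
  have sp: "space (\<nu> t) = UNIV" using sets_eq_imp_space_eq[OF sets_nu[OF t]] by simp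
  have "(LINT y|\<nu> t. discrete_kernel m (q y) \<phi> x y) = 
    (\<Sum>z\<in>?Z. (LINT y|\<nu> t. indicator (?A z) y * ?D z + indicator (?B z) y * (m * ?D ((- (1 / m)) *\<^sub>R z))))"
    unfolding kernel
    by (rule Bochner_Integration.integral_sum) (intro Bochner_Integration.integrable_add integrable_mult_left ind)
  also have "\<dots> = (\<Sum>z\<in>?Z. measure (\<nu> t) (?A z) * ?D z + measure (\<nu> t) (?B z) * (m * ?D ((- (1 / m)) *\<^sub>R z)))"
  proof (rule sum.cong[OF refl])
    fix z assume z: "z \<in> ?Z"
    have "(LINT y|\<nu> t. indicator (?A z) y * ?D z + indicator (?B z) y * (m * ?D ((- (1 / m)) *\<^sub>R z))) = 
      (LINT y|\<nu> t. indicator (?A z) y * ?D z) + (LINT y|\<nu> t. indicator (?B z) y * (m * ?D ((- (1 / m)) *\<^sub>R z)))"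
      by (intro Bochner_Integration.integral_add integrable_mult_left ind z)
    then show "(LINT y|\<nu> t. indicator (?A z) y * ?D z + indicator (?B z) y * (m * ?D ((- (1 / m)) *\<^sub>R z))) = 
      measure (\<nu> t) (?A z) * ?D z + measure (\<nu> t) (?B z) * (m * ?D ((- (1 / m)) *\<^sub>R z))"
      using level_sets[of z] sets_nu[OF t] by (simp add: sp)
  qed
  also have "\<dots> = (\<Sum>z\<in>?Z. \<Sum>c\<in>UNIV. jump_rate m q (z, c) t * ?D (jump_shift m (z, c)))"
    by (simp add: UNIV_bool jump_rate_def jump_shift_def mult_ac)
  also have "\<dots> = jump_gen (jump_indices q) (jump_rate m q) (jump_shift m) t \<phi> x"
    unfolding jump_gen_def jump_indices_def by (subst sum.cartesian_product) (simp add: case_prod_beta')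
  finally show ?thesis by simp
qed

end

text \<open>
  For fixed \<open>s\<close>, Tonelli's theorem bounds the \<open>L\<^sub>1\<close> distance \<open>E n s\<close> by the integral over \<open>y\<close> of the \<open>L\<^sub>1\<close>
  norms in \<open>x\<close> of the kernel differences. These tend to 0 and are dominated by \<open>C min 1 \<bar>y\<bar>\<^sup>2\<close>. So
  \<open>E n s\<close> tends to 0 and is dominated by a multiple of the total mass of \<open>min 1 \<bar>y\<bar>\<^sup>2\<close>, which is
  integrable in time. Joint measurability of the jump operator in \<open>(s, x)\<close> is inherited
  from the discretisations, which converge pointwise.
\<close>

lemma discretisation_L1_convergence:
  fixes q :: "nat \<Rightarrow> real ^ 'n \<Rightarrow> real ^ 'n"
  assumes q: "\<And>n. q n \<in> borel_measurable borel" "\<And>n. finite (range (q n))"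
    "\<And>n y. norm (q n y) \<le> 2 * norm y" "\<And>y. (\<lambda>n. q n y) \<longlonglongrightarrow> y"
    "\<And>n y. norm y < 1 / Suc n \<Longrightarrow> q n y = 0"
    and \<phi>: "\<phi> \<in> test_fun"
  defines "G \<equiv> \<lambda>n. jump_gen (jump_indices (q n)) (jump_rate (real (Suc n)) (q n)) (jump_shift (real (Suc n)))"
  assumes G: "\<And>n. set_integrable lborel (open_slab T) (\<lambda>(s, x). G n s \<phi> x)"
  shows "set_integrable lborel (open_slab T) (\<lambda>(s, x). jump_op (\<nu> s) \<phi> x)"
    and "(\<lambda>n. LINT (s, x):open_slab T|lborel. \<bar>G n s \<phi> x - jump_op (\<nu> s) \<phi> x\<bar>) \<longlonglongrightarrow> 0"
proof -
  let ?m = "\<lambda>n. real (Suc n)"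
  let ?O = "open_slab T :: (real \<times> (real ^ 'n)) set"
  have m: "1 \<le> ?m n" for n by simp
  have near: "0 < 1 / real (Suc n)" for n by simp
  have G_kernel: "G n t \<phi> x = (LINT y|\<nu> t. discrete_kernel (?m n) (q n y) \<phi> x y)" if "t \<in> {0<..<T}" for n t x
    unfolding G_def by (rule jump_gen_discrete_kernel[OF m q(1,2,3) near q(5) that])
  have dint: "integrable (\<nu> t) (\<lambda>y. discrete_kernel (?m n) (q n y) \<phi> x y)" if "t \<in> {0<..<T}" for n t x
    by (rule discrete_kernel_integrable(1)[OF m q(1,2,3) near q(5) that \<phi>])
  have jint: "integrable (\<nu> t) (jump_kernel \<phi> x)" if "t \<in> {0<..<T}" for t x
    by (rule discrete_kernel_integrable(2)[OF m q(1,2,3) near q(5)[of _ 0] that \<phi>])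
  have qmeas: "(\<lambda>y. discrete_kernel (?m n) (q n y) \<phi> x y) \<in> borel_measurable borel" for n x
    using measurable_compose[OF measurable_Pair1'[of x borel borel] kernel_measurable(1)[OF \<phi> q(1), of "?m n" n]] by simp
  have jmeas: "(\<lambda>y. jump_kernel \<phi> x y) \<in> borel_measurable borel" for x
    using measurable_compose[OF measurable_Pair1'[of x borel borel] kernel_measurable(2)[OF \<phi> q(1)]] by simp
  obtain C0 where C0: "0 < C0"
    "\<And>m z x y. 1 \<le> m \<Longrightarrow> norm z \<le> 2 * norm y \<Longrightarrow> \<bar>discrete_kernel m z \<phi> x y\<bar> \<le> C0 * min 1 ((norm y)\<^sup>2)"
    "\<And>x y. \<bar>jump_kernel \<phi> x y\<bar> \<le> C0 * min 1 ((norm y)\<^sup>2)"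
    using kernel_bounds[OF \<phi>] by blast
  obtain C where C: "0 < C"
    "\<And>m z y. 1 \<le> m \<Longrightarrow> norm z \<le> 2 * norm y \<Longrightarrow> 
      (\<integral>\<^sup>+x. ennreal \<bar>discrete_kernel m z \<phi> x y - jump_kernel \<phi> x y\<bar> \<partial>lborel) \<le> ennreal (C * min 1 ((norm y)\<^sup>2))"
    "\<And>z y. (\<And>n. norm (z n) \<le> 2 * norm y) \<Longrightarrow> z \<longlonglongrightarrow> y \<Longrightarrow>
      (\<lambda>n. \<integral>\<^sup>+x. ennreal \<bar>discrete_kernel (real (Suc n)) (z n) \<phi> x y - jump_kernel \<phi> x y\<bar> \<partial>lborel) \<longlonglongrightarrow> 0"
    using kernel_difference_L1[OF \<phi>] by blast
  have pointwise: "(\<lambda>n. G n t \<phi> x) \<longlonglongrightarrow> jump_op (\<nu> t) \<phi> x" if t: "t \<in> {0<..<T}" for t x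
    unfolding G_kernel[OF t] jump_op_kernel
  proof (rule integral_dominated_convergence)
    show "integrable (\<nu> t) (\<lambda>y. C0 * min 1 ((norm y)\<^sup>2))"
      by (rule nu_integrable[OF t, of _ C0]) (use C0(1) in \<open>auto simp: abs_mult\<close>)
    show "AE y in \<nu> t. (\<lambda>n. discrete_kernel (?m n) (q n y) \<phi> x y) \<longlonglongrightarrow> jump_kernel \<phi> x y"
      by (intro AE_I2 kernel_tendsto \<phi> q)
    show "AE y in \<nu> t. norm (discrete_kernel (?m n) (q n y) \<phi> x y) \<le> C0 * min 1 ((norm y)\<^sup>2)" for n
      using C0(2)[OF m q(3)] by (intro AE_I2) simp
  qed (use qmeas jmeas in \<open>simp_all add: measurable_nu[OF t]\<close>)
  define g where "g n p = indicator ?O p *\<^sub>R (case p of (s, x) \<Rightarrow> G n s \<phi> x)" for n p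
  define j where "j p = indicator ?O p *\<^sub>R (case p of (s, x) \<Rightarrow> jump_op (\<nu> s) \<phi> x)" for p
  have g_int: "integrable lborel (g n)" for n using G[of n] unfolding set_integrable_def g_def .
  have [measurable]: "g n \<in> borel_measurable (lborel \<Otimes>\<^sub>M lborel)" for n
    using borel_measurable_integrable[OF g_int] unfolding lborel_prod .
  have gj: "(\<lambda>n. g n p) \<longlonglongrightarrow> j p" for p
  proof (cases "p \<in> ?O")
    case True
    then show ?thesis using pointwise[of "fst p" "snd p"] by (auto simp: g_def j_def case_prod_beta')
  qed (simp add: g_def j_def)
  have [measurable]: "j \<in> borel_measurable (lborel \<Otimes>\<^sub>M lborel)"
    by (rule borel_measurable_LIMSEQ_real[OF gj]) measurable
  define E where "E n s = (\<integral>\<^sup>+x. ennreal \<bar>g n (s, x) - j (s, x)\<bar> \<partial>lborel)" for n s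
  define w where "w s = ennreal C * (mass s * indicator {0<..<T} s)" for s
  have w_meas[measurable]: "w \<in> borel_measurable lborel"
  proof -
    have [measurable]: "(\<lambda>s. mass s * indicator {0<..<T} s) \<in> borel_measurable borel"
      using mass_measurable by (subst (asm) borel_measurable_restrict_space_iff_ennreal) auto
    show ?thesis unfolding w_def by measurable
  qed
  have w_fin: "(\<integral>\<^sup>+s. w s \<partial>lborel) < \<infinity>"
  proof -
    have "(\<lambda>s. mass s * indicator {0<..<T} s) \<in> borel_measurable borel"
      using mass_measurable by (subst (asm) borel_measurable_restrict_space_iff_ennreal) auto
    then have "(\<integral>\<^sup>+s. w s \<partial>lborel) = ennreal C * (\<integral>\<^sup>+s\<in>{0<..<T}. mass s \<partial>lborel)"
      unfolding w_def by (intro nn_integral_cmult) simp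
    then show ?thesis using mass_integral_finite by (simp add: ennreal_mult_less_top)
  qed
  have E_meas[measurable]: "E n \<in> borel_measurable lborel" for n
    unfolding E_def by measurable
  have E_zero: "E n s = 0" if "s \<notin> {0<..<T}" for n s
    using that by (simp add: E_def g_def j_def)
  have E_le: "E n t \<le> (\<integral>\<^sup>+y. (\<integral>\<^sup>+x. ennreal \<bar>discrete_kernel (?m n) (q n y) \<phi> x y - jump_kernel \<phi> x y\<bar> \<partial>lborel) \<partial>\<nu> t)"
    if t: "t \<in> {0<..<T}" for n t
  proof -
    let ?\<Delta> = "\<lambda>x y. discrete_kernel (?m n) (q n y) \<phi> x y - jump_kernel \<phi> x y"
    interpret nu: sigma_finite_measure "\<nu> t" by (rule nu_sigma_finite[OF t])
    interpret P: pair_sigma_finite "lborel :: (real ^ 'n) measure" "\<nu> t" ..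
    have "E n t \<le> (\<integral>\<^sup>+x. (\<integral>\<^sup>+y. ennreal \<bar>?\<Delta> x y\<bar> \<partial>\<nu> t) \<partial>lborel)"
      unfolding E_def
    proof (rule nn_integral_mono)
      fix x :: "real ^ 'n"
      have "g n (t, x) - j (t, x) = (LINT y|\<nu> t. ?\<Delta> x y)"
        using t dint[OF t, of n x] jint[OF t, of x] by (simp add: g_def j_def G_kernel jump_op_kernel)
      then show "ennreal \<bar>g n (t, x) - j (t, x)\<bar> \<le> (\<integral>\<^sup>+y. ennreal \<bar>?\<Delta> x y\<bar> \<partial>\<nu> t)"
        using integral_norm_bound_ennreal[of "\<nu> t" "?\<Delta> x"] dint[OF t, of n x] jint[OF t, of x] by simp
    qed
    also have "\<dots> = (\<integral>\<^sup>+y. (\<integral>\<^sup>+x. ennreal \<bar>?\<Delta> x y\<bar> \<partial>lborel) \<partial>\<nu> t)"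
    proof (rule P.Fubini'[symmetric])
      have "(\<lambda>(x, y). ennreal \<bar>?\<Delta> x y\<bar>) \<in> borel_measurable (borel \<Otimes>\<^sub>M borel)"
        using kernel_measurable(1)[OF \<phi> q(1), of "?m n" n] kernel_measurable(2)[OF \<phi> q(1)]
        by (simp add: case_prod_beta')
      also have "borel_measurable (borel \<Otimes>\<^sub>M borel) = borel_measurable (lborel \<Otimes>\<^sub>M \<nu> t)"
        by (intro measurable_cong_sets sets_pair_measure_cong) (use sets_nu[OF t] in auto)
      finally show "(\<lambda>(x, y). ennreal \<bar>?\<Delta> x y\<bar>) \<in> borel_measurable (lborel \<Otimes>\<^sub>M \<nu> t)" .
    qed
    finally show ?thesis .
  qed
  have E_bound: "E n t \<le> w t" for n t
  proof (cases "t \<in> {0<..<T}")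
    case True
    note E_le[OF True, of n]
    also have "(\<integral>\<^sup>+y. (\<integral>\<^sup>+x. ennreal \<bar>discrete_kernel (?m n) (q n y) \<phi> x y - jump_kernel \<phi> x y\<bar> \<partial>lborel) \<partial>\<nu> t)
      \<le> (\<integral>\<^sup>+y. ennreal C * ennreal (min 1 ((norm y)\<^sup>2)) \<partial>\<nu> t)"
      using C(1) C(2)[OF m q(3)] by (intro nn_integral_mono) (simp add: ennreal_mult)
    also have "\<dots> = ennreal C * mass t"
      unfolding mass_def by (rule nn_integral_cmult) (simp add: measurable_nu[OF True])
    finally show ?thesis using True by (simp add: w_def)
  qed (simp add: E_zero)
  have E_lim: "(\<lambda>n. E n t) \<longlonglongrightarrow> 0" for t
  proof (cases "t \<in> {0<..<T}")
    case True
    let ?H = "\<lambda>n y. \<integral>\<^sup>+x. ennreal \<bar>discrete_kernel (?m n) (q n y) \<phi> x y - jump_kernel \<phi> x y\<bar> \<partial>lborel"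
    have "(\<lambda>n. \<integral>\<^sup>+y. ?H n y \<partial>\<nu> t) \<longlonglongrightarrow> (\<integral>\<^sup>+y. 0 \<partial>\<nu> t)"
    proof (rule nn_integral_dominated_convergence[where w = "\<lambda>y. ennreal C * ennreal (min 1 ((norm y)\<^sup>2))"])
      fix n
      have "(\<lambda>(y, x). ennreal \<bar>discrete_kernel (?m n) (q n y) \<phi> x y - jump_kernel \<phi> x y\<bar>) \<in> borel_measurable (borel \<Otimes>\<^sub>M lborel)"
        using measurable_compose[OF measurable_pair_swap' kernel_measurable(1)[OF \<phi> q(1), of "?m n" n]]
          measurable_compose[OF measurable_pair_swap' kernel_measurable(2)[OF \<phi> q(1)]]
        by (simp add: case_prod_beta')
      then have "?H n \<in> borel_measurable borel" by (rule lborel.borel_measurable_nn_integral)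
      then show "?H n \<in> borel_measurable (\<nu> t)" by (simp add: measurable_nu[OF True])
      show "AE y in \<nu> t. ?H n y \<le> ennreal C * ennreal (min 1 ((norm y)\<^sup>2))"
        using C(1) C(2)[OF m q(3)] by (intro AE_I2) (simp add: ennreal_mult)
    next
      have "(\<integral>\<^sup>+y. ennreal C * ennreal (min 1 ((norm y)\<^sup>2)) \<partial>\<nu> t) = ennreal C * mass t"
        unfolding mass_def by (rule nn_integral_cmult) (simp add: measurable_nu[OF True])
      then show "(\<integral>\<^sup>+y. ennreal C * ennreal (min 1 ((norm y)\<^sup>2)) \<partial>\<nu> t) < \<infinity>"
        using mass_finite[OF True] by (simp add: ennreal_mult_less_top)
      show "AE y in \<nu> t. (\<lambda>n. ?H n y) \<longlonglongrightarrow> 0"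
        by (rule AE_I2) (rule C(3)[OF q(3,4)])
    qed (simp_all add: measurable_nu[OF True])
    then have H0: "(\<lambda>n. \<integral>\<^sup>+y. ?H n y \<partial>\<nu> t) \<longlonglongrightarrow> 0" by simp
    show ?thesis
      by (rule tendsto_sandwich[OF _ _ tendsto_const H0]) (use E_le[OF True] in auto)
  qed (simp add: E_zero)
  have "(\<lambda>n. \<integral>\<^sup>+s. E n s \<partial>lborel) \<longlonglongrightarrow> (\<integral>\<^sup>+s. 0 \<partial>(lborel :: real measure))"
    by (rule nn_integral_dominated_convergence[where w = w]) (use w_fin E_bound E_lim in auto)
  then have lim: "(\<lambda>n. \<integral>\<^sup>+s. E n s \<partial>lborel) \<longlonglongrightarrow> 0" by simp
  have fub: "(\<integral>\<^sup>+p. ennreal \<bar>g n p - j p\<bar> \<partial>lborel) = (\<integral>\<^sup>+s. E n s \<partial>lborel)" for n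
  proof -
    have "(\<lambda>p. ennreal \<bar>g n p - j p\<bar>) \<in> borel_measurable (lborel \<Otimes>\<^sub>M lborel)" by measurable
    from lborel.nn_integral_fst[OF this] show ?thesis unfolding E_def lborel_prod by simp
  qed
  have gj_int: "integrable lborel (\<lambda>p. g n p - j p)" for n
  proof (rule integrableI_bounded)
    have "(\<lambda>p. g n p - j p) \<in> borel_measurable (lborel \<Otimes>\<^sub>M lborel)" by measurable
    then show "(\<lambda>p. g n p - j p) \<in> borel_measurable lborel" unfolding lborel_prod .
    have "(\<integral>\<^sup>+s. E n s \<partial>lborel) \<le> (\<integral>\<^sup>+s. w s \<partial>lborel)" by (intro nn_integral_mono E_bound)
    then show "(\<integral>\<^sup>+p. ennreal (norm (g n p - j p)) \<partial>lborel) < \<infinity>"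
      using w_fin fub[of n] by (simp add: order_le_less_trans)
  qed
  have "integrable lborel (\<lambda>p. g 0 p - (g 0 p - j p))" by (intro Bochner_Integration.integrable_diff g_int gj_int)
  then show "set_integrable lborel (open_slab T) (\<lambda>(s, x). jump_op (\<nu> s) \<phi> x)"
    unfolding set_integrable_def by (simp add: j_def)
  have "ennreal (LINT (s, x):?O|lborel. \<bar>G n s \<phi> x - jump_op (\<nu> s) \<phi> x\<bar>) = (\<integral>\<^sup>+s. E n s \<partial>lborel)" for n
  proof -
    have "(LINT (s, x):?O|lborel. \<bar>G n s \<phi> x - jump_op (\<nu> s) \<phi> x\<bar>) = (LINT p|lborel. \<bar>g n p - j p\<bar>)"
      unfolding set_lebesgue_integral_def g_def j_def
      by (rule Bochner_Integration.integral_cong) (auto simp: indicator_def)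
    then show ?thesis unfolding fub[symmetric] using gj_int[of n] by (simp add: nn_integral_eq_integral)
  qed
  then have "(\<lambda>n. ennreal (LINT (s, x):?O|lborel. \<bar>G n s \<phi> x - jump_op (\<nu> s) \<phi> x\<bar>)) \<longlonglongrightarrow> ennreal 0"
    using lim by simp
  moreover have "0 \<le> (LINT (s, x):?O|lborel. \<bar>G n s \<phi> x - jump_op (\<nu> s) \<phi> x\<bar>)" for n
    unfolding set_lebesgue_integral_def by (rule Bochner_Integration.integral_nonneg) (auto simp: indicator_def)
  ultimately show "(\<lambda>n. LINT (s, x):open_slab T|lborel. \<bar>G n s \<phi> x - jump_op (\<nu> s) \<phi> x\<bar>) \<longlonglongrightarrow> 0"
    by (subst (asm) tendsto_ennreal_iff) auto
qed

end

section \<open>The perturbed equation\<close>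

text \<open>
  Solutions are bounded by \<open>K\<close>, so replacing one operator by another costs at most \<open>K\<close> times their \<open>L\<^sub>1\<close>
  distance on the slab: exact solutions for \<open>B n\<close> are approximate solutions for \<open>A\<close>.
\<close>

lemma (in translation_family) exists_solution_by_approximation:
  assumes h: "h \<in> bounded_borel_on {0<..<T}"
    and B: "\<And>n \<zeta>. \<zeta> \<in> test_fun \<Longrightarrow> set_integrable lborel (open_slab T) (\<lambda>(s, x). B n s \<zeta> x)"
    and A: "\<And>\<zeta>. \<zeta> \<in> test_fun \<Longrightarrow> set_integrable lborel (open_slab T) (\<lambda>(s, x). A s \<zeta> x)"
    and lim: "\<And>\<zeta>. \<zeta> \<in> test_fun \<Longrightarrow> (\<lambda>n. LINT (s, x):open_slab T|lborel. \<bar>B n s \<zeta> x - A s \<zeta> x\<bar>) \<longlonglongrightarrow> 0"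
    and u: "\<And>n. u n \<in> W" "\<And>n \<zeta> t. \<zeta> \<in> test_fun \<Longrightarrow> t \<in> {0..T} \<Longrightarrow>
      residual (\<lambda>s \<phi> x. L s \<phi> x + B n s \<phi> x) (u n) t \<zeta> = source u0 f h t \<zeta>"
  obtains w where "w \<in> W" "\<And>\<zeta> t. \<zeta> \<in> test_fun \<Longrightarrow> t \<in> {0..T} \<Longrightarrow>
      residual (\<lambda>s \<phi> x. L s \<phi> x + A s \<phi> x) w t \<zeta> = source u0 f h t \<zeta>"
proof -
  let ?A = "\<lambda>s \<phi> x. L s \<phi> x + A s \<phi> x"
  have LA: "set_integrable lborel (open_slab T) (\<lambda>(s, x). ?A s \<zeta> x)" if \<zeta>: "\<zeta> \<in> test_fun" for \<zeta>
    using set_integral_add(1)[OF L_integrable[OF \<zeta>] A[OF \<zeta>]] by (simp add: case_prod_beta')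
  have res: "(\<lambda>n. residual ?A (u n) t \<zeta>) \<longlonglongrightarrow> source u0 f h t \<zeta>" if \<zeta>: "\<zeta> \<in> test_fun" and t: "t \<in> {0..T}" for \<zeta> t
  proof -
    let ?D = "\<lambda>n p. case p of (s, x) \<Rightarrow> B n s \<zeta> x - A s \<zeta> x"
    let ?S = "ival 0 t \<times> UNIV :: (real \<times> (real ^ 'n)) set"
    have tT: "t \<le> T" using t by simp
    have D: "set_integrable lborel (open_slab T) (?D n)" for n
      using set_integral_diff(1)[OF B[OF \<zeta>, of n] A[OF \<zeta>]] by (simp add: case_prod_beta')
    have LB: "set_integrable lborel (open_slab T) (\<lambda>(s, x). L s \<zeta> x + B n s \<zeta> x)" for n
      using set_integral_add(1)[OF L_integrable[OF \<zeta>] B[OF \<zeta>]] by (simp add: case_prod_beta')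
    have eq: "residual ?A (u n) t \<zeta> = source u0 f h t \<zeta> + (LINT p:?S|lborel. u n p * ?D n p)" for n
    proof -
      have i1: "set_integrable lborel ?S (\<lambda>p. u n p * (case p of (s, x) \<Rightarrow> ?A s \<zeta> x))"
        by (rule set_integrable_slab[OF W_mult_integrable[OF u(1) LA[OF \<zeta>]] tT])
      have i2: "set_integrable lborel ?S (\<lambda>p. u n p * ?D n p)"
        by (rule set_integrable_slab[OF W_mult_integrable[OF u(1) D] tT])
      have "(LINT p:?S|lborel. u n p * (case p of (s, x) \<Rightarrow> L s \<zeta> x + B n s \<zeta> x)) = 
        (LINT p:?S|lborel. u n p * (case p of (s, x) \<Rightarrow> ?A s \<zeta> x) + u n p * ?D n p)"
        by (rule set_lebesgue_integral_cong) (auto simp: algebra_simps)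
      also have "\<dots> = (LINT p:?S|lborel. u n p * (case p of (s, x) \<Rightarrow> ?A s \<zeta> x)) + (LINT p:?S|lborel. u n p * ?D n p)"
        by (rule set_integral_add(2)[OF i1 i2])
      finally show ?thesis
        using u(2)[OF \<zeta> t, of n] unfolding residual_eq by simp
    qed
    have "(\<lambda>n. LINT p:?S|lborel. u n p * ?D n p) \<longlonglongrightarrow> 0"
    proof (rule tendsto_rabs_zero_cancel, rule tendsto_sandwich[OF _ _ tendsto_const])
      have "(\<lambda>n. \<bar>K\<bar> * (LINT (s, x):open_slab T|lborel. \<bar>B n s \<zeta> x - A s \<zeta> x\<bar>)) \<longlonglongrightarrow> \<bar>K\<bar> * 0"
        by (intro tendsto_intros lim[OF \<zeta>])
      then show "(\<lambda>n. \<bar>K\<bar> * (LINT (s, x):open_slab T|lborel. \<bar>B n s \<zeta> x - A s \<zeta> x\<bar>)) \<longlonglongrightarrow> 0" by simp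
      show "\<forall>\<^sub>F n in sequentially. \<bar>LINT p:?S|lborel. u n p * ?D n p\<bar> \<le> \<bar>K\<bar> * (LINT (s, x):open_slab T|lborel. \<bar>B n s \<zeta> x - A s \<zeta> x\<bar>)"
      proof (rule always_eventually, rule allI)
        fix n
        have KD: "set_integrable lborel (open_slab T) (\<lambda>p. \<bar>K\<bar> * \<bar>?D n p\<bar>)"
          by (intro set_integrable_mult_right set_integrable_abs D)
        have "\<bar>LINT p:?S|lborel. u n p * ?D n p\<bar> \<le> (LINT p:?S|lborel. \<bar>K\<bar> * \<bar>?D n p\<bar>)"
        proof (rule set_integral_abs_le[OF set_integrable_slab[OF W_mult_integrable[OF u(1) D] tT] set_integrable_slab[OF KD tT]])
          fix p assume "p \<in> ?S"
          then have "p \<in> slab T" using tT by (auto simp: ival_def)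
          from W_abs_le[OF u(1)[of n] this] have "\<bar>u n p\<bar> \<le> \<bar>K\<bar>" by simp
          then show "\<bar>u n p * ?D n p\<bar> \<le> \<bar>K\<bar> * \<bar>?D n p\<bar>" by (simp only: abs_mult mult_right_mono abs_ge_zero)
        qed
        also have "\<dots> \<le> (LINT p:open_slab T|lborel. \<bar>K\<bar> * \<bar>?D n p\<bar>)"
          unfolding set_lebesgue_integral_def
        proof (rule Bochner_Integration.integral_mono)
          show "indicator ?S p *\<^sub>R (\<bar>K\<bar> * \<bar>?D n p\<bar>) \<le> indicator (open_slab T) p *\<^sub>R (\<bar>K\<bar> * \<bar>?D n p\<bar>)" for p
            using ival_subset[OF tT, of 0] by (auto simp: indicator_def)
        qed (use KD set_integrable_slab[OF KD tT] in \<open>simp_all only: set_integrable_def\<close>)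
        also have "\<dots> = \<bar>K\<bar> * (LINT p:open_slab T|lborel. \<bar>?D n p\<bar>)" by (rule set_integral_mult_right)
        also have "(LINT p:open_slab T|lborel. \<bar>?D n p\<bar>) = (LINT (s, x):open_slab T|lborel. \<bar>B n s \<zeta> x - A s \<zeta> x\<bar>)"
          by (rule arg_cong[where f = "set_lebesgue_integral lborel (open_slab T)"]) auto
        finally show "\<bar>LINT p:?S|lborel. u n p * ?D n p\<bar> \<le> \<bar>K\<bar> * (LINT (s, x):open_slab T|lborel. \<bar>B n s \<zeta> x - A s \<zeta> x\<bar>)" .
      qed
    qed auto
    from tendsto_add[OF tendsto_const[of "source u0 f h t \<zeta>"] this] show ?thesis
      unfolding eq by simp
  qed
  obtain w where "w \<in> W" "\<And>\<zeta> t. \<zeta> \<in> test_fun \<Longrightarrow> t \<in> {0..T} \<Longrightarrow> residual ?A w t \<zeta> = source u0 f h t \<zeta>"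
    using exists_residual_limit[where A = ?A and v = u and c = "source u0 f h", OF LA u(1) res] by blast
  then show ?thesis by (rule that)
qed

theorem theorem7p1:
  fixes T K :: real
    and W :: "(real \<times> (real ^ 'n::finite) \<Rightarrow> real) set"
    and L :: "real \<Rightarrow> (real ^ 'n \<Rightarrow> real) \<Rightarrow> (real ^ 'n \<Rightarrow> real)"
    and u0 :: "real ^ 'n \<Rightarrow> real"
    and f :: "real \<times> (real ^ 'n) \<Rightarrow> real"
    and U :: "(real \<Rightarrow> real ^ 'n) \<Rightarrow> (real \<times> (real ^ 'n) \<Rightarrow> real)"
    and \<nu> :: "real \<Rightarrow> (real ^ 'n) measure"
  assumes "0 < T" and "0 \<le> K"
    and "u0 \<in> bounded_borel_on UNIV"
    and "f \<in> bounded_borel_on (open_slab T)"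
    and "W \<subseteq> borel_on (slab T)"
    and "cond_W1 T K W" and "cond_W2 T W" and "cond_W3 T W" and "cond_W4 T W"
    and "linear_operator_family T L"
    and cond_i: "\<forall>t\<in>{0<..<T}. \<forall>b. \<forall>\<phi>\<in>test_fun. translate b (L t \<phi>) = L t (translate b \<phi>)"
    (* L is given on (0,T) only; the end points form a null set *)
    and cond_ii: "\<forall>\<zeta>\<in>test_fun. set_integrable lborel (open_slab T) (\<lambda>(t, x). L t \<zeta> x)"
    and cond_iii: "\<forall>h\<in>bounded_borel_on {0<..<T}. U h \<in> W \<and> weak_solution T L u0 f h (U h)"
    (* the supremum is in general only Lebesgue measurable in r, hence lebesgue and not lborel *)
    and cond_iv: "\<forall>h'\<in>bounded_borel_on {0<..<T}. \<forall>h''\<in>bounded_borel_on {0<..<T}. \<forall>t\<in>{0..T}. \<forall>x.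
        \<bar>U h' (t, x) - U h'' (t, x)\<bar> \<le>
          K * (LINT r:{0<..<t}|lebesgue. (SUP y. \<bar>f (r, y + h' r) - f (r, y + h'' r)\<bar>))"
    and "levy_family T \<nu>"
  shows "\<forall>h\<in>bounded_borel_on {0<..<T}. \<exists>u\<in>W.
           weak_solution T (\<lambda>t \<phi> x. L t \<phi> x + jump_op (\<nu> t) \<phi> x) u0 f h u"
proof
  fix h :: "real \<Rightarrow> real ^ 'n" assume h: "h \<in> bounded_borel_on {0<..<T}"
  interpret translation_family T K W L u0 f U
    by unfold_locales (use assms in auto)
  interpret levy_measures T \<nu> by unfold_locales fact
  obtain q :: "nat \<Rightarrow> real ^ 'n \<Rightarrow> real ^ 'n" where q:
    "\<And>n. q n \<in> borel_measurable borel" "\<And>n. finite (range (q n))"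
    "\<And>n y. norm (q n y) \<le> 2 * norm y" "\<And>y. (\<lambda>n. q n y) \<longlonglongrightarrow> y"
    "\<And>n y. norm y < 1 / Suc n \<Longrightarrow> q n y = 0"
    using simple_approximation_vanishing_near_0 by blast
  define G where "G n = jump_gen (jump_indices (q n)) (jump_rate (real (Suc n)) (q n)) (jump_shift (real (Suc n)))" for n
  have m: "1 \<le> real (Suc n)" and near: "0 < 1 / real (Suc n)" for n by simp_all
  have q_near: "q n y = 0" if "norm y < 1 / real (Suc n)" for n y using q(5) that by simp
  note disc = m q(1,2,3) near q_near
  have J: "finite (jump_indices (q n))" for n
    by (rule finite_jump_indices[OF disc])
  have rate: "set_integrable lborel {0<..<T} (jump_rate (real (Suc n)) (q n) j)" if "j \<in> jump_indices (q n)" for n j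
    by (rule jump_rate_integrable[OF disc that])
  have rate0: "0 \<le> jump_rate (real (Suc n)) (q n) j s" for n j s
    by (rule jump_rate_nonneg[OF disc])
  have G: "set_integrable lborel (open_slab T) (\<lambda>(s, x). G n s \<zeta> x)" if "\<zeta> \<in> test_fun" for n \<zeta>
    unfolding G_def by (rule jump_gen_integrable[OF J rate that])
  have conv: "set_integrable lborel (open_slab T) (\<lambda>(s, x). jump_op (\<nu> s) \<zeta> x)"
    "(\<lambda>n. LINT (s, x):open_slab T|lborel. \<bar>G n s \<zeta> x - jump_op (\<nu> s) \<zeta> x\<bar>) \<longlonglongrightarrow> 0" if "\<zeta> \<in> test_fun" for \<zeta>
    unfolding G_def
    by (rule discretisation_L1_convergence[where q = q];
        (rule q that G[OF that, unfolded G_def] | assumption)+)+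
  have "\<exists>u. u \<in> W \<and> (\<forall>\<zeta>\<in>test_fun. \<forall>t\<in>{0..T}. residual (\<lambda>s \<phi> x. L s \<phi> x + G n s \<phi> x) u t \<zeta> = source u0 f h t \<zeta>)" for n
    unfolding G_def
    by (rule finite_jump_solution[where J = "jump_indices (q n)" and a = "jump_rate (real (Suc n)) (q n)"
          and b = "jump_shift (real (Suc n))", OF J rate rate0 h]) blast+
  then have "\<exists>u. \<forall>n. u n \<in> W \<and> (\<forall>\<zeta>\<in>test_fun. \<forall>t\<in>{0..T}. 
      residual (\<lambda>s \<phi> x. L s \<phi> x + G n s \<phi> x) (u n) t \<zeta> = source u0 f h t \<zeta>)"
    by (intro choice allI)
  then obtain u where u: "\<And>n. u n \<in> W" "\<And>n \<zeta> t. \<zeta> \<in> test_fun \<Longrightarrow> t \<in> {0..T} \<Longrightarrow> 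
      residual (\<lambda>s \<phi> x. L s \<phi> x + G n s \<phi> x) (u n) t \<zeta> = source u0 f h t \<zeta>"
    by blast
  obtain w where w: "w \<in> W" "\<And>\<zeta> t. \<zeta> \<in> test_fun \<Longrightarrow> t \<in> {0..T} \<Longrightarrow> 
      residual (\<lambda>s \<phi> x. L s \<phi> x + jump_op (\<nu> s) \<phi> x) w t \<zeta> = source u0 f h t \<zeta>"
    using exists_solution_by_approximation[where B = G and u = u and A = "\<lambda>s. jump_op (\<nu> s)",
        OF h G conv u] by blast
  have "set_integrable lborel (open_slab T) (\<lambda>(s, x). L s \<zeta> x + jump_op (\<nu> s) \<zeta> x)" if "\<zeta> \<in> test_fun" for \<zeta>
    using set_integral_add(1)[OF L_integrable[OF that] conv(1)[OF that]] by (simp add: case_prod_beta')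
  from weak_solution_iff_residual[of w T K "\<lambda>t \<phi> x. L t \<phi> x + jump_op (\<nu> t) \<phi> x" u0 f h,
      OF W_measurable[OF w(1)] W_abs_le[OF w(1)] this] w
  show "\<exists>u\<in>W. weak_solution T (\<lambda>t \<phi> x. L t \<phi> x + jump_op (\<nu> t) \<phi> x) u0 f h u"
    by blast
qed

end
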